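(* Let $n,l$ be positive integers and let $\alpha\in\mathbb{C}$. Then, as a $\mathcal{U}(\mathfrak{gl}_n)$-module, $$\mathcal{U}(\mathfrak{gl}_n)\cdot \det{}^{(\alpha)}(X)^l\;\cong\;\bigoplus_{\lambda\vdash nl}\bigl(\mathcal{M}_n^\lambda\bigr)^{\oplus m_{n,l}^\lambda(\alpha)},$$ where each $m_{n,l}^\lambda(\alpha)$ is a nonnegative integer with $m_{n,l}^\lambda(\alpha)\le K_{\lambda (l^n)}$, and $m_{n,l}^\lambda(0)=K_{\lambda(l^n)}$.
   Context: $\mathcal{A}(\mathrm{Mat}_n)$ is the polynomial algebra over $\mathbb{C}$ in the variables $x_{ij}$ ($1\le i,j\le n$), $X=(x_{ij})$. The universal enveloping algebra $\mathcal{U}(\mathfrak{gl}_n)$ of $\mathfrak{gl}_n(\mathbb{C})$ acts on $\mathcal{A}(\mathrm{Mat}_n)$ by $E_{ij}\cdot f=\sum_{k=1}^n x_{ik}\,\partial f/\partial x_{jk}$. The $\alpha$-determinant is $\det^{(\alpha)}(X)=\sum_{\sigma\in\mathfrak{S}_n}\alpha^{\nu(\sigma)}x_{\sigma(1)1}\cdots x_{\sigma(n)n}$, where $\nu(\sigma)$ is $n$ minus the number of cycles of $\sigma$ (fixed points counted as cycles; $0^0=1$). $\mathcal{U}(\mathfrak{gl}_n)\cdot f$ is the cyclic submodule generated by $f$. $\mathcal{M}_n^\lambda$ is the irreducible highest weight module with highest weight the partition $\lambda$ (of length $\le n$). $K_{\lambda(l^n)}$ is the Kostka number: the number of semistandard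 tableaux of shape $\lambda$ and weight $(l^n)=(l,\dots,l)$; it is $0$ when $\lambda$ has more than $n$ parts, so such $\lambda$ do not contribute. *)

theory Defs
  imports
    Complex_Main
    "HOL-Library.FuncSet"
    "HOL-Library.Poly_Mapping"
    "HOL-Combinatorics.Permutations"
    "HOL-Combinatorics.Orbits"
    "HOL-Algebra.Module"
    "HOL-Algebra.QuotRing"
begin

section \<open>Left modules over a ring that need not be commutative\<close>

text \<open>
  The axioms are those of the locale \<^locale>\<open>module\<close> of HOL-Algebra, which requires the ring to be
  commutative. The fields \<open>mult\<close> and \<open>one\<close> that the record type of modules inherits
  from rings play no role.
\<close>

locale left_module = R?: ring R + M?: abelian_group M
  for R :: "('a, 'b) ring_scheme" (structure) and M :: "('a, 'c, 'd) module_scheme" (structure) +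
  assumes smult_closed:
      "\<lbrakk>a \<in> carrier R; x \<in> carrier M\<rbrakk> \<Longrightarrow> a \<odot>\<^bsub>M\<^esub> x \<in> carrier M"
    and smult_l_distr:
      "\<lbrakk>a \<in> carrier R; b \<in> carrier R; x \<in> carrier M\<rbrakk> \<Longrightarrow>
        (a \<oplus>\<^bsub>R\<^esub> b) \<odot>\<^bsub>M\<^esub> x = (a \<odot>\<^bsub>M\<^esub> x) \<oplus>\<^bsub>M\<^esub> (b \<odot>\<^bsub>M\<^esub> x)"
    and smult_r_distr:
      "\<lbrakk>a \<in> carrier R; x \<in> carrier M; y \<in> carrier M\<rbrakk> \<Longrightarrow>
        a \<odot>\<^bsub>M\<^esub> (x \<oplus>\<^bsub>M\<^esub> y) = (a \<odot>\<^bsub>M\<^esub> x) \<oplus>\<^bsub>M\<^esub> (a \<odot>\<^bsub>M\<^esub> y)"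
    and smult_assoc:
      "\<lbrakk>a \<in> carrier R; b \<in> carrier R; x \<in> carrier M\<rbrakk> \<Longrightarrow>
        (a \<otimes>\<^bsub>R\<^esub> b) \<odot>\<^bsub>M\<^esub> x = a \<odot>\<^bsub>M\<^esub> (b \<odot>\<^bsub>M\<^esub> x)"
    and smult_one: "x \<in> carrier M \<Longrightarrow> \<one>\<^bsub>R\<^esub> \<odot>\<^bsub>M\<^esub> x = x"

definition cyclic_submodule ::
    "('a, 'b) ring_scheme \<Rightarrow> ('a, 'c) module \<Rightarrow> 'c \<Rightarrow> ('a, 'c) module" where
  "cyclic_submodule R M x = M\<lparr>carrier := {a \<odot>\<^bsub>M\<^esub> x | a. a \<in> carrier R}\<rparr>"

definition irreducible_module :: "('a, 'b) ring_scheme \<Rightarrow> ('a, 'c) module \<Rightarrow> bool" where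
  "irreducible_module R M \<longleftrightarrow>
     left_module R M \<and> carrier M \<noteq> {\<zero>\<^bsub>M\<^esub>} \<and>
     (\<forall>N. submodule N R M \<longrightarrow> N = {\<zero>\<^bsub>M\<^esub>} \<or> N = carrier M)"

definition direct_sum :: "'i set \<Rightarrow> ('i \<Rightarrow> ('a, 'c) module) \<Rightarrow> ('a, 'i \<Rightarrow> 'c) module" where
  "direct_sum I M =
     \<lparr>carrier = {x \<in> (\<Pi>\<^sub>E i\<in>I. carrier (M i)). finite {i \<in> I. x i \<noteq> \<zero>\<^bsub>M i\<^esub>}},
      mult = undefined, one = undefined,
      zero = (\<lambda>i\<in>I. \<zero>\<^bsub>M i\<^esub>),
      add = (\<lambda>x y. \<lambda>i\<in>I. x i \<oplus>\<^bsub>M i\<^esub> y i),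
      smult = (\<lambda>a x. \<lambda>i\<in>I. a \<odot>\<^bsub>M i\<^esub> x i)\<rparr>"

definition module_power :: "('a, 'c) module \<Rightarrow> nat \<Rightarrow> ('a, nat \<Rightarrow> 'c) module" where
  "module_power M m = direct_sum {..<m} (\<lambda>_. M)"

definition module_iso ::
    "('a, 'b) ring_scheme \<Rightarrow> ('a, 'c) module \<Rightarrow> ('a, 'd) module \<Rightarrow> ('c \<Rightarrow> 'd) set" where
  "module_iso R M N =
     {\<phi> \<in> iso (add_monoid M) (add_monoid N).
        \<forall>a\<in>carrier R. \<forall>x\<in>carrier M. \<phi> (a \<odot>\<^bsub>M\<^esub> x) = a \<odot>\<^bsub>N\<^esub> \<phi> x}"

definition modules_isomorphic ::
    "('a, 'b) ring_scheme \<Rightarrow> ('a, 'c) module \<Rightarrow> ('a, 'd) module \<Rightarrow> bool" where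
  "modules_isomorphic R M N \<longleftrightarrow> module_iso R M N \<noteq> {}"


section \<open>The universal enveloping algebra of \<open>gl\<^sub>n\<close>\<close>

text \<open>
  The tensor algebra of \<open>gl\<^sub>n(\<complex>)\<close> is the free algebra on the matrix units \<open>E\<^sub>i\<^sub>j\<close>:
  finitely supported complex functions on words in the letters \<open>(i, j)\<close>, \<open>1 \<le> i, j \<le> n\<close>,
  multiplied by convolution along all splittings of a word.
\<close>

type_synonym gl_word = "(nat \<times> nat) list"
type_synonym env_elem = "(gl_word \<Rightarrow> complex) set"

definition gl_tensor_algebra :: "nat \<Rightarrow> (gl_word \<Rightarrow> complex) ring" where
  "gl_tensor_algebra n =
     \<lparr>carrier = {p. finite {w. p w \<noteq> 0} \<and> {w. p w \<noteq> 0} \<subseteq> lists ({1..n} \<times> {1..n})},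
      mult = (\<lambda>p q w. \<Sum>k\<le>length w. p (take k w) * q (drop k w)),
      one = (\<lambda>w. if w = [] then 1 else 0),
      zero = (\<lambda>w. 0),
      add = (\<lambda>p q w. p w + q w)\<rparr>"

definition word_elem :: "gl_word \<Rightarrow> gl_word \<Rightarrow> complex" where
  "word_elem v = (\<lambda>w. if w = v then 1 else 0)"

text \<open>
  \<open>gl_relation i j k l\<close> is
  \<open>E\<^sub>i\<^sub>j E\<^sub>k\<^sub>l - E\<^sub>k\<^sub>l E\<^sub>i\<^sub>j - [E\<^sub>i\<^sub>j, E\<^sub>k\<^sub>l]\<close>, where
  \<open>[E\<^sub>i\<^sub>j, E\<^sub>k\<^sub>l] = \<delta>\<^sub>j\<^sub>k E\<^sub>i\<^sub>l - \<delta>\<^sub>l\<^sub>i E\<^sub>k\<^sub>j\<close>.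
\<close>

definition gl_relation :: "nat \<Rightarrow> nat \<Rightarrow> nat \<Rightarrow> nat \<Rightarrow> gl_word \<Rightarrow> complex" where
  "gl_relation i j k l = (\<lambda>w.
     word_elem [(i, j), (k, l)] w - word_elem [(k, l), (i, j)] w
     - ((if j = k then word_elem [(i, l)] w else 0) - (if l = i then word_elem [(k, j)] w else 0)))"

definition gl_ideal :: "nat \<Rightarrow> (gl_word \<Rightarrow> complex) set" where
  "gl_ideal n = Idl\<^bsub>gl_tensor_algebra n\<^esub>
     {gl_relation i j k l | i j k l. i \<in> {1..n} \<and> j \<in> {1..n} \<and> k \<in> {1..n} \<and> l \<in> {1..n}}"

definition U_gl :: "nat \<Rightarrow> env_elem ring" where
  "U_gl n = gl_tensor_algebra n Quot gl_ideal n"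

text \<open>
  The generated ideal \<open>Idl\<close> is an intersection of ideals, which presupposes a ring; the next
  lemmas show that \<^term>\<open>gl_tensor_algebra n\<close> and \<^term>\<open>U_gl n\<close> are rings.
\<close>

lemma gl_tensor_mult_support:
  assumes p: "p \<in> carrier (gl_tensor_algebra n)" and q: "q \<in> carrier (gl_tensor_algebra n)"
  shows "p \<otimes>\<^bsub>gl_tensor_algebra n\<^esub> q \<in> carrier (gl_tensor_algebra n)"
proof -
  define P where "P = {w. p w \<noteq> 0}"
  define Q where "Q = {w. q w \<noteq> 0}"
  define r where "r = (\<lambda>w. \<Sum>k\<le>length w. p (take k w) * q (drop k w))"
  have P: "finite P" "P \<subseteq> lists ({1..n} \<times> {1..n})" and Q: "finite Q" "Q \<subseteq> lists ({1..n} \<times> {1..n})"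
    using p q by (simp_all add: gl_tensor_algebra_def P_def Q_def)
  have *: "{w. r w \<noteq> 0} \<subseteq> (\<lambda>(u, v). u @ v) ` (P \<times> Q)"
  proof
    fix w assume "w \<in> {w. r w \<noteq> 0}"
    then have "\<exists>k\<in>{..length w}. p (take k w) * q (drop k w) \<noteq> 0"
      unfolding r_def using sum.neutral[of "{..length w}" "\<lambda>k. p (take k w) * q (drop k w)"] by auto
    then obtain k where "p (take k w) * q (drop k w) \<noteq> 0" ..
    then have "(take k w, drop k w) \<in> P \<times> Q" by (simp add: P_def Q_def)
    then show "w \<in> (\<lambda>(u, v). u @ v) ` (P \<times> Q)"
      by (rule rev_image_eqI) simp
  qed
  have "finite {w. r w \<noteq> 0}"
    by (rule finite_subset[OF *]) (simp add: P Q)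
  moreover have "(\<lambda>(u, v). u @ v) ` (P \<times> Q) \<subseteq> lists ({1..n} \<times> {1..n})"
  proof (rule image_subsetI)
    fix x assume "x \<in> P \<times> Q"
    then have "fst x \<in> lists ({1..n} \<times> {1..n})" "snd x \<in> lists ({1..n} \<times> {1..n})"
      using P(2) Q(2) by (simp_all add: mem_Times_iff subset_iff)
    then show "(case x of (u, v) \<Rightarrow> u @ v) \<in> lists ({1..n} \<times> {1..n})"
      by (simp add: case_prod_unfold)
  qed
  with * have "{w. r w \<noteq> 0} \<subseteq> lists ({1..n} \<times> {1..n})" by (rule subset_trans)
  ultimately show ?thesis
    by (simp add: gl_tensor_algebra_def r_def)
qed

lemma gl_tensor_mult_assoc:
  "(\<Sum>k\<le>length w. (\<Sum>j\<le>length (take k w). p (take j (take k w)) * q (drop j (take k w))) * r (drop k w))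
   = (\<Sum>k\<le>length w. p (take k w) *
        (\<Sum>j\<le>length (drop k w). q (take j (drop k w)) * (r (drop j (drop k w)) :: complex)))"
proof -
  have "(\<Sum>k\<le>length w. (\<Sum>j\<le>length (take k w). p (take j (take k w)) * q (drop j (take k w))) * r (drop k w))
    = (\<Sum>k\<le>length w. \<Sum>j\<le>k. p (take j w) * q (take (k - j) (drop j w)) * r (drop (j + (k - j)) w))"
    by (intro sum.cong refl) (auto simp: sum_distrib_right min_def drop_take intro!: sum.cong)
  also have "\<dots> = (\<Sum>(j, i) | j + i \<le> length w.
      p (take j w) * q (take i (drop j w)) * r (drop (j + i) w))"
    by (rule sum.triangle_reindex_eq[symmetric])
  also have "{(j, i). j + i \<le> length w} = Sigma {..length w} (\<lambda>j. {..length w - j})"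
    by auto
  also have "(\<Sum>(j, i)\<in>Sigma {..length w} (\<lambda>j. {..length w - j}).
      p (take j w) * q (take i (drop j w)) * r (drop (j + i) w))
     = (\<Sum>k\<le>length w. \<Sum>j\<le>length w - k. p (take k w) * q (take j (drop k w)) * r (drop (k + j) w))"
    by (rule sum.Sigma[symmetric]) auto
  also have "\<dots> = (\<Sum>k\<le>length w. p (take k w) *
        (\<Sum>j\<le>length (drop k w). q (take j (drop k w)) * r (drop j (drop k w))))"
    by (auto simp: sum_distrib_left mult.assoc add.commute intro!: sum.cong)
  finally show ?thesis .
qed

lemma gl_tensor_one_left:
  "(\<Sum>k\<le>length w. (if take k w = [] then 1 else 0) * p (drop k w)) = (p w :: complex)"
proof -
  have "(\<Sum>k\<le>length w. (if take k w = [] then 1 else 0) * p (drop k w))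
      = (\<Sum>k\<le>length w. if k = 0 then p w else 0)"
    by (intro sum.cong) auto
  then show ?thesis by simp
qed

lemma gl_tensor_one_right:
  "(\<Sum>k\<le>length w. p (take k w) * (if drop k w = [] then 1 else 0)) = (p w :: complex)"
proof -
  have "(\<Sum>k\<le>length w. p (take k w) * (if drop k w = [] then 1 else 0))
      = (\<Sum>k\<le>length w. if k = length w then p w else 0)"
    by (intro sum.cong) auto
  then show ?thesis by simp
qed

lemma gl_tensor_add_closed:
  assumes "p \<in> carrier (gl_tensor_algebra n)" "q \<in> carrier (gl_tensor_algebra n)"
  shows "p \<oplus>\<^bsub>gl_tensor_algebra n\<^esub> q \<in> carrier (gl_tensor_algebra n)"
proof -
  have sub: "{w. p w + q w \<noteq> 0} \<subseteq> {w. p w \<noteq> 0} \<union> {w. q w \<noteq> 0}" by auto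
  then have "finite {w. p w + q w \<noteq> 0}"
    by (rule finite_subset) (use assms in \<open>simp add: gl_tensor_algebra_def\<close>)
  moreover from sub have "{w. p w + q w \<noteq> 0} \<subseteq> lists ({1..n} \<times> {1..n})"
    by (rule subset_trans) (use assms in \<open>simp add: gl_tensor_algebra_def\<close>)
  ultimately show ?thesis by (simp add: gl_tensor_algebra_def)
qed

lemma abelian_group_gl_tensor_algebra: "abelian_group (gl_tensor_algebra n)" (is "abelian_group ?R")
proof (rule abelian_groupI)
  fix p assume p: "p \<in> carrier ?R"
  show "\<exists>q\<in>carrier ?R. q \<oplus>\<^bsub>?R\<^esub> p = \<zero>\<^bsub>?R\<^esub>"
  proof
    show "(\<lambda>w. - p w) \<in> carrier ?R" using p by (simp add: gl_tensor_algebra_def)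
  qed (simp add: gl_tensor_algebra_def)
qed (simp_all add: gl_tensor_add_closed, simp_all add: gl_tensor_algebra_def add_ac)

lemma monoid_gl_tensor_algebra: "Group.monoid (gl_tensor_algebra n)" (is "Group.monoid ?R")
proof (rule Group.monoidI)
  have "{w :: gl_word. (if w = [] then 1 else 0) \<noteq> (0 :: complex)} = {[]}" by simp
  then show "\<one>\<^bsub>?R\<^esub> \<in> carrier ?R" by (simp add: gl_tensor_algebra_def)
next
  fix p q r
  show "p \<otimes>\<^bsub>?R\<^esub> q \<otimes>\<^bsub>?R\<^esub> r = p \<otimes>\<^bsub>?R\<^esub> (q \<otimes>\<^bsub>?R\<^esub> r)"
    unfolding gl_tensor_algebra_def monoid.simps by (rule ext) (rule gl_tensor_mult_assoc)
  show "\<one>\<^bsub>?R\<^esub> \<otimes>\<^bsub>?R\<^esub> p = p"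
    unfolding gl_tensor_algebra_def monoid.simps by (rule ext) (rule gl_tensor_one_left)
  show "p \<otimes>\<^bsub>?R\<^esub> \<one>\<^bsub>?R\<^esub> = p"
    unfolding gl_tensor_algebra_def monoid.simps by (rule ext) (rule gl_tensor_one_right)
qed (rule gl_tensor_mult_support)

lemma ring_gl_tensor_algebra: "ring (gl_tensor_algebra n)" (is "ring ?R")
proof (rule ringI[OF abelian_group_gl_tensor_algebra monoid_gl_tensor_algebra])
  fix p q r
  show "(p \<oplus>\<^bsub>?R\<^esub> q) \<otimes>\<^bsub>?R\<^esub> r = p \<otimes>\<^bsub>?R\<^esub> r \<oplus>\<^bsub>?R\<^esub> q \<otimes>\<^bsub>?R\<^esub> r"
    unfolding gl_tensor_algebra_def monoid.simps ring.simps
    by (rule ext) (simp only: distrib_right sum.distrib)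
  show "r \<otimes>\<^bsub>?R\<^esub> (p \<oplus>\<^bsub>?R\<^esub> q) = r \<otimes>\<^bsub>?R\<^esub> p \<oplus>\<^bsub>?R\<^esub> r \<otimes>\<^bsub>?R\<^esub> q"
    unfolding gl_tensor_algebra_def monoid.simps ring.simps
    by (rule ext) (simp only: distrib_left sum.distrib)
qed

lemma gl_relation_closed:
  assumes "i \<in> {1..n}" "j \<in> {1..n}" "k \<in> {1..n}" "l \<in> {1..n}"
  shows "gl_relation i j k l \<in> carrier (gl_tensor_algebra n)"
proof -
  let ?W = "{[(i, j), (k, l)], [(k, l), (i, j)], [(i, l)], [(k, j)]}"
  have "gl_relation i j k l w = 0" if "w \<notin> ?W" for w
    using that by (simp add: gl_relation_def word_elem_def)
  then have sub: "{w. gl_relation i j k l w \<noteq> 0} \<subseteq> ?W"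
    by blast
  then have "finite {w. gl_relation i j k l w \<noteq> 0}"
    by (rule finite_subset) simp
  moreover from sub have "{w. gl_relation i j k l w \<noteq> 0} \<subseteq> lists ({1..n} \<times> {1..n})"
    by (rule subset_trans) (use assms in simp)
  ultimately show ?thesis
    by (simp add: gl_tensor_algebra_def)
qed

lemma ideal_gl_ideal: "ideal (gl_ideal n) (gl_tensor_algebra n)"
  unfolding gl_ideal_def
  by (rule ring.genideal_ideal[OF ring_gl_tensor_algebra]) (use gl_relation_closed in blast)

lemma ring_U_gl: "ring (U_gl n)"
  unfolding U_gl_def by (rule ideal.quotient_is_ring[OF ideal_gl_ideal])

definition U_unit :: "nat \<Rightarrow> nat \<Rightarrow> nat \<Rightarrow> env_elem" where
  "U_unit n i j = gl_ideal n +>\<^bsub>gl_tensor_algebra n\<^esub> word_elem [(i, j)]"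

definition U_scalar :: "nat \<Rightarrow> complex \<Rightarrow> env_elem" where
  "U_scalar n c = gl_ideal n +>\<^bsub>gl_tensor_algebra n\<^esub> (\<lambda>w. if w = [] then c else 0)"


section \<open>Partitions, Kostka numbers and irreducible highest weight modules\<close>

definition is_partition :: "nat list \<Rightarrow> nat \<Rightarrow> bool" where
  "is_partition \<mu> N \<longleftrightarrow> sorted_wrt (\<ge>) \<mu> \<and> 0 \<notin> set \<mu> \<and> sum_list \<mu> = N"

text \<open>The \<open>i\<close>-th part, counted from \<open>1\<close>, with \<open>0\<close> beyond the length.\<close>

definition part :: "nat list \<Rightarrow> nat \<Rightarrow> nat" where
  "part \<mu> i = (if 1 \<le> i \<and> i \<le> length \<mu> then \<mu> ! (i - 1) else 0)"

definition young_diagram :: "nat list \<Rightarrow> (nat \<times> nat) set" where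
  "young_diagram \<mu> = {(r, c). 1 \<le> r \<and> 1 \<le> c \<and> c \<le> part \<mu> r}"

definition semistandard_tableaux :: "nat list \<Rightarrow> nat list \<Rightarrow> (nat \<times> nat \<Rightarrow> nat) set" where
  "semistandard_tableaux \<mu> wt =
     {T \<in> young_diagram \<mu> \<rightarrow>\<^sub>E {1..}.
        (\<forall>r c c'. (r, c) \<in> young_diagram \<mu> \<longrightarrow> (r, c') \<in> young_diagram \<mu> \<longrightarrow>
           c < c' \<longrightarrow> T (r, c) \<le> T (r, c')) \<and>
        (\<forall>r r' c. (r, c) \<in> young_diagram \<mu> \<longrightarrow> (r', c) \<in> young_diagram \<mu> \<longrightarrow>
           r < r' \<longrightarrow> T (r, c) < T (r', c)) \<and>
        (\<forall>k\<ge>1. card {x \<in> young_diagram \<mu>. T x = k} = part wt k)}"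

definition kostka :: "nat list \<Rightarrow> nat list \<Rightarrow> nat" where
  "kostka \<mu> wt = card (semistandard_tableaux \<mu> wt)"

definition highest_weight_vector ::
    "nat \<Rightarrow> nat list \<Rightarrow> (env_elem, 'c) module \<Rightarrow> 'c \<Rightarrow> bool" where
  "highest_weight_vector n \<mu> M v \<longleftrightarrow>
     v \<in> carrier M \<and> v \<noteq> \<zero>\<^bsub>M\<^esub> \<and>
     (\<forall>i\<in>{1..n}. \<forall>j\<in>{1..n}. i < j \<longrightarrow> U_unit n i j \<odot>\<^bsub>M\<^esub> v = \<zero>\<^bsub>M\<^esub>) \<and>
     (\<forall>i\<in>{1..n}. U_unit n i i \<odot>\<^bsub>M\<^esub> v = U_scalar n (of_nat (part \<mu> i)) \<odot>\<^bsub>M\<^esub> v)"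

definition is_irreducible_highest_weight ::
    "nat \<Rightarrow> nat list \<Rightarrow> (env_elem, 'c) module \<Rightarrow> bool" where
  "is_irreducible_highest_weight n \<mu> M \<longleftrightarrow>
     irreducible_module (U_gl n) M \<and>
     (\<exists>v. highest_weight_vector n \<mu> M v \<and>
          carrier M = carrier (cyclic_submodule (U_gl n) M v))"

text \<open>
  The irreducible module with highest weight \<open>\<mu>\<close> is determined up to isomorphism, and one
  realization is chosen. Every irreducible module is isomorphic to the quotient of \<^term>\<open>U_gl n\<close> by
  the annihilator of a nonzero vector, so realizations can be sought among modules whose elements
  are sets of elements of \<^term>\<open>U_gl n\<close>. The definition is meaningful for \<open>length \<mu> \<le> n\<close>.
\<close>

definition irrep_gl :: "nat \<Rightarrow> nat list \<Rightarrow> (env_elem, env_elem set) module" where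
  "irrep_gl n \<mu> = (SOME M. is_irreducible_highest_weight n \<mu> M)"


section \<open>The polynomial algebra on matrices and its \<open>gl\<^sub>n\<close>-action\<close>

text \<open>Polynomials in variables \<open>x\<^sub>i\<^sub>j\<close>: finitely supported functions from exponent vectors.\<close>

type_synonym matrix_poly = "(nat \<times> nat \<Rightarrow>\<^sub>0 nat) \<Rightarrow>\<^sub>0 complex"

definition Const :: "complex \<Rightarrow> matrix_poly" where
  "Const c = Poly_Mapping.single 0 c"

definition Var :: "nat \<Rightarrow> nat \<Rightarrow> matrix_poly" where
  "Var i j = Poly_Mapping.single (Poly_Mapping.single (i, j) 1) 1"

definition partial_deriv :: "nat \<times> nat \<Rightarrow> matrix_poly \<Rightarrow> matrix_poly" where
  "partial_deriv v f =
     (\<Sum>a\<in>Poly_Mapping.keys f. Poly_Mapping.single (a - Poly_Mapping.single v 1)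
        (Poly_Mapping.lookup f a * of_nat (Poly_Mapping.lookup a v)))"

definition gl_unit_action :: "nat \<Rightarrow> nat \<Rightarrow> nat \<Rightarrow> matrix_poly \<Rightarrow> matrix_poly" where
  "gl_unit_action n i j f = (\<Sum>k=1..n. Var i k * partial_deriv (j, k) f)"

definition word_action :: "nat \<Rightarrow> gl_word \<Rightarrow> matrix_poly \<Rightarrow> matrix_poly" where
  "word_action n w f = foldr (\<lambda>(i, j). gl_unit_action n i j) w f"

definition tensor_action :: "nat \<Rightarrow> (gl_word \<Rightarrow> complex) \<Rightarrow> matrix_poly \<Rightarrow> matrix_poly" where
  "tensor_action n p f = (\<Sum>w | p w \<noteq> 0. Const (p w) * word_action n w f)"

text \<open>
  The action of the tensor algebra respects the relations, so it is constant on every coset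
  \<open>u\<close>, and \<open>the_elem\<close> picks that constant value.
\<close>

definition poly_Mat :: "nat \<Rightarrow> (env_elem, matrix_poly) module" where
  "poly_Mat n =
     \<lparr>carrier = {f. \<forall>a\<in>Poly_Mapping.keys f. Poly_Mapping.keys a \<subseteq> {1..n} \<times> {1..n}},
      mult = (*), one = 1, zero = 0, add = (+),
      smult = (\<lambda>u f. the_elem ((\<lambda>p. tensor_action n p f) ` u))\<rparr>"


section \<open>The \<open>\<alpha>\<close>-determinant\<close>

text \<open>The cycles of \<open>\<sigma>\<close>, fixed points included, correspond to its orbits on \<open>{1..n}\<close>.\<close>

definition perm_nu :: "nat \<Rightarrow> (nat \<Rightarrow> nat) \<Rightarrow> nat" where
  "perm_nu n \<sigma> = n - card (orbit \<sigma> ` {1..n})"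

definition alpha_det :: "nat \<Rightarrow> complex \<Rightarrow> matrix_poly" where
  "alpha_det n \<alpha> =
     (\<Sum>\<sigma> | \<sigma> permutes {1..n}. Const (\<alpha> ^ perm_nu n \<sigma>) * (\<Prod>i=1..n. Var (\<sigma> i) i))"

end

theory Submission
  imports Defs
begin

text \<open>
  The \<open>l\<close>-th power of an \<open>\<alpha>\<close>-determinant has degree \<open>l\<close> in each column of variables, so its cyclic
  module \<open>N\<close> lies in the finite-dimensional space \<open>W\<close> of all such polynomials, whatever \<open>\<alpha>\<close> is. For the
  Fischer inner product, in which distinct monomials \<open>x\<^sup>a\<close> are orthogonal and \<open>x\<^sup>a\<close> has square norm \<open>a!\<close>,
  the adjoint of \<open>E\<^sub>i\<^sub>j\<close> is \<open>E\<^sub>j\<^sub>i\<close>. Hence orthogonal highest weight vectors generate orthogonal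
  irreducible modules, and an orthogonal basis of the highest weight vectors in \<open>N\<close> of each weight gives
  the decomposition; the multiplicity of \<open>\<mu>\<close> is the dimension of the space of highest weight vectors of
  weight \<open>\<mu>\<close> in \<open>N\<close>.

  In \<open>W\<close> this dimension is the Kostka number. It is at most that, since the leading exponent of a
  highest weight vector, for a suitable lexicographic order, counts the entries \<open>j\<close> in row \<open>i\<close> of a
  semistandard tableau. It is at least that, since the products of minors given by the columns of
  semistandard tableaux are highest weight vectors with these leading exponents. Finally, for
  \<open>\<alpha> = 0\<close> the generator is \<open>(x\<^sub>1\<^sub>1 \<cdots> x\<^sub>n\<^sub>n)\<^sup>l\<close>, which generates all of \<open>W\<close>.
\<close>

section \<open>Polynomials and the operators of the action\<close>

text \<open>The upper bound on multiplicities uses neither characters nor the RSK correspondence: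
  reading off coefficients at semistandard exponents is injective on highest weight vectors. The
  hard point is that leading exponents are semistandard. It is why the operators
  \<open>col_op\<close> carry a set of columns: an sl_2 that acts only on the columns before a given
  one, with its strings bounded by positivity of the inner product, yields exactly column
  strictness.

  The module with highest weight \<lambda> is an arbitrary choice among the irreducible ones, so it
  comes without inner product, weight decomposition or finite dimension. Identifying it with a
  cyclic module of polynomials takes an algebraic uniqueness proof inside the enveloping algebra.
  The Poincare-Birkhoff-Witt theorem is avoided: an element is only written as a lowering one plus
  one that annihilates the highest weight vectors, and polynomials in the grading element, the sum
  of \<open>k E_kk\<close>, separate a highest weight vector from everything strictly below
  it.\<close>

abbreviation lookup :: "('a \<Rightarrow>\<^sub>0 'b :: zero) \<Rightarrow> 'a \<Rightarrow> 'b" where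
  "lookup \<equiv> Poly_Mapping.lookup"

abbreviation keys :: "('a \<Rightarrow>\<^sub>0 'b :: zero) \<Rightarrow> 'a set" where
  "keys \<equiv> Poly_Mapping.keys"

abbreviation single :: "'a \<Rightarrow> 'b \<Rightarrow> 'a \<Rightarrow>\<^sub>0 'b :: zero" where
  "single \<equiv> Poly_Mapping.single"

abbreviation unit_exp :: "nat \<times> nat \<Rightarrow> (nat \<times> nat \<Rightarrow>\<^sub>0 nat)" where
  "unit_exp v \<equiv> single v 1"

lemma matrix_poly_eq_sum_single:
  fixes f :: matrix_poly
  shows "f = (\<Sum>a\<in>keys f. single a (lookup f a))"
  by (rule poly_mapping_eqI)
    (simp add: lookup_sum lookup_single sum.delta' when_def in_keys_iff)

lemma matrix_poly_induct [case_names single add]: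
  fixes f :: matrix_poly
  assumes single: "\<And>a c. P (single a c)"
    and add: "\<And>f g. P f \<Longrightarrow> P g \<Longrightarrow> P (f + g)"
  shows "P f"
proof -
  have "P (\<Sum>a\<in>A. single a (lookup f a))" if "finite A" for A
    using that
  proof (induction A)
    case empty
    have "P (single 0 0)" by (rule single)
    then show ?case by simp
  qed (auto intro: single add)
  then show ?thesis
    by (subst matrix_poly_eq_sum_single) simp
qed

section \<open>Coefficients and the product rule for partial derivatives\<close>

lemma lookup_partial_deriv:
  "lookup (partial_deriv v f) a =
     lookup f (a + unit_exp v) * of_nat (Suc (lookup a v))"
proof -
  have "lookup (partial_deriv v f) a = (\<Sum>b\<in>keys f.
      if b = a + unit_exp v then lookup f b * of_nat (lookup b v) else 0)"
    unfolding partial_deriv_def lookup_sum lookup_single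
  proof (intro sum.cong refl)
    fix b
    show "(lookup f b * of_nat (lookup b v) when b - unit_exp v = a)
      = (if b = a + unit_exp v then lookup f b * of_nat (lookup b v) else 0)"
    \<comment> \<open>Subtraction of exponents is truncated: if \<open>v\<close> does not occur in
      \<open>b\<close>, the condition on the left may hold for the wrong \<open>a\<close>, but then
      its coefficient carries the factor 0.\<close>
    proof (cases "lookup b v = 0")
      case True
      then have "b \<noteq> a + unit_exp v" by (auto simp: lookup_add)
      with True show ?thesis by simp
    next
      case False
      then have "b - unit_exp v + unit_exp v = b"
        by (intro poly_mapping_eqI) (auto simp: lookup_add lookup_minus lookup_single when_def)
      then have "b - unit_exp v = a \<longleftrightarrow> b = a + unit_exp v" by auto
      then show ?thesis by simp
    qed
  qed
  then show ?thesis
    by (simp add: lookup_add in_keys_iff)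
qed

lemma partial_deriv_add: "partial_deriv v (f + g) = partial_deriv v f + partial_deriv v g"
  by (rule poly_mapping_eqI) (simp add: lookup_partial_deriv lookup_add algebra_simps)

lemma partial_deriv_0 [simp]: "partial_deriv v 0 = 0"
  by (rule poly_mapping_eqI) (simp add: lookup_partial_deriv)

lemma partial_deriv_single:
  "partial_deriv v (single a c) =
     single (a - unit_exp v) (c * of_nat (lookup a v))"
  by (cases "c = 0") (simp_all add: partial_deriv_def)

lemma lookup_Const_mult: "lookup (Const c * f) a = c * lookup f a"
proof (induction f rule: matrix_poly_induct)
  case (single b d)
  then show ?case by (simp add: Const_def mult_single lookup_single when_def)
qed (simp add: distrib_left lookup_add)

lemma partial_deriv_Const_mult: "partial_deriv v (Const c * f) = Const c * partial_deriv v f"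
  by (rule poly_mapping_eqI) (simp add: lookup_partial_deriv lookup_Const_mult)

lemma Const_add: "Const (c + d) = Const c + Const d"
  by (simp add: Const_def single_add)

lemma Const_mult: "Const (c * d) = Const c * Const d"
  by (simp add: Const_def mult_single)

lemma Const_0 [simp]: "Const 0 = 0" and Const_1 [simp]: "Const 1 = 1"
  by (simp_all add: Const_def)

lemma Const_uminus: "Const (- c) = - Const c"
  by (simp add: Const_def single_uminus)

lemma Const_diff: "Const (c - d) = Const c - Const d"
  by (simp add: Const_def single_diff)


lemma partial_deriv_mult:
  "partial_deriv v (f * g) = partial_deriv v f * g + f * partial_deriv v g"
proof (induction f rule: matrix_poly_induct)
  case (single a c)
  show ?case
  proof (induction g rule: matrix_poly_induct)
    case (single b d)
    have 1: "a - unit_exp v + b = a + b - unit_exp v" if "lookup a v \<noteq> 0"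
      using that by (intro poly_mapping_eqI) (auto simp: lookup_add lookup_minus lookup_single when_def)
    have 2: "a + (b - unit_exp v) = a + b - unit_exp v" if "lookup b v \<noteq> 0"
      using that by (intro poly_mapping_eqI) (auto simp: lookup_add lookup_minus lookup_single when_def)
    show ?case
      using 1 2
      by (cases "lookup a v = 0"; cases "lookup b v = 0")
        (simp_all add: mult_single partial_deriv_single lookup_add algebra_simps flip: single_add)
  qed (simp add: distrib_left partial_deriv_add algebra_simps)
qed (simp add: distrib_right partial_deriv_add algebra_simps)

lemma partial_deriv_Var: "partial_deriv v (Var i j) = (if v = (i, j) then 1 else 0)"
  by (simp add: Var_def partial_deriv_single lookup_single when_def)

lemma partial_deriv_commute:
  "partial_deriv u (partial_deriv v f) = partial_deriv v (partial_deriv u f)"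
  by (rule poly_mapping_eqI)
    (cases "u = v"; simp add: lookup_partial_deriv lookup_add lookup_single when_def add_ac mult_ac)

lemma lookup_Var_mult_plus:
  "lookup (Var i j * f) (a + unit_exp (i, j)) = lookup f a"
proof (induction f rule: matrix_poly_induct)
  case (single b d)
  then show ?case by (simp add: Var_def mult_single lookup_single when_def add.commute)
qed (simp add: distrib_left lookup_add)

lemma lookup_Var_mult_eq_0:
  assumes "lookup a (i, j) = 0"
  shows "lookup (Var i j * f) a = 0"
proof (induction f rule: matrix_poly_induct)
  case (single b d)
  have "unit_exp (i, j) + b \<noteq> a" using assms by (auto simp: lookup_add)
  then show ?case by (simp add: Var_def mult_single lookup_single when_def)
qed (simp add: distrib_left lookup_add)

text \<open>The polarization operator \<open>E_ij\<close> with its sum over columns cut down to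
  \<open>C\<close>. Each set of columns carries its own copy of gl_n, and copies on disjoint sets
  commute; the sl_2-argument on leading exponents works with the columns before a given one.\<close>

definition col_op :: "nat set \<Rightarrow> nat \<Rightarrow> nat \<Rightarrow> matrix_poly \<Rightarrow> matrix_poly" where
  "col_op C i j f = (\<Sum>k\<in>C. Var i k * partial_deriv (j, k) f)"

lemma gl_unit_action_eq_col_op: "gl_unit_action n = col_op {1..n}"
  by (intro ext) (simp add: gl_unit_action_def col_op_def)

lemma col_op_add: "col_op C i j (f + g) = col_op C i j f + col_op C i j g"
  by (simp add: col_op_def partial_deriv_add distrib_left sum.distrib)

lemma col_op_Const_mult: "col_op C i j (Const c * f) = Const c * col_op C i j f"
  by (simp add: col_op_def partial_deriv_Const_mult sum_distrib_left mult.left_commute)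

lemma col_op_0 [simp]: "col_op C i j 0 = 0"
  by (simp add: col_op_def)

lemma col_op_uminus: "col_op C i j (- f) = - col_op C i j f"
  using col_op_Const_mult[of C i j "-1" f] by (simp add: Const_uminus)

lemma col_op_diff: "col_op C i j (f - g) = col_op C i j f - col_op C i j g"
  using col_op_add[of C i j f "- g"] by (simp add: col_op_uminus)

lemma col_op_sum: "col_op C i j (sum f A) = (\<Sum>x\<in>A. col_op C i j (f x))"
  by (induction A rule: infinite_finite_induct) (simp_all add: col_op_add)

lemma col_op_mult: "col_op C i j (f * g) = col_op C i j f * g + f * col_op C i j g"
  by (simp add: col_op_def partial_deriv_mult sum_distrib_left sum_distrib_right sum.distrib algebra_simps)

lemma col_op_1 [simp]: "col_op C i j 1 = 0"
  using col_op_mult[of C i j 1 1] by simp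

lemma col_op_prod:
  assumes "finite A"
  shows "col_op C i j (prod f A) = (\<Sum>x\<in>A. col_op C i j (f x) * prod f (A - {x}))"
  using assms
proof (induction A)
  case (insert y A)
  have "col_op C i j (prod f (insert y A)) =
      col_op C i j (f y) * prod f A + f y * (\<Sum>x\<in>A. col_op C i j (f x) * prod f (A - {x}))"
    using insert by (simp add: col_op_mult)
  also have "f y * (\<Sum>x\<in>A. col_op C i j (f x) * prod f (A - {x})) =
      (\<Sum>x\<in>A. col_op C i j (f x) * prod f (insert y A - {x}))"
    unfolding sum_distrib_left
  proof (intro sum.cong refl)
    fix x assume "x \<in> A"
    then have "insert y A - {x} = insert y (A - {x})" using insert by auto
    then show "f y * (col_op C i j (f x) * prod f (A - {x})) =
        col_op C i j (f x) * prod f (insert y A - {x})"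
      using insert by (simp add: mult_ac)
  qed
  finally show ?case using insert by simp
qed simp

lemma col_op_Var:
  assumes "finite C"
  shows "col_op C i j (Var r c) = (if j = r \<and> c \<in> C then Var i c else 0)"
proof -
  have "col_op C i j (Var r c) = (\<Sum>k\<in>C. if k = c then (if j = r then Var i c else 0) else 0)"
    unfolding col_op_def by (intro sum.cong) (auto simp: partial_deriv_Var)
  then show ?thesis using assms by (auto simp: sum.delta')
qed

text \<open>Moving the inner variable out past the outer derivative leaves a second-order operator
  and a contraction. The second-order part is symmetric in the two operators and cancels in the
  commutator; only the contractions at a common column remain.\<close>

lemma col_op_commutator:
  assumes "finite C"
  shows "col_op C i j (col_op C k l f) = col_op C k l (col_op C i j f)
     + (if j = k then col_op C i l f else 0) - (if l = i then col_op C k j f else 0)"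
proof -
  have *: "col_op C i j (col_op C k l f) =
      (\<Sum>a\<in>C. \<Sum>b\<in>C. Var i a * Var k b * partial_deriv (j, a) (partial_deriv (l, b) f))
      + (if j = k then col_op C i l f else 0)" for i j k l
  proof -
    have "col_op C i j (col_op C k l f) = (\<Sum>a\<in>C. \<Sum>b\<in>C. Var i a *
        partial_deriv (j, a) (Var k b * partial_deriv (l, b) f))"
      unfolding col_op_def
    proof (intro sum.cong refl)
      fix a
      have "partial_deriv (j, a) (\<Sum>b\<in>C. Var k b * partial_deriv (l, b) f)
         = (\<Sum>b\<in>C. partial_deriv (j, a) (Var k b * partial_deriv (l, b) f))"
        by (induction C rule: infinite_finite_induct) (simp_all add: partial_deriv_add)
      then show "Var i a * partial_deriv (j, a) (\<Sum>b\<in>C. Var k b * partial_deriv (l, b) f)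
         = (\<Sum>b\<in>C. Var i a * partial_deriv (j, a) (Var k b * partial_deriv (l, b) f))"
        by (simp add: sum_distrib_left)
    qed
    also have "\<dots> = (\<Sum>a\<in>C. \<Sum>b\<in>C. Var i a * Var k b * partial_deriv (j, a) (partial_deriv (l, b) f)
        + (if b = a then if j = k then Var i a * partial_deriv (l, a) f else 0 else 0))"
      by (intro sum.cong) (auto simp: partial_deriv_mult partial_deriv_Var algebra_simps)
    also have "\<dots> = (\<Sum>a\<in>C. \<Sum>b\<in>C. Var i a * Var k b * partial_deriv (j, a) (partial_deriv (l, b) f))
      + (if j = k then col_op C i l f else 0)"
      unfolding sum.distrib using assms by (simp add: sum.delta col_op_def)
    finally show ?thesis .
  qed
  have "(\<Sum>a\<in>C. \<Sum>b\<in>C. Var i a * Var k b * partial_deriv (j, a) (partial_deriv (l, b) f))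
      = (\<Sum>a\<in>C. \<Sum>b\<in>C. Var k a * Var i b * partial_deriv (l, a) (partial_deriv (j, b) f))"
    by (subst sum.swap) (simp add: partial_deriv_commute[of "(l, _)"] mult_ac)
  then show ?thesis
    unfolding *[of i j k l] *[of k l i j] by (auto simp: algebra_simps)
qed

text \<open>A contraction needs a common column, so for disjoint sets the composition is its
  second-order part alone, which is symmetric.\<close>

lemma col_op_disjoint_commute:
  assumes "C \<inter> D = {}"
  shows "col_op C i j (col_op D k l f) = col_op D k l (col_op C i j f)"
proof -
  have *: "col_op C i j (col_op D k l f) =
      (\<Sum>a\<in>C. \<Sum>b\<in>D. Var i a * Var k b * partial_deriv (j, a) (partial_deriv (l, b) f))"
    if "C \<inter> D = {}" for C D i j k l
    unfolding col_op_def
  proof (intro sum.cong refl)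
    fix a assume a: "a \<in> C"
    have "partial_deriv (j, a) (\<Sum>b\<in>D. Var k b * partial_deriv (l, b) f)
       = (\<Sum>b\<in>D. partial_deriv (j, a) (Var k b * partial_deriv (l, b) f))"
      by (induction D rule: infinite_finite_induct) (simp_all add: partial_deriv_add)
    also have "\<dots> = (\<Sum>b\<in>D. Var k b * partial_deriv (j, a) (partial_deriv (l, b) f))"
      using a that by (intro sum.cong) (auto simp: partial_deriv_mult partial_deriv_Var)
    finally show "Var i a * partial_deriv (j, a) (\<Sum>b\<in>D. Var k b * partial_deriv (l, b) f)
       = (\<Sum>b\<in>D. Var i a * Var k b * partial_deriv (j, a) (partial_deriv (l, b) f))"
      by (simp add: sum_distrib_left mult_ac)
  qed
  have "D \<inter> C = {}" using assms by auto
  with assms show ?thesis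
    by (simp add: *) (subst sum.swap, simp add: partial_deriv_commute[of "(j, _)"] mult_ac)
qed


text \<open>Euler's identity for one row: each monomial is an eigenvector, with eigenvalue its
  degree in the variables of row \<open>i\<close> and columns \<open>C\<close>.\<close>

lemma lookup_col_op_diag:
  "lookup (col_op C i i f) a =
     of_nat (\<Sum>k\<in>C. lookup a (i, k)) * lookup f a"
proof -
  have "lookup (Var i k * partial_deriv (i, k) f) a =
      of_nat (lookup a (i, k)) * lookup f a" for k
  proof (cases "lookup a (i, k) = 0")
    case True
    then show ?thesis by (simp add: lookup_Var_mult_eq_0)
  next
    case False
    define b where "b = a - unit_exp (i, k)"
    have a: "a = b + unit_exp (i, k)"
      using False unfolding b_def
      by (intro poly_mapping_eqI) (auto simp: lookup_add lookup_minus lookup_single when_def)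
    show ?thesis
      unfolding a lookup_Var_mult_plus lookup_partial_deriv by (simp add: lookup_add)
  qed
  then show ?thesis
    by (simp add: col_op_def lookup_sum sum_distrib_right)
qed

text \<open>The coefficient at \<open>a\<close> collects the exponents from which \<open>a\<close>
  arises by moving one unit from row \<open>j\<close> to row \<open>i\<close> within a column. For
  \<open>i \<noteq> j\<close> the source has one unit more than \<open>a\<close> at
  \<open>(j, k)\<close>, which is the factor from the derivative.\<close>

lemma lookup_col_op:
  assumes "i \<noteq> j"
  shows "lookup (col_op C i j f) a =
    (\<Sum>k\<in>C. if lookup a (i, k) = 0 then 0
       else of_nat (Suc (lookup a (j, k)))
         * lookup f (a - unit_exp (i, k) + unit_exp (j, k)))"
proof -
  have "lookup (Var i k * partial_deriv (j, k) f) a =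
      (if lookup a (i, k) = 0 then 0
       else of_nat (Suc (lookup a (j, k)))
         * lookup f (a - unit_exp (i, k) + unit_exp (j, k)))" for k
  proof (cases "lookup a (i, k) = 0")
    case True
    then show ?thesis by (simp add: lookup_Var_mult_eq_0)
  next
    case False
    define b where "b = a - unit_exp (i, k)"
    have a: "a = b + unit_exp (i, k)"
      using False unfolding b_def
      by (intro poly_mapping_eqI) (auto simp: lookup_add lookup_minus lookup_single when_def)
    have b: "a - unit_exp (i, k) = b" by (simp add: b_def)
    have *: "lookup a (j, k) = lookup b (j, k)"
      using assms by (simp add: b_def lookup_minus lookup_single)
    have "lookup (Var i k * partial_deriv (j, k) f) a
        = lookup (partial_deriv (j, k) f) b"
      by (subst a) (rule lookup_Var_mult_plus)
    also have "\<dots> = lookup f (b + unit_exp (j, k)) * of_nat (Suc (lookup b (j, k)))"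
      by (rule lookup_partial_deriv)
    finally show ?thesis using False by (simp only: b * if_False mult.commute)
  qed
  then show ?thesis
    by (simp add: col_op_def lookup_sum)
qed

lemma col_op_single:
  "col_op C i j (single a c) =
     (\<Sum>k\<in>C. single (a - unit_exp (j, k) + unit_exp (i, k))
        (c * of_nat (lookup a (j, k))))"
  by (simp add: col_op_def partial_deriv_single Var_def mult_single add.commute)

text \<open>Naming the common part \<open>c\<close> of source and target keeps truncated subtraction
  out of later arguments, where weights and column degrees of the two exponents are
  compared.\<close>

lemma keys_col_op:
  assumes "a \<in> keys (col_op C i j f)"
  obtains c k where "k \<in> C" "c + unit_exp (j, k) \<in> keys f" "a = c + unit_exp (i, k)"
proof -
  have "col_op C i j f = (\<Sum>b\<in>keys f.
      col_op C i j (single b (lookup f b)))"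
    by (subst matrix_poly_eq_sum_single) (rule col_op_sum)
  also have "lookup \<dots> a = (\<Sum>b\<in>keys f. \<Sum>k\<in>C.
      (lookup f b * of_nat (lookup b (j, k))
         when b - unit_exp (j, k) + unit_exp (i, k) = a))"
    by (simp add: lookup_sum col_op_single lookup_single)
  finally have "\<dots> \<noteq> 0" using assms by (simp add: in_keys_iff)
  then obtain b where b: "b \<in> keys f" and "(\<Sum>k\<in>C.
      (lookup f b * of_nat (lookup b (j, k))
         when b - unit_exp (j, k) + unit_exp (i, k) = a)) \<noteq> 0"
    by (meson sum.neutral)
  then obtain k where "k \<in> C" "(lookup f b * of_nat (lookup b (j, k))
         when b - unit_exp (j, k) + unit_exp (i, k) = a) \<noteq> 0"
    by (meson sum.neutral)
  then have k: "k \<in> C" "lookup b (j, k) \<noteq> 0"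
    and a: "a = b - unit_exp (j, k) + unit_exp (i, k)"
    by (auto simp: when_def split: if_splits)
  have "b - unit_exp (j, k) + unit_exp (j, k) = b"
    using k by (intro poly_mapping_eqI) (auto simp: lookup_add lookup_minus lookup_single when_def)
  with b k a show ?thesis by (intro that[of k "b - unit_exp (j, k)"]) auto
qed


section \<open>The Fischer inner product\<close>

definition exp_fact :: "(nat \<times> nat \<Rightarrow>\<^sub>0 nat) \<Rightarrow> nat" where
  "exp_fact a = (\<Prod>p\<in>keys a. fact (lookup a p))"

definition fischer :: "matrix_poly \<Rightarrow> matrix_poly \<Rightarrow> complex" where
  "fischer f g = (\<Sum>a\<in>keys f. lookup f a
      * cnj (lookup g a) * of_nat (exp_fact a))"

lemma exp_fact_pos: "exp_fact a > 0"
  by (simp add: exp_fact_def prod_pos)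

lemma exp_fact_superset:
  assumes "finite A" "keys a \<subseteq> A"
  shows "exp_fact a = (\<Prod>p\<in>A. fact (lookup a p))"
  unfolding exp_fact_def using assms
  by (intro prod.mono_neutral_left) (auto simp: in_keys_iff)

lemma exp_fact_plus_unit:
  "exp_fact (a + unit_exp v) = Suc (lookup a v) * exp_fact a"
proof -
  define A where "A = insert v (keys a)"
  have A: "finite A" "v \<in> A" "keys a \<subseteq> A" by (auto simp: A_def)
  have "keys (a + unit_exp v) \<subseteq> A"
    using keys_add[of a "unit_exp v"] by (auto simp: A_def)
  then have "exp_fact (a + unit_exp v) = (\<Prod>p\<in>A. fact (lookup (a + unit_exp v) p))"
    using A by (intro exp_fact_superset)
  also have "\<dots> = fact (Suc (lookup a v)) * (\<Prod>p\<in>A - {v}. fact (lookup a p))"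
    using A by (subst prod.remove[of A v]) (auto simp: lookup_add lookup_single when_def intro!: prod.cong split: if_splits)
  also have "\<dots> = Suc (lookup a v) * (\<Prod>p\<in>A. fact (lookup a p))"
    using A by (subst prod.remove[of A v "\<lambda>p. fact (lookup a p)"])
      (auto simp: algebra_simps)
  also have "(\<Prod>p\<in>A. fact (lookup a p)) = exp_fact a"
    using A by (intro exp_fact_superset[symmetric])
  finally show ?thesis .
qed

lemma fischer_superset:
  assumes "finite A" "keys f \<subseteq> A"
  shows "fischer f g = (\<Sum>a\<in>A. lookup f a
      * cnj (lookup g a) * of_nat (exp_fact a))"
  unfolding fischer_def using assms
  by (intro sum.mono_neutral_left) (auto simp: in_keys_iff)

lemma fischer_add_left: "fischer (f + g) h = fischer f h + fischer g h"
proof -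
  define A where "A = keys f \<union> keys g"
  have "finite A" "keys f \<subseteq> A" "keys g \<subseteq> A" "keys (f + g) \<subseteq> A"
    using keys_add[of f g] by (auto simp: A_def)
  then show ?thesis
    by (simp add: fischer_superset[of A] lookup_add algebra_simps sum.distrib)
qed

lemma fischer_cnj: "fischer g f = cnj (fischer f g)"
proof -
  define A where "A = keys f \<union> keys g"
  have "finite A" "keys f \<subseteq> A" "keys g \<subseteq> A"
    by (auto simp: A_def)
  then show ?thesis
    by (simp add: fischer_superset[of A] mult_ac)
qed

lemma fischer_add_right: "fischer h (f + g) = fischer h f + fischer h g"
  by (subst (1 2 3) fischer_cnj) (simp add: fischer_add_left)

lemma fischer_Const_left: "fischer (Const c * f) g = c * fischer f g"
proof -
  have "keys (Const c * f) \<subseteq> keys f"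
    by (auto simp: in_keys_iff lookup_Const_mult)
  then show ?thesis
    by (simp add: fischer_superset[of "keys f"] lookup_Const_mult sum_distrib_left mult.assoc)
qed

lemma fischer_Const_right: "fischer f (Const c * g) = cnj c * fischer f g"
  by (subst (1 2) fischer_cnj) (simp add: fischer_Const_left)

lemma fischer_0_left [simp]: "fischer 0 g = 0" and fischer_0_right [simp]: "fischer g 0 = 0"
  by (simp_all add: fischer_def)

lemma fischer_minus_left: "fischer (- f) g = - fischer f g"
  using fischer_Const_left[of "-1" f g] by (simp add: Const_uminus)


lemma fischer_diff_left: "fischer (f - g) h = fischer f h - fischer g h"
  using fischer_add_left[of f "- g" h] by (simp add: fischer_minus_left)


lemma fischer_sum_left: "fischer (sum f A) g = (\<Sum>x\<in>A. fischer (f x) g)"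
  by (induction A rule: infinite_finite_induct) (simp_all add: fischer_add_left)

lemma fischer_sum_right: "fischer g (sum f A) = (\<Sum>x\<in>A. fischer g (f x))"
  by (induction A rule: infinite_finite_induct) (simp_all add: fischer_add_right)

lemma fischer_self:
  "fischer f f = of_real (\<Sum>a\<in>keys f.
     (cmod (lookup f a))\<^sup>2 * of_nat (exp_fact a))"
  unfolding fischer_def of_real_sum
  by (intro sum.cong refl) (simp only: complex_norm_square of_real_mult of_real_of_nat_eq)

lemma fischer_self_eq_0_iff: "fischer f f = 0 \<longleftrightarrow> f = 0"
proof
  assume "fischer f f = 0"
  then have "(\<Sum>a\<in>keys f.
     (cmod (lookup f a))\<^sup>2 * of_nat (exp_fact a)) = 0"
    unfolding fischer_self of_real_eq_0_iff .
  then have "\<forall>a\<in>keys f. (cmod (lookup f a))\<^sup>2 * of_nat (exp_fact a) = 0"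
    by (subst (asm) sum_nonneg_eq_0_iff) auto
  then show "f = 0"
    by (intro poly_mapping_eqI) (metis exp_fact_pos in_keys_iff lookup_zero mult_eq_0_iff norm_eq_zero
        of_nat_eq_0_iff order_less_irrefl power_eq_0_iff)
qed simp

definition fischer_norm2 :: "matrix_poly \<Rightarrow> real" where
  "fischer_norm2 f = Re (fischer f f)"

lemma fischer_norm2_nonneg: "fischer_norm2 f \<ge> 0"
  unfolding fischer_norm2_def fischer_self by (simp add: sum_nonneg)

lemma fischer_eq_norm2: "fischer f f = of_real (fischer_norm2 f)"
  unfolding fischer_norm2_def fischer_self by simp

lemma fischer_norm2_pos: "f \<noteq> 0 \<Longrightarrow> fischer_norm2 f > 0"
  using fischer_norm2_nonneg[of f] fischer_self_eq_0_iff[of f] fischer_eq_norm2[of f]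
  by (metis less_eq_real_def of_real_0)

text \<open>After the shift of exponents by \<open>(i, j)\<close> both sides are sums over the
  monomials of \<open>f\<close>: the factor produced by differentiation is the ratio of
  \<open>exp_fact\<close> at the shifted and the original exponent.\<close>

lemma fischer_Var_adjoint: "fischer (Var i j * f) g = fischer f (partial_deriv (i, j) g)"
proof -
  define s where "s = (\<lambda>a. a + unit_exp (i, j))"
  have inj: "inj_on s A" for A by (auto simp: s_def inj_on_def)
  have "keys (Var i j * f) \<subseteq> s ` keys f"
    using keys_mult[of "Var i j" f] by (auto simp: Var_def s_def add.commute)
  then have "fischer (Var i j * f) g = (\<Sum>a\<in>s ` keys f. lookup (Var i j * f) a
      * cnj (lookup g a) * of_nat (exp_fact a))"
    by (intro fischer_superset) auto
  also have "\<dots> = (\<Sum>a\<in>keys f. lookup (Var i j * f) (s a)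
      * cnj (lookup g (s a)) * of_nat (exp_fact (s a)))"
    by (subst sum.reindex[OF inj]) simp
  also have "\<dots> = fischer f (partial_deriv (i, j) g)"
    unfolding fischer_def s_def lookup_Var_mult_plus exp_fact_plus_unit lookup_partial_deriv
    by (intro sum.cong refl) (simp only: of_nat_mult complex_cnj_mult complex_cnj_of_nat mult_ac)
  finally show ?thesis .
qed

lemma fischer_partial_deriv_adjoint: "fischer (partial_deriv (i, j) f) g = fischer f (Var i j * g)"
  by (subst (1 2) fischer_cnj) (simp add: fischer_Var_adjoint)

lemma fischer_col_op: "fischer (col_op C i j f) g = fischer f (col_op C j i g)"
  by (simp add: col_op_def fischer_sum_left fischer_sum_right fischer_Var_adjoint
      fischer_partial_deriv_adjoint)

section \<open>Orthogonal bases\<close>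

text \<open>Scalars are embedded as constant polynomials; this gives spans, independence and
  dimension bounds for spaces of highest weight vectors.\<close>

interpretation poly_vs: vector_space "\<lambda>c (f :: matrix_poly). Const c * f"
  by unfold_locales (simp_all add: Const_add Const_mult algebra_simps)

definition fischer_orthogonal :: "matrix_poly set \<Rightarrow> bool" where
  "fischer_orthogonal B \<longleftrightarrow> 0 \<notin> B \<and> (\<forall>x\<in>B. \<forall>y\<in>B. x \<noteq> y \<longrightarrow> fischer x y = 0)"

lemma fischer_span_eq_0:
  assumes "\<And>b. b \<in> B \<Longrightarrow> fischer x b = 0" "y \<in> poly_vs.span B"
  shows "fischer x y = 0"
  using assms(2)
  by (induction rule: poly_vs.span_induct_alt)
    (simp_all add: fischer_add_right fischer_Const_right assms(1))

lemma fischer_orthogonal_projection: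
  assumes "finite B" "fischer_orthogonal B"
  obtains y where "y \<in> poly_vs.span B" "\<And>z. z \<in> poly_vs.span B \<Longrightarrow> fischer (x - y) z = 0"
proof -
  define y where "y = (\<Sum>b\<in>B. Const (fischer x b / fischer b b) * b)"
  have "y \<in> poly_vs.span B"
    unfolding y_def by (intro poly_vs.span_sum poly_vs.span_scale poly_vs.span_base)
  moreover have "fischer (x - y) c = 0" if c: "c \<in> B" for c
  proof -
    have "fischer y c = (\<Sum>b\<in>B. if b = c then fischer x c else 0)"
      unfolding y_def fischer_sum_left fischer_Const_left
      using assms(2) c by (intro sum.cong) (auto simp: fischer_orthogonal_def fischer_self_eq_0_iff)
    then show ?thesis using assms(1) c by (simp add: fischer_diff_left)
  qed
  ultimately show ?thesis
    using fischer_span_eq_0 that by blast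
qed

lemma fischer_orthogonal_insert:
  assumes "fischer_orthogonal B" "x \<noteq> 0" "\<And>z. z \<in> B \<Longrightarrow> fischer x z = 0"
  shows "fischer_orthogonal (insert x B)"
  using assms unfolding fischer_orthogonal_def by (metis complex_cnj_zero fischer_cnj insert_iff)

lemma fischer_gram_schmidt:
  assumes "finite S"
  obtains B where "finite B" "fischer_orthogonal B" "poly_vs.span B = poly_vs.span S"
  using assms
proof (induction S arbitrary: thesis)
  case empty
  show ?case by (rule empty[of "{}"]) (simp_all add: fischer_orthogonal_def)
next
  case (insert s S)
  obtain B where B: "finite B" "fischer_orthogonal B" "poly_vs.span B = poly_vs.span S"
    using insert.IH by blast
  obtain y where y: "y \<in> poly_vs.span B" "\<And>z. z \<in> poly_vs.span B \<Longrightarrow> fischer (s - y) z = 0"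
    using fischer_orthogonal_projection[OF B(1,2)] by blast
  have eq: "poly_vs.span (insert (s - y) B) = poly_vs.span (insert s S)"
  proof -
    have "poly_vs.span (insert (s - y) B) = poly_vs.span (insert s B)"
    proof (rule poly_vs.span_eq[THEN iffD2], intro conjI insert_subsetI)
      have "y \<in> poly_vs.span (insert s B)"
        using y(1) poly_vs.span_mono[of B "insert s B"] by blast
      then show "s - y \<in> poly_vs.span (insert s B)"
        by (intro poly_vs.span_diff) (auto intro: poly_vs.span_base)
      have "y \<in> poly_vs.span (insert (s - y) B)"
        using y(1) poly_vs.span_mono[of B "insert (s - y) B"] by blast
      then have "(s - y) + y \<in> poly_vs.span (insert (s - y) B)"
        by (intro poly_vs.span_add) (auto intro: poly_vs.span_base)
      then show "s \<in> poly_vs.span (insert (s - y) B)" by simp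
    qed (auto intro: poly_vs.span_base)
    also have "\<dots> = poly_vs.span (insert s S)"
      using B(3) by (simp add: poly_vs.span_insert)
    finally show ?thesis .
  qed
  show ?case
  proof (cases "s - y = 0")
    case True
    with eq have "poly_vs.span B = poly_vs.span (insert s S)"
      using poly_vs.span_insert_0 by metis
    with B show ?thesis by (intro insert.prems(1))
  next
    case False
    then have "fischer_orthogonal (insert (s - y) B)"
      using B(2) y(2) by (intro fischer_orthogonal_insert) (auto intro: poly_vs.span_base)
    then show ?thesis
      using B(1) eq by (intro insert.prems(1)[of "insert (s - y) B"]) auto
  qed
qed

text \<open>A maximal independent subset is finite because \<open>S\<close> spans, and the
  Gram-Schmidt process makes it orthogonal.\<close>

lemma subspace_orthogonal_basis:
  assumes "poly_vs.subspace A" "finite S" "A \<subseteq> poly_vs.span S"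
  obtains B where "finite B" "fischer_orthogonal B" "poly_vs.span B = A"
proof -
  obtain B where B: "B \<subseteq> A" "poly_vs.independent B" "A \<subseteq> poly_vs.span B"
    using poly_vs.maximal_independent_subset by blast
  have "finite B"
    using poly_vs.independent_span_bound[OF assms(2) B(2)] B(1) assms(3) by blast
  moreover have "poly_vs.span B = A"
    using B assms(1) by (simp add: poly_vs.span_minimal subset_antisym)
  ultimately show ?thesis
    using fischer_gram_schmidt[of B] that by metis
qed

lemma fischer_orthogonal_independent:
  assumes "finite B" "fischer_orthogonal B"
  shows "poly_vs.independent B"
proof
  assume "poly_vs.dependent B"
  then obtain u v where u: "(\<Sum>v\<in>B. Const (u v) * v) = 0" and v: "v \<in> B" "u v \<noteq> 0"
    unfolding poly_vs.dependent_finite[OF assms(1)] by blast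
  have "fischer (\<Sum>v\<in>B. Const (u v) * v) v = (\<Sum>b\<in>B. if b = v then u v * fischer v v else 0)"
    unfolding fischer_sum_left fischer_Const_left
    using assms(2) v(1) by (intro sum.cong) (auto simp: fischer_orthogonal_def)
  with u v assms(1) have "fischer v v = 0" by simp
  with v assms(2) show False by (auto simp: fischer_self_eq_0_iff fischer_orthogonal_def)
qed


section \<open>Strings of \<open>sl\<^sub>2\<close>\<close>

text \<open>Let E be the raising operator \<open>i j\<close> and F the lowering operator
  \<open>j i\<close>. Since \<open>t\<close> is killed by E and has weight \<open>w\<close>, E
  F^(k+1) t = (k+1)(w - k) F^k t. As E and F are adjoint, the square norm of F^(k+1) t is (k+1)(w -
  k) times that of F^k t, and nonnegativity of norms bounds the length of the string.\<close>

lemma sl2_lowering_string: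
  assumes C: "finite C" and ij: "i \<noteq> j"
    and E: "col_op C i j t = 0"
    and H: "col_op C i i t - col_op C j j t = Const (of_real w) * t"
    and w: "w \<in> \<int>"
    and F: "(col_op C j i ^^ c) t \<noteq> 0"
  shows "real c \<le> w"
proof -
  define F where "F = col_op C j i"
  define h where "h = (\<lambda>x. col_op C i i x - col_op C j j x)"
  have hF: "h (F x) = F (h x) - Const 2 * F x" for x
    using ij by (simp add: h_def F_def col_op_commutator[OF C, of i i j i]
        col_op_commutator[OF C, of j j j i] col_op_diff Const_add[of 1 1, simplified] algebra_simps)
  have FC: "F (Const c * x) = Const c * F x" for c x
    by (simp add: F_def col_op_Const_mult)
  have EF: "col_op C i j (F x) = F (col_op C i j x) + h x" for x
    using C by (simp add: h_def F_def col_op_commutator[OF C, of i j j i])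
  have hFk: "h ((F ^^ k) t) = Const (of_real w - 2 * of_nat k) * (F ^^ k) t" for k
  proof (induction k)
    case 0
    then show ?case using H by (simp add: h_def)
  next
    case (Suc k)
    have "h ((F ^^ Suc k) t) = F (h ((F ^^ k) t)) - Const 2 * (F ^^ Suc k) t"
      by (simp add: hF)
    also have "\<dots> = Const (of_real w - 2 * of_nat k) * (F ^^ Suc k) t - Const 2 * (F ^^ Suc k) t"
      by (simp add: Suc.IH FC)
    also have "\<dots> = Const (of_real w - 2 * of_nat (Suc k)) * (F ^^ Suc k) t"
      by (simp only: Const_diff[symmetric] left_diff_distrib[symmetric]) (simp add: diff_diff_eq)
    finally show ?case .
  qed
  have EFk: "col_op C i j ((F ^^ Suc k) t) = Const (of_real (real (Suc k) * (w - real k))) * (F ^^ k) t" for k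
  proof (induction k)
    case 0
    then show ?case using hFk[of 0] E FC[of 0] by (simp add: EF)
  next
    case (Suc k)
    have "col_op C i j ((F ^^ Suc (Suc k)) t) = F (col_op C i j ((F ^^ Suc k) t)) + h ((F ^^ Suc k) t)"
      by (simp add: EF)
    also have "\<dots> = Const (of_real (real (Suc k) * (w - real k))) * (F ^^ Suc k) t
        + Const (of_real w - 2 * of_nat (Suc k)) * (F ^^ Suc k) t"
      by (simp only: Suc.IH hFk) (simp add: F_def col_op_Const_mult)
    also have "\<dots> = Const (of_real (real (Suc k) * (w - real k)) + (of_real w - 2 * of_nat (Suc k)))
        * (F ^^ Suc k) t"
      by (simp only: Const_add distrib_right)
    also have "of_real (real (Suc k) * (w - real k)) + (of_real w - 2 * of_nat (Suc k))
        = (of_real (real (Suc (Suc k)) * (w - real (Suc k))) :: complex)"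
      by (simp add: algebra_simps)
    finally show ?case .
  qed
  have norm: "fischer_norm2 ((F ^^ Suc k) t) = real (Suc k) * (w - real k) * fischer_norm2 ((F ^^ k) t)" for k
  proof -
    have "fischer ((F ^^ Suc k) t) ((F ^^ Suc k) t) = fischer ((F ^^ k) t) (col_op C i j ((F ^^ Suc k) t))"
      by (simp add: F_def fischer_col_op)
    also have "\<dots> = of_real (real (Suc k) * (w - real k)) * fischer ((F ^^ k) t) ((F ^^ k) t)"
      unfolding EFk fischer_Const_right by simp
    finally show ?thesis
      unfolding fischer_eq_norm2 by (simp only: of_real_mult[symmetric] of_real_eq_iff)
  qed
  show ?thesis
  proof (cases c)
    \<comment> \<open>Even the empty string carries information: the square norm of F t is
      \<open>w\<close> times that of \<open>t\<close>, so \<open>w\<close> is nonnegative.\<close>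
    case 0
    then have "fischer_norm2 t > 0" using F by (auto intro: fischer_norm2_pos)
    moreover have "w * fischer_norm2 t \<ge> 0"
      using norm[of 0] fischer_norm2_nonneg[of "F t"] by simp
    ultimately show ?thesis using 0 by (simp add: zero_le_mult_iff)
  next
    case (Suc k)
    then have "fischer_norm2 ((F ^^ Suc k) t) > 0"
      using F by (auto intro: fischer_norm2_pos simp: F_def)
    then have "real (Suc k) * (w - real k) * fischer_norm2 ((F ^^ k) t) > 0" by (simp only: norm)
    moreover have "fischer_norm2 ((F ^^ k) t) \<ge> 0" by (rule fischer_norm2_nonneg)
    \<comment> \<open>Positivity gives only \<open>w > k\<close>; integrality of \<open>w\<close>
      raises this to \<open>w \<ge> Suc k\<close>.\<close>
    ultimately have "w - real k > 0"
      by (metis mult_nonneg_nonpos mult_nonpos_nonneg not_less of_nat_0_le_iff)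
    moreover obtain z where "w = of_int z" using w by (auto elim: Ints_cases)
    ultimately have "real_of_int (int k) < real_of_int z" by simp
    then have "int k < z" by (simp only: of_int_less_iff)
    then have "real_of_int (int c) \<le> real_of_int z" using Suc by (simp only: of_int_le_iff)
    with \<open>w = of_int z\<close> show ?thesis by simp
  qed
qed

declare One_nat_def [simp del]

section \<open>Invariant subspaces and highest weight vectors among polynomials\<close>

text \<open>The degrees \<open>d\<close> are the weight for the second gl_n, which acts on columns
  and commutes with the given action.\<close>

definition col_homogeneous :: "nat \<Rightarrow> (nat \<Rightarrow> nat) \<Rightarrow> matrix_poly set" where
  "col_homogeneous n d = {f. \<forall>a\<in>keys f. keys a \<subseteq> {1..n} \<times> {1..n} \<and>
     (\<forall>k\<in>{1..n}. (\<Sum>r=1..n. lookup a (r, k)) = d k)}"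

text \<open>Asked of the matrix units only, so that invariance can be used before the enveloping
  algebra enters; \<open>gl_stable_act\<close> extends it to all of \<open>U_gl n\<close>.\<close>

definition gl_stable :: "nat \<Rightarrow> matrix_poly set \<Rightarrow> bool" where
  "gl_stable n N \<longleftrightarrow> poly_vs.subspace N \<and>
     (\<forall>i\<in>{1..n}. \<forall>j\<in>{1..n}. \<forall>x\<in>N. col_op {1..n} i j x \<in> N)"

text \<open>Zero is included, which makes this a subspace. The weight is a bare function, since the
  weight of a highest weight vector is at first just the row sums of one of its exponents.\<close>

definition hw_space :: "nat \<Rightarrow> (nat \<Rightarrow> nat) \<Rightarrow> matrix_poly set" where
  "hw_space n \<mu> = {f. (\<forall>i\<in>{1..n}. \<forall>j\<in>{1..n}. i < j \<longrightarrow> col_op {1..n} i j f = 0) \<and>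
     (\<forall>i\<in>{1..n}. col_op {1..n} i i f = Const (of_nat (\<mu> i)) * f)}"

lemma keys_Const_mult: "keys (Const c * f) \<subseteq> keys f"
  by (auto simp: in_keys_iff lookup_Const_mult)

lemma subspace_col_homogeneous: "poly_vs.subspace (col_homogeneous n d)"
proof (rule poly_vs.subspaceI)
  fix c x assume "x \<in> col_homogeneous n d"
  then show "Const c * x \<in> col_homogeneous n d"
    using keys_Const_mult[of c x] unfolding col_homogeneous_def by blast
next
  fix x y assume "x \<in> col_homogeneous n d" "y \<in> col_homogeneous n d"
  then show "x + y \<in> col_homogeneous n d"
    using keys_add[of x y] unfolding col_homogeneous_def by blast
qed (simp add: col_homogeneous_def)

lemma keys_plus_nat:
  fixes a b :: "'a \<Rightarrow>\<^sub>0 nat"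
  shows "keys (a + b) = keys a \<union> keys b"
  by (auto simp: in_keys_iff lookup_add)

lemma sum_lookup_unit_exp_col:
  assumes "i \<in> {1..n}"
  shows "(\<Sum>r=1..n. lookup (unit_exp (i, k)) (r, c)) = (if c = k then 1 else 0)"
proof -
  have "(\<Sum>r=1..n. lookup (unit_exp (i, k)) (r, c)) =
      (\<Sum>r=1..n. if r = i then (if c = k then 1 else 0) else 0)"
    by (intro sum.cong) (auto simp: lookup_single when_def)
  then show ?thesis using assms by simp
qed

text \<open>\<open>E_ij\<close> moves a factor from row \<open>j\<close> to row \<open>i\<close>
  without leaving its column.\<close>

lemma gl_stable_col_homogeneous: "gl_stable n (col_homogeneous n d)"
  unfolding gl_stable_def
proof (intro conjI ballI)
  fix i j x assume i: "i \<in> {1..n}" and j: "j \<in> {1..n}" and x: "x \<in> col_homogeneous n d"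
  show "col_op {1..n} i j x \<in> col_homogeneous n d"
    unfolding col_homogeneous_def
  proof (intro CollectI ballI)
    fix a assume "a \<in> keys (col_op {1..n} i j x)"
    then obtain c k where k: "k \<in> {1..n}" and c: "c + unit_exp (j, k) \<in> keys x"
      and a: "a = c + unit_exp (i, k)"
      by (rule keys_col_op)
    have "keys (c + unit_exp (j, k)) \<subseteq> {1..n} \<times> {1..n}"
      and *: "\<And>q. q \<in> {1..n} \<Longrightarrow> (\<Sum>r=1..n. lookup (c + unit_exp (j, k)) (r, q)) = d q"
      using x c unfolding col_homogeneous_def by blast+
    then have "keys a \<subseteq> {1..n} \<times> {1..n}"
      using i k unfolding a keys_plus_nat by auto
    moreover have "(\<Sum>r=1..n. lookup a (r, q)) = d q" if "q \<in> {1..n}" for q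
      using *[OF that] i j unfolding a lookup_add sum.distrib by (simp add: sum_lookup_unit_exp_col)
    ultimately show "keys a \<subseteq> {1..n} \<times> {1..n} \<and>
        (\<forall>q\<in>{1..n}. (\<Sum>r=1..n. lookup a (r, q)) = d q)" by blast
  qed
qed (rule subspace_col_homogeneous)

lemma finite_poly_mapping_bounded:
  assumes "finite A"
  shows "finite {a :: 'a \<Rightarrow>\<^sub>0 nat. keys a \<subseteq> A \<and> (\<forall>p\<in>A. lookup a p \<le> m)}"
    (is "finite ?S")
proof (rule finite_imageD)
  show "finite ((\<lambda>a. \<lambda>p\<in>A. lookup a p) ` ?S)"
    by (rule finite_subset[OF _ finite_PiE[OF assms, of "\<lambda>_. {..m}"]]) auto
  show "inj_on (\<lambda>a. \<lambda>p\<in>A. lookup a p) ?S"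
  proof (rule inj_onI)
    fix a b assume a: "a \<in> ?S" and b: "b \<in> ?S"
      and eq: "(\<lambda>p\<in>A. lookup a p) = (\<lambda>p\<in>A. lookup b p)"
    show "a = b"
    proof (rule poly_mapping_eqI)
      fix p show "lookup a p = lookup b p"
      proof (cases "p \<in> A")
        case True
        with fun_cong[OF eq, of p] show ?thesis by simp
      next
        case False
        then have "p \<notin> keys a" "p \<notin> keys b" using a b by blast+
        then show ?thesis by (simp add: in_keys_iff)
      qed
    qed
  qed
qed

text \<open>The column degrees bound every exponent, so only finitely many monomials occur.\<close>

lemma col_homogeneous_finite_span:
  obtains S where "finite S" "col_homogeneous n d \<subseteq> poly_vs.span S"
proof -
  define m where "m = (\<Sum>k=1..n. d k)"
  define K where "K = {a. keys a \<subseteq> {1..n} \<times> {1..n} \<and>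
      (\<forall>p\<in>{1..n} \<times> {1..n}. lookup a p \<le> m)}"
  define S where "S = (\<lambda>a. single a 1 :: matrix_poly) ` K"
  have "finite S" unfolding S_def K_def by (intro finite_imageI finite_poly_mapping_bounded) simp
  moreover have "f \<in> poly_vs.span S" if f: "f \<in> col_homogeneous n d" for f
  proof (subst matrix_poly_eq_sum_single, rule poly_vs.span_sum)
    fix a assume a: "a \<in> keys f"
    have "a \<in> K"
      unfolding K_def
    proof (intro CollectI conjI ballI)
      show "keys a \<subseteq> {1..n} \<times> {1..n}" using f a by (auto simp: col_homogeneous_def)
      fix p assume p: "p \<in> {1..n} \<times> {1..n}"
      have "lookup a (fst p, snd p) \<le> (\<Sum>r=1..n. lookup a (r, snd p))"
        using p by (intro member_le_sum) auto
      also have "\<dots> = d (snd p)" using f a p by (auto simp: col_homogeneous_def)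
      also have "\<dots> \<le> m" unfolding m_def using p by (intro member_le_sum) auto
      finally show "lookup a p \<le> m" by simp
    qed
    then have "single a 1 \<in> S" by (simp add: S_def)
    then have "Const (lookup f a) * single a 1 \<in> poly_vs.span S"
      by (intro poly_vs.span_scale poly_vs.span_base)
    then show "single a (lookup f a) \<in> poly_vs.span S"
      by (simp add: Const_def mult_single)
  qed
  ultimately show ?thesis using that by blast
qed

lemma subspace_hw_space: "poly_vs.subspace (hw_space n \<mu>)"
  by (rule poly_vs.subspaceI)
    (auto simp: hw_space_def col_op_add col_op_Const_mult distrib_left mult.left_commute)

section \<open>Weights of monomials and existence of highest weight vectors\<close>

definition row_sum :: "nat \<Rightarrow> (nat \<times> nat \<Rightarrow>\<^sub>0 nat) \<Rightarrow> nat \<Rightarrow> nat" where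
  "row_sum n a i = (\<Sum>k=1..n. lookup a (i, k))"

lemma row_sum_add: "row_sum n (a + b) i = row_sum n a i + row_sum n b i"
  by (simp add: row_sum_def lookup_add sum.distrib)

lemma row_sum_unit_exp:
  assumes "k \<in> {1..n}"
  shows "row_sum n (unit_exp (j, k)) i = (if i = j then 1 else 0)"
proof -
  have "row_sum n (unit_exp (j, k)) i = (\<Sum>q=1..n. if q = k then (if i = j then 1 else 0) else 0)"
    unfolding row_sum_def by (intro sum.cong) (auto simp: lookup_single when_def)
  then show ?thesis using assms by simp
qed

lemma hw_space_row_sum:
  assumes "f \<in> hw_space n \<mu>" "a \<in> keys f" "i \<in> {1..n}"
  shows "row_sum n a i = \<mu> i"
proof -
  have "lookup (col_op {1..n} i i f) a = of_nat (\<mu> i) * lookup f a"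
    using assms by (simp add: hw_space_def lookup_Const_mult)
  then have "of_nat (row_sum n a i) * lookup f a = of_nat (\<mu> i) * lookup f a"
    unfolding lookup_col_op_diag by (simp add: row_sum_def)
  then have "(of_nat (row_sum n a i) :: complex) = of_nat (\<mu> i)"
    using assms(2) by (simp add: in_keys_iff)
  then show ?thesis by simp
qed

lemma sum_row_sum:
  assumes "f \<in> col_homogeneous n d" "a \<in> keys f"
  shows "(\<Sum>i=1..n. row_sum n a i) = (\<Sum>k=1..n. d k)"
proof -
  have "(\<Sum>i=1..n. row_sum n a i) = (\<Sum>k=1..n. \<Sum>i=1..n. lookup a (i, k))"
    unfolding row_sum_def by (rule sum.swap)
  also have "\<dots> = (\<Sum>k=1..n. d k)"
    using assms by (intro sum.cong) (auto simp: col_homogeneous_def)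
  finally show ?thesis .
qed

text \<open>A nonzero element \<open>y\<close> with fewest monomials is a weight vector: if two of
  its monomials differ in row \<open>i\<close>, subtracting from \<open>E_ii y\<close> the multiple
  of \<open>y\<close> by the row sum of one of them removes that monomial, keeps the other, and adds
  none.\<close>

lemma gl_stable_weight_vector:
  assumes N: "gl_stable n N" "x \<in> N" "x \<noteq> 0"
  obtains y where "y \<in> N" "y \<noteq> 0"
    "\<forall>a\<in>keys y. \<forall>b\<in>keys y. \<forall>i\<in>{1..n}. row_sum n a i = row_sum n b i"
proof -
  obtain y where y: "y \<in> N \<and> y \<noteq> 0"
    and min: "\<And>z. z \<in> N \<and> z \<noteq> 0 \<Longrightarrow> card (keys y) \<le> card (keys z)"
    using ex_has_least_nat[of "\<lambda>y. y \<in> N \<and> y \<noteq> 0" x "\<lambda>y. card (keys y)"] N by auto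
  have "row_sum n a i = row_sum n b i"
    if a: "a \<in> keys y" and b: "b \<in> keys y" and i: "i \<in> {1..n}" for a b i
  proof (rule ccontr)
    assume neq: "row_sum n a i \<noteq> row_sum n b i"
    define z where "z = col_op {1..n} i i y - Const (of_nat (row_sum n a i)) * y"
    have z: "lookup z c =
        (of_nat (row_sum n c i) - of_nat (row_sum n a i)) * lookup y c" for c
      by (simp add: z_def lookup_minus lookup_col_op_diag lookup_Const_mult row_sum_def left_diff_distrib)
    have "z \<in> N"
      using N(1) y i unfolding z_def gl_stable_def
      by (intro poly_vs.subspace_diff poly_vs.subspace_scale) auto
    moreover have "z \<noteq> 0"
    proof
      assume "z = 0"
      with z[of b] b neq show False by (simp add: in_keys_iff)
    qed
    moreover have "keys z \<subset> keys y"
      using z a by (auto simp: in_keys_iff psubset_eq)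
    then have "card (keys z) < card (keys y)"
      by (intro psubset_card_mono) auto
    ultimately show False using min[of z] by simp
  qed
  with y show ?thesis using that by blast
qed

text \<open>A linear functional on weights that every raising operator \<open>E_ij\<close>,
  \<open>i < j\<close>, increases by \<open>j - i\<close>.\<close>

definition height :: "nat \<Rightarrow> (nat \<times> nat \<Rightarrow>\<^sub>0 nat) \<Rightarrow> nat" where
  "height n a = (\<Sum>i=1..n. (n - i) * row_sum n a i)"

lemma height_add: "height n (a + b) = height n a + height n b"
  by (simp add: height_def row_sum_add distrib_left sum.distrib)

lemma height_unit_exp:
  assumes "j \<in> {1..n}" "k \<in> {1..n}"
  shows "height n (unit_exp (j, k)) = n - j"
proof -
  have "height n (unit_exp (j, k)) = (\<Sum>i=1..n. if i = j then n - j else 0)"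
    unfolding height_def using assms by (intro sum.cong) (auto simp: row_sum_unit_exp)
  then show ?thesis using assms by simp
qed

text \<open>A weight vector of maximal height is killed by every raising operator, because a nonzero
  image would be a weight vector in \<open>N\<close> of larger height. Pairs of a vector and one of
  its exponents are maximized, as the weight is read off an exponent.\<close>

lemma gl_stable_hw_vector:
  assumes N: "gl_stable n N" "N \<subseteq> col_homogeneous n d" "N \<noteq> {0}"
  obtains y a where "y \<in> N" "y \<noteq> 0" "a \<in> keys y" "y \<in> hw_space n (row_sum n a)"
proof -
  define wt where "wt = (\<lambda>y. y \<in> N \<and> y \<noteq> 0 \<and> (\<forall>a\<in>keys y. \<forall>b\<in>keys y.
     \<forall>i\<in>{1..n}. row_sum n a i = row_sum n b i))"
  define P where "P = (\<lambda>p. wt (fst p) \<and> snd p \<in> keys (fst p))"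
  have "0 \<in> N" using N(1) unfolding gl_stable_def by (simp add: poly_vs.subspace_0)
  then obtain x where x: "x \<in> N" "x \<noteq> 0" using N(3) by blast
  obtain y where "y \<in> N" "y \<noteq> 0" "\<forall>a\<in>keys y. \<forall>b\<in>keys y.
      \<forall>i\<in>{1..n}. row_sum n a i = row_sum n b i"
    by (rule gl_stable_weight_vector[OF N(1) x])
  then have y: "wt y" unfolding wt_def by blast
  then obtain a where "a \<in> keys y" unfolding wt_def
    by (metis keys_eq_empty ex_in_conv)
  with y have P: "P (y, a)" by (simp add: P_def)
  define D where "D = (\<Sum>k=1..n. d k)"
  \<comment> \<open>The column degrees fix the total degree \<open>D\<close>, which bounds every row
    sum and hence the height, so a maximum exists.\<close>
  have "height n (snd p) \<le> n * (n * D)" if "P p" for p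
  proof -
    have "row_sum n (snd p) i \<le> D" if "i \<in> {1..n}" for i
    proof -
      have "row_sum n (snd p) i \<le> (\<Sum>i=1..n. row_sum n (snd p) i)"
        using that by (intro member_le_sum) auto
      also have "\<dots> = D"
        unfolding D_def using \<open>P p\<close> N(2) by (intro sum_row_sum[of "fst p"]) (auto simp: P_def wt_def)
      finally show ?thesis .
    qed
    then have "(n - i) * row_sum n (snd p) i \<le> n * D" if "i \<in> {1..n}" for i
      using that by (intro mult_le_mono) auto
    then show ?thesis
      unfolding height_def using sum_bounded_above[of "{1..n}" "\<lambda>i. (n - i) * row_sum n (snd p) i" "n * D"]
      by simp
  qed
  then have "\<forall>p. P p \<longrightarrow> height n (snd p) < Suc (n * (n * D))" by (simp add: less_Suc_eq_le)
  from ex_has_greatest_nat[of P, OF P this]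
  obtain p where p: "P p" and max: "\<And>q. P q \<Longrightarrow> height n (snd q) \<le> height n (snd p)" by blast
  obtain y a where ya: "p = (y, a)" by (cases p)
  have y: "wt y" "a \<in> keys y" using p by (auto simp: P_def ya)
  have "col_op {1..n} i j y = 0" if ij: "i \<in> {1..n}" "j \<in> {1..n}" "i < j" for i j
  proof (rule ccontr)
    assume nz: "col_op {1..n} i j y \<noteq> 0"
    \<comment> \<open>An exponent of the image comes from one of \<open>y\<close> by moving a unit
      from row \<open>j\<close> to row \<open>i\<close>; the relation of row sums is written with
      additions on both sides to avoid subtraction.\<close>
    have key: "\<exists>b. b \<in> keys y \<and> height n c > height n b \<and>
         (\<forall>r\<in>{1..n}. row_sum n c r + (if r = j then 1 else 0) = row_sum n b r + (if r = i then 1 else 0))"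
      if "c \<in> keys (col_op {1..n} i j y)" for c
    proof -
      from that obtain e k where k: "k \<in> {1..n}" "e + unit_exp (j, k) \<in> keys y"
        and c: "c = e + unit_exp (i, k)" by (rule keys_col_op)
      have "n - j < n - i" using ij by auto
      then have "height n (e + unit_exp (j, k)) < height n c"
        unfolding c height_add using ij k(1) by (simp add: height_unit_exp)
      moreover have "row_sum n c r + (if r = j then 1 else 0) =
          row_sum n (e + unit_exp (j, k)) r + (if r = i then 1 else 0)" for r
        unfolding c row_sum_add using k(1) by (simp add: row_sum_unit_exp)
      ultimately show ?thesis using k(2) by blast
    qed
    obtain c where c: "c \<in> keys (col_op {1..n} i j y)"
      using nz by (metis keys_eq_empty ex_in_conv)
    have "wt (col_op {1..n} i j y)"
      unfolding wt_def
    proof (intro conjI ballI)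
      show "col_op {1..n} i j y \<in> N" using N(1) y(1) ij unfolding gl_stable_def wt_def by blast
      fix c c' r assume c: "c \<in> keys (col_op {1..n} i j y)"
        and c': "c' \<in> keys (col_op {1..n} i j y)" and r: "r \<in> {1..n}"
      obtain b where b: "b \<in> keys y"
        and 1: "row_sum n c r + (if r = j then 1 else 0) = row_sum n b r + (if r = i then 1 else 0)"
        using key[OF c] r by blast
      obtain b' where b': "b' \<in> keys y"
        and 2: "row_sum n c' r + (if r = j then 1 else 0) = row_sum n b' r + (if r = i then 1 else 0)"
        using key[OF c'] r by blast
      have "row_sum n b r = row_sum n b' r" using y(1) b b' r unfolding wt_def by blast
      with 1 2 show "row_sum n c r = row_sum n c' r" by linarith
    qed (rule nz)
    with c have "P (col_op {1..n} i j y, c)" by (simp add: P_def)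
    from max[OF this] have "height n c \<le> height n a" by (simp add: ya)
    moreover obtain b where "b \<in> keys y" "height n c > height n b"
      using key[OF c] by blast
    moreover have "height n b' = height n a" if "b' \<in> keys y" for b'
    proof -
      have "row_sum n b' i = row_sum n a i" if "i \<in> {1..n}" for i
        using y \<open>b' \<in> keys y\<close> that unfolding wt_def by blast
      then show ?thesis unfolding height_def by (intro sum.cong) auto
    qed
    ultimately show False by simp
  qed
  moreover have "col_op {1..n} i i y = Const (of_nat (row_sum n a i)) * y" if i: "i \<in> {1..n}" for i
  proof (rule poly_mapping_eqI)
    fix b
    show "lookup (col_op {1..n} i i y) b =
        lookup (Const (of_nat (row_sum n a i)) * y) b"
    proof (cases "b \<in> keys y")
      case True
      then have "row_sum n b i = row_sum n a i" using y i unfolding wt_def by blast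
      then show ?thesis by (simp add: lookup_col_op_diag lookup_Const_mult row_sum_def)
    qed (simp add: lookup_col_op_diag lookup_Const_mult in_keys_iff)
  qed
  ultimately have "y \<in> hw_space n (row_sum n a)" by (simp add: hw_space_def)
  with y show ?thesis using that unfolding wt_def by blast
qed

text \<open>The empty string in \<open>sl2_lowering_string\<close>, for rows \<open>i\<close> and
  \<open>Suc i\<close>: a nonzero vector killed by the raising operator has nonnegative
  sl_2-weight.\<close>

lemma hw_space_dominant:
  assumes "f \<in> hw_space n \<mu>" "f \<noteq> 0" "i \<in> {1..n}" "Suc i \<in> {1..n}"
  shows "\<mu> (Suc i) \<le> \<mu> i"
proof -
  have "real 0 \<le> real (\<mu> i) - real (\<mu> (Suc i))"
  proof (rule sl2_lowering_string[of "{1..n}" i "Suc i" f])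
    show "col_op {1..n} i i f - col_op {1..n} (Suc i) (Suc i) f =
        Const (of_real (real (\<mu> i) - real (\<mu> (Suc i)))) * f"
      using assms by (simp add: hw_space_def Const_diff algebra_simps)
  qed (use assms in \<open>simp_all add: hw_space_def\<close>)
  then show ?thesis by simp
qed

text \<open>\<open>E_ii\<close> is self-adjoint, and its eigenvalues on \<open>f\<close> and
  \<open>g\<close> are real and distinct.\<close>

lemma hw_space_orthogonal:
  assumes f: "f \<in> hw_space n \<mu>" and g: "g \<in> hw_space n \<nu>" and i: "i \<in> {1..n}" "\<mu> i \<noteq> \<nu> i"
  shows "fischer f g = 0"
proof -
  have "of_nat (\<mu> i) * fischer f g = fischer (col_op {1..n} i i f) g"
    using f i by (simp add: hw_space_def fischer_Const_left)
  also have "\<dots> = fischer f (col_op {1..n} i i g)" by (rule fischer_col_op)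
  also have "\<dots> = of_nat (\<nu> i) * fischer f g"
    using g i by (simp add: hw_space_def fischer_Const_right)
  finally show ?thesis using i(2) by simp
qed

section \<open>Leading exponents of highest weight vectors\<close>

text \<open>Significance of positions: later columns first, and within a column rows of larger index
  first. With this choice, moving a unit from row \<open>r\<close> to row \<open>r + 1\<close> of a
  column increases an exponent, and the diagonal term of a minor with increasing columns
  leads.\<close>

definition rank_gt :: "nat \<times> nat \<Rightarrow> nat \<times> nat \<Rightarrow> bool" where
  "rank_gt q p \<longleftrightarrow> snd q > snd p \<or> snd q = snd p \<and> fst q > fst p"

definition lex_less :: "(nat \<times> nat \<Rightarrow>\<^sub>0 nat) \<Rightarrow> (nat \<times> nat \<Rightarrow>\<^sub>0 nat) \<Rightarrow> bool" where
  "lex_less a b \<longleftrightarrow> (\<exists>p. lookup a p < lookup b p \<and>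
     (\<forall>q. rank_gt q p \<longrightarrow> lookup a q = lookup b q))"

lemma rank_gt_linear: "p \<noteq> q \<Longrightarrow> rank_gt p q \<or> rank_gt q p"
  by (auto simp: rank_gt_def prod_eq_iff)

lemma rank_gt_trans: "rank_gt p q \<Longrightarrow> rank_gt q r \<Longrightarrow> rank_gt p r"
  by (auto simp: rank_gt_def)

lemma lex_less_trans:
  assumes "lex_less a b" "lex_less b c"
  shows "lex_less a c"
proof -
  obtain p where p: "lookup a p < lookup b p"
    "\<And>q. rank_gt q p \<Longrightarrow> lookup a q = lookup b q"
    using assms(1) by (auto simp: lex_less_def)
  obtain p' where p': "lookup b p' < lookup c p'"
    "\<And>q. rank_gt q p' \<Longrightarrow> lookup b q = lookup c q"
    using assms(2) by (auto simp: lex_less_def)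
  consider "p = p'" | "rank_gt p p'" | "rank_gt p' p" using rank_gt_linear by blast
  then show ?thesis
  proof cases
    case 1
    then show ?thesis using p p' unfolding lex_less_def by (intro exI[of _ p]) auto
  next
    case 2
    then show ?thesis using p p' rank_gt_trans[of _ p p'] unfolding lex_less_def
      by (intro exI[of _ p]) auto
  next
    case 3
    then show ?thesis using p p' rank_gt_trans[of _ p' p] unfolding lex_less_def
      by (intro exI[of _ p']) auto
  qed
qed

lemma lex_less_irrefl [simp]: "\<not> lex_less a a"
  by (simp add: lex_less_def)

lemma lex_less_linear:
  assumes "a \<noteq> b"
  shows "lex_less a b \<or> lex_less b a"
proof -
  define D where "D = {p. lookup a p \<noteq> lookup b p}"
  have "D \<subseteq> keys a \<union> keys b"
    by (auto simp: D_def in_keys_iff)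
  then have fin: "finite D" by (rule finite_subset) simp
  have "D \<noteq> {}" using assms by (auto simp: D_def intro: poly_mapping_eqI)
  \<comment> \<open>The most significant difference sits in the last column that has one, and there
    in the last row.\<close>
  define m where "m = Max (snd ` D)"
  define R where "R = {r. (r, m) \<in> D}"
  have "m \<in> snd ` D" unfolding m_def using fin \<open>D \<noteq> {}\<close> by (intro Max_in) auto
  then have "R \<noteq> {}" by (auto simp: R_def)
  have "R \<subseteq> fst ` D" by (force simp: R_def)
  then have finR: "finite R" using fin finite_subset by blast
  have "Max R \<in> R" using finR \<open>R \<noteq> {}\<close> by (rule Max_in)
  then have in_D: "(Max R, m) \<in> D" by (simp add: R_def)
  have *: "lookup a q = lookup b q" if "rank_gt q (Max R, m)" for q
  proof (rule ccontr)
    assume "lookup a q \<noteq> lookup b q"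
    then have q: "q \<in> D" by (simp add: D_def)
    then have "snd q \<le> m" unfolding m_def using fin by (intro Max_ge) auto
    with that have eq: "snd q = m" "fst q > Max R" by (auto simp: rank_gt_def)
    then have "fst q \<in> R" using q by (auto simp: R_def)
    then have "fst q \<le> Max R" using finR by (intro Max_ge)
    with eq show False by simp
  qed
  from in_D have "lookup a (Max R, m) < lookup b (Max R, m) \<or>
      lookup b (Max R, m) < lookup a (Max R, m)"
    by (auto simp: D_def)
  with * show ?thesis unfolding lex_less_def by (metis (no_types, lifting))
qed

lemma lex_less_add_left: "lex_less a b \<Longrightarrow> lex_less (c + a) (c + b)"
  by (auto simp: lex_less_def lookup_add)

lemma lex_greatest_exists:
  assumes "finite A" "A \<noteq> {}"
  obtains a where "a \<in> A" "\<And>b. b \<in> A \<Longrightarrow> b = a \<or> lex_less b a"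
proof -
  have "\<exists>a\<in>A. \<forall>b\<in>A. b = a \<or> lex_less b a"
    using assms
  proof (induction A rule: finite_ne_induct)
    case (insert x A)
    then obtain a where a: "a \<in> A" "\<forall>b\<in>A. b = a \<or> lex_less b a" by blast
    consider "x = a" | "lex_less x a" | "lex_less a x" using lex_less_linear by blast
    then show ?case
    proof cases
      case 3
      then have "\<forall>b\<in>insert x A. b = x \<or> lex_less b x"
        using a lex_less_trans by (metis insert_iff)
      then show ?thesis by blast
    qed (use a in blast)+
  qed simp
  then show ?thesis using that by blast
qed

section \<open>Restriction to sets of exponents and column strictness of leading exponents\<close>

definition restrict_poly :: "((nat \<times> nat \<Rightarrow>\<^sub>0 nat) \<Rightarrow> bool) \<Rightarrow> matrix_poly \<Rightarrow> matrix_poly" where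
  "restrict_poly P f = (\<Sum>a\<in>{a \<in> keys f. P a}. single a (lookup f a))"

lemma lookup_restrict_poly:
  "lookup (restrict_poly P f) a = (if P a then lookup f a else 0)"
  unfolding restrict_poly_def lookup_sum lookup_single
  by (simp add: when_def sum.delta' in_keys_iff)

lemma fischer_funpow_col_op:
  "fischer ((col_op C i j ^^ m) x) y = fischer x ((col_op C j i ^^ m) y)"
proof (induction m arbitrary: y)
  case (Suc m)
  have "fischer ((col_op C i j ^^ Suc m) x) y = fischer ((col_op C i j ^^ m) x) (col_op C j i y)"
    by (simp add: fischer_col_op)
  also have "\<dots> = fischer x ((col_op C j i ^^ Suc m) y)"
    by (simp only: Suc.IH funpow_Suc_right o_apply)
  finally show ?case .
qed simp

lemma funpow_col_op_disjoint_commute: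
  assumes "C \<inter> D = {}"
  shows "col_op C i j ((col_op D k l ^^ m) x) = (col_op D k l ^^ m) (col_op C i j x)"
  by (induction m) (simp_all add: col_op_disjoint_commute[OF assms])

lemma funpow_col_op_Const_mult: "(col_op C i j ^^ m) (Const c * x) = Const c * (col_op C i j ^^ m) x"
  by (induction m) (simp_all add: col_op_Const_mult)

text \<open>The part of \<open>f\<close> that shares the exponents of \<open>a\<close> outside rows \<open>r, r + 1\<close> and columns up to
  \<open>j\<close> is killed by the raising operator of these columns. Grading it by the exponent of
  \<open>x\<^bsub>r+1,j\<^esub>\<close> produces a vector that is highest for the columns below \<open>j\<close> and lies in the image of
  the \<open>c\<close>-th power of their raising operator, \<open>c\<close> being that exponent in \<open>a\<close>; so its \<open>sl\<^sub>2\<close>-weight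
  is at least \<open>c\<close>.\<close>

lemma hw_leading_semistandard:
  assumes f: "f \<in> hw_space n \<mu>" "f \<in> col_homogeneous n d"
    and a: "a \<in> keys f"
    and lead: "\<And>b. b \<in> keys f \<Longrightarrow> b = a \<or> lex_less b a"
    and r: "r \<in> {1..n}" "Suc r \<in> {1..n}" and j: "j \<in> {1..n}"
  shows "(\<Sum>k=1..j. lookup a (Suc r, k)) \<le> (\<Sum>k=1..<j. lookup a (r, k))"
proof -
  define R where "R = Suc r"
  define L where "L = {1..<j}"
  define P where "P = (\<lambda>b. \<forall>p. p \<notin> {r, R} \<times> {1..j} \<longrightarrow> lookup b p = lookup a p)"
  define g where "g = (\<lambda>s. restrict_poly (\<lambda>b. P b \<and> lookup b (R, j) = s) f)"
  define c where "c = lookup a (R, j)"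
  define m where "m = (\<lambda>b k. b - unit_exp (r, k) + unit_exp (R, k))"
  have m_fold: "b - unit_exp (r, k) + unit_exp (R, k) = m b k" for b k by (simp add: m_def)
  have rR: "r \<noteq> R" "r < R" by (auto simp: R_def)
  have finL: "finite L" and disj: "L \<inter> {j} = {}" "{j} \<inter> L = {}" by (auto simp: L_def)
  have larger: "b \<notin> keys f" if "lex_less a b" for b
    using that lead[of b] lex_less_trans[of a b a] by auto
  have m_eq: "lookup (m b k) p = lookup b p"
    if "p \<noteq> (r, k)" "p \<noteq> (R, k)" for b k p
    using that by (auto simp: m_def lookup_add lookup_minus lookup_single when_def)
  have m_R: "lookup (m b k) (R, k) = Suc (lookup b (R, k))" for b k
    using rR by (auto simp: m_def lookup_add lookup_minus lookup_single when_def)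
  have P_m: "P (m b k) \<longleftrightarrow> P b" if "k \<in> {1..j}" for b k
    unfolding P_def using that m_eq by (smt (verit) SigmaI insertCI)
  \<comment> \<open>This is the vanishing of the raising operator from row \<open>R\<close> to row
    \<open>r\<close> on \<open>f\<close>, read at exponents of class \<open>P\<close> with exponent
    \<open>s\<close> at \<open>(R, j)\<close>. Columns before \<open>j\<close> leave that exponent
    alone, while column \<open>j\<close> reaches it from \<open>Suc s\<close>.\<close>
  have step: "col_op L r R (g s) + col_op {j} r R (g (Suc s)) = 0" for s
  proof (rule poly_mapping_eqI)
    fix b
    define T where "T = (\<lambda>k. if lookup b (r, k) = 0 then 0
       else of_nat (Suc (lookup b (R, k))) * lookup f (m b k))"
    define Q where "Q \<longleftrightarrow> P b \<and> lookup b (R, j) = s"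
    have "lookup (col_op L r R (g s)) b = (\<Sum>k\<in>L. if Q then T k else 0)"
      unfolding lookup_col_op[OF rR(1)] m_fold
    proof (intro sum.cong refl)
      fix k assume "k \<in> L"
      then have k: "k \<in> {1..j}" "k \<noteq> j" by (auto simp: L_def)
      have "lookup (m b k) (R, j) = lookup b (R, j)"
        using k by (intro m_eq) auto
      then have "lookup (g s) (m b k) = (if Q then lookup f (m b k) else 0)"
        using P_m[OF k(1)] by (simp add: g_def lookup_restrict_poly Q_def)
      then show "(if lookup b (r, k) = 0 then 0
         else of_nat (Suc (lookup b (R, k))) * lookup (g s) (m b k))
         = (if Q then T k else 0)" by (simp add: T_def)
    qed
    moreover have "lookup (col_op {j} r R (g (Suc s))) b = (if Q then T j else 0)"
    proof -
      have "lookup (g (Suc s)) (m b j) = (if Q then lookup f (m b j) else 0)"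
        using P_m[of j] j by (simp add: g_def lookup_restrict_poly Q_def m_R)
      then show ?thesis
        unfolding lookup_col_op[OF rR(1)] m_fold by (simp add: T_def)
    qed
    moreover have "(\<Sum>k\<in>L. T k) + T j = 0" if Q
    proof -
      \<comment> \<open>A column behind \<open>j\<close> would need a monomial of \<open>f\<close>
        with one unit more than \<open>a\<close> at \<open>(R, k)\<close> and the exponents of
        \<open>a\<close> at all more significant positions; it would exceed the leading one.\<close>
      have "T k = 0" if k: "k \<in> {1..n} - {1..j}" for k
      proof -
        have P: "lookup b p = lookup a p" if "snd p > j" for p
          using \<open>Q\<close> that unfolding Q_def P_def by (cases p) auto
        have "lex_less a (m b k)"
          unfolding lex_less_def
        proof (intro exI[of _ "(R, k)"] conjI allI impI)
          show "lookup a (R, k) < lookup (m b k) (R, k)"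
            using P[of "(R, k)"] k by (auto simp: m_R)
          fix q assume q: "rank_gt q (R, k)"
          then have "q \<noteq> (r, k)" "q \<noteq> (R, k)" "snd q > j" using rR k by (auto simp: rank_gt_def)
          then show "lookup a q = lookup (m b k) q"
            using P[of q] by (simp add: m_eq)
        qed
        then have "lookup f (m b k) = 0" using larger by (simp add: in_keys_iff)
        then show ?thesis by (simp add: T_def)
      qed
      then have "(\<Sum>k=1..n. T k) = (\<Sum>k=1..j. T k)"
        using j by (intro sum.mono_neutral_right) auto
      also have "{1..j} = insert j L" using j by (auto simp: L_def)
      also have "(\<Sum>k\<in>insert j L. T k) = T j + (\<Sum>k\<in>L. T k)"
        using finL by (intro sum.insert) (auto simp: L_def)
      finally have "(\<Sum>k\<in>L. T k) + T j = (\<Sum>k=1..n. T k)" by simp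
      also have "\<dots> = lookup (col_op {1..n} r R f) b"
        unfolding lookup_col_op[OF rR(1)] T_def m_def by (rule refl)
      also have "\<dots> = 0" using f(1) r rR by (simp add: hw_space_def R_def)
      finally show ?thesis .
    qed
    ultimately show "lookup (col_op L r R (g s) + col_op {j} r R (g (Suc s))) b
        = lookup 0 b"
      by (cases Q) (simp_all add: lookup_add)
  qed
  \<comment> \<open>Within class \<open>P\<close>, the position \<open>(R, j)\<close> is the most
    significant one at which exponents may differ from \<open>a\<close>, so exceeding
    \<open>c\<close> there means exceeding \<open>a\<close>.\<close>
  have g_Suc_c: "g (Suc c) = 0"
  proof (rule poly_mapping_eqI)
    fix b
    show "lookup (g (Suc c)) b = lookup 0 b"
    proof (cases "P b \<and> lookup b (R, j) = Suc c")
      case True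
      have "lex_less a b"
        unfolding lex_less_def
      proof (intro exI[of _ "(R, j)"] conjI allI impI)
        fix q assume q: "rank_gt q (R, j)"
        then have "q \<notin> {r, R} \<times> {1..j}" using rR by (auto simp: rank_gt_def)
        then show "lookup a q = lookup b q"
          using True unfolding P_def by metis
      qed (use True in \<open>simp add: c_def\<close>)
      then show ?thesis using larger by (simp add: g_def lookup_restrict_poly in_keys_iff)
    next
      case False
      then show ?thesis by (auto simp: g_def lookup_restrict_poly)
    qed
  qed
  have E_g: "col_op L r R (g s) = - col_op {j} r R (g (Suc s))" for s
    using step[of s] by (simp add: eq_neg_iff_add_eq_0)
  \<comment> \<open>With \<open>s = 0\<close> and \<open>k = c\<close> this exhibits the vector
    \<open>t\<close> below, up to sign, as the \<open>c\<close>-th power of the raising operator of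
    the earlier columns applied to \<open>g 0\<close>.\<close>
  have string: "(col_op L r R ^^ k) (g s) = Const ((- 1) ^ k) * (col_op {j} r R ^^ k) (g (s + k))" for k s
  proof (induction k)
    case (Suc k)
    have "(col_op L r R ^^ Suc k) (g s) =
        Const ((- 1) ^ k) * (col_op {j} r R ^^ k) (col_op L r R (g (s + k)))"
      by (simp add: Suc.IH col_op_Const_mult funpow_col_op_disjoint_commute[OF disj(1)])
    also have "col_op L r R (g (s + k)) = Const (- 1) * col_op {j} r R (g (Suc (s + k)))"
      by (simp add: E_g Const_uminus)
    also have "(col_op {j} r R ^^ k) (Const (- 1) * col_op {j} r R (g (Suc (s + k)))) =
        Const (- 1) * (col_op {j} r R ^^ Suc k) (g (Suc (s + k)))"
      by (simp only: funpow_col_op_Const_mult funpow_Suc_right o_apply)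
    also have "Const ((- 1) ^ k) * (Const (- 1) * (col_op {j} r R ^^ Suc k) (g (Suc (s + k))))
        = Const ((- 1) ^ Suc k) * (col_op {j} r R ^^ Suc k) (g (Suc (s + k)))"
      by (simp only: mult.assoc[symmetric] Const_mult[symmetric] power_Suc2)
    finally show ?case by simp
  qed simp
  define t where "t = (col_op {j} r R ^^ c) (g c)"
  \<comment> \<open>On the single column \<open>j\<close> the operator has one term, so nothing can
    cancel: the coefficient of \<open>f\<close> at \<open>a\<close> is carried along, times positive
    integers, while units move from \<open>(R, j)\<close> to \<open>(r, j)\<close>.\<close>
  have "lookup ((col_op {j} r R ^^ k) (g c))
      (a - single (R, j) k + single (r, j) k) \<noteq> 0" if "k \<le> c" for k
    using that
  proof (induction k)
    case 0
    then show ?case using a by (simp add: g_def lookup_restrict_poly P_def c_def in_keys_iff)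
  next
    case (Suc k)
    define b where "b = a - single (R, j) (Suc k) + single (r, j) (Suc k)"
    have "lookup b (r, j) \<noteq> 0" by (simp add: b_def lookup_add)
    moreover have "m b j = a - single (R, j) k + single (r, j) k"
      using rR Suc.prems unfolding m_def b_def c_def
      by (intro poly_mapping_eqI) (auto simp: lookup_add lookup_minus lookup_single when_def)
    ultimately show ?case
      using Suc unfolding b_def[symmetric] funpow.simps o_apply lookup_col_op[OF rR(1)]
      by (simp add: m_fold del: of_nat_Suc)
  qed
  from this[of c] have t: "t \<noteq> 0" unfolding t_def by auto
  have E_t: "col_op L r R t = 0"
    unfolding t_def funpow_col_op_disjoint_commute[OF disj(1)] E_g g_Suc_c
    using funpow_col_op_Const_mult[of c "{j}" r R 0 0] by simp
  have weight: "col_op L q q t = Const (of_nat (\<Sum>k\<in>L. lookup a (q, k))) * t"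
    if q: "q \<in> {r, R}" for q
  proof -
    \<comment> \<open>Every monomial of \<open>g c\<close> has the exponents of \<open>a\<close> in
      column \<open>j\<close>, by the degree of that column, and in all later columns; the row sums
      then force the same totals over \<open>L\<close>.\<close>
    have "col_op L q q (g c) = Const (of_nat (\<Sum>k\<in>L. lookup a (q, k))) * g c"
    proof (rule poly_mapping_eqI)
      fix b
      show "lookup (col_op L q q (g c)) b =
         lookup (Const (of_nat (\<Sum>k\<in>L. lookup a (q, k))) * g c) b"
      proof (cases "lookup (g c) b = 0")
        case False
        then have Pb: "P b" "lookup b (R, j) = c" and b: "b \<in> keys f"
          by (auto simp: g_def lookup_restrict_poly in_keys_iff split: if_splits)
        have "(\<Sum>i=1..n. lookup b (i, j)) = (\<Sum>i=1..n. lookup a (i, j))"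
          using f(2) a b j by (auto simp: col_homogeneous_def)
        moreover have "(\<Sum>i\<in>{1..n} - {r}. lookup b (i, j)) =
            (\<Sum>i\<in>{1..n} - {r}. lookup a (i, j))"
          using Pb by (intro sum.cong) (auto simp: P_def c_def)
        ultimately have rj: "lookup b (r, j) = lookup a (r, j)"
          using r(1) sum.remove[of "{1..n}" r "\<lambda>i. lookup b (i, j)"]
            sum.remove[of "{1..n}" r "\<lambda>i. lookup a (i, j)"] by simp
        have "row_sum n b q = row_sum n a q"
          using f(1) a b r q by (auto simp: hw_space_row_sum R_def)
        moreover have "(\<Sum>k\<in>{1..n} - L. lookup b (q, k)) =
            (\<Sum>k\<in>{1..n} - L. lookup a (q, k))"
        proof (rule sum.cong[OF refl])
          fix k assume k: "k \<in> {1..n} - L"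
          then have "k = j \<or> k > j" by (auto simp: L_def)
          then show "lookup b (q, k) = lookup a (q, k)"
            using rj Pb q by (auto simp: P_def c_def)
        qed
        moreover have "L \<subseteq> {1..n}" using j by (auto simp: L_def)
        ultimately have "(\<Sum>k\<in>L. lookup b (q, k)) = (\<Sum>k\<in>L. lookup a (q, k))"
          using sum.subset_diff[of L "{1..n}" "\<lambda>k. lookup b (q, k)"]
            sum.subset_diff[of L "{1..n}" "\<lambda>k. lookup a (q, k)"]
          by (simp add: row_sum_def)
        then show ?thesis by (simp only: lookup_col_op_diag lookup_Const_mult)
      qed (simp add: lookup_col_op_diag lookup_Const_mult)
    qed
    then show ?thesis
      unfolding t_def funpow_col_op_disjoint_commute[OF disj(1)] by (simp only: funpow_col_op_Const_mult)
  qed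
  define w where "w = real (\<Sum>k\<in>L. lookup a (r, k)) - real (\<Sum>k\<in>L. lookup a (R, k))"
  have "real c \<le> w"
  proof (rule sl2_lowering_string[OF finL rR(1) E_t])
    show "col_op L r r t - col_op L R R t = Const (of_real w) * t"
      by (simp add: weight w_def Const_diff left_diff_distrib del: of_nat_sum)
    show "w \<in> \<int>" by (simp add: w_def del: of_nat_sum)
    show "(col_op L R r ^^ c) t \<noteq> 0"
    proof
      \<comment> \<open>Adjointness turns the lowering operators into raising ones on
        \<open>g 0\<close>, which give \<open>t\<close> up to sign; so \<open>t\<close> would be
        orthogonal to itself.\<close>
      assume "(col_op L R r ^^ c) t = 0"
      then have "fischer ((col_op L r R ^^ c) (g 0)) t = 0"
        by (simp add: fischer_funpow_col_op)
      then have "fischer t t = 0"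
        using string[of c 0] by (simp add: t_def[symmetric] fischer_Const_left)
      then show False using t by (simp add: fischer_self_eq_0_iff)
    qed
  qed
  then have "c + (\<Sum>k\<in>L. lookup a (R, k)) \<le> (\<Sum>k\<in>L. lookup a (r, k))"
    unfolding w_def by linarith
  moreover have "{1..j} = insert j L" using j by (auto simp: L_def)
  ultimately show ?thesis
    using finL by (simp add: L_def R_def c_def)
qed

section \<open>Tableaux and exponents\<close>

lemma part_antimono:
  assumes "is_partition \<mu> N" "1 \<le> r" "r \<le> r'"
  shows "part \<mu> r' \<le> part \<mu> r"
proof (cases "r = r' \<or> r' > length \<mu>")
  case False
  then have "r - 1 < r' - 1" "r' - 1 < length \<mu>" using assms by auto
  then have "\<mu> ! (r' - 1) \<le> \<mu> ! (r - 1)"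
    using assms(1) unfolding is_partition_def by (auto dest: sorted_wrt_nth_less)
  then show ?thesis using False assms by (auto simp: part_def)
qed (use assms in \<open>auto simp: part_def\<close>)

lemma mem_young_diagram: "(r, c) \<in> young_diagram \<mu> \<longleftrightarrow> 1 \<le> r \<and> 1 \<le> c \<and> c \<le> part \<mu> r"
  by (simp add: young_diagram_def)

lemma young_diagram_row:
  assumes "1 \<le> r"
  shows "{c. (r, c) \<in> young_diagram \<mu>} = {1..part \<mu> r}"
  using assms by (auto simp: mem_young_diagram)

lemma young_diagram_row_le_length: "(r, c) \<in> young_diagram \<mu> \<Longrightarrow> r \<le> length \<mu>"
  by (auto simp: young_diagram_def part_def split: if_splits)

lemma finite_young_diagram: "finite (young_diagram \<mu>)"
proof -
  have "young_diagram \<mu> \<subseteq> (SIGMA r:{1..length \<mu>}. {1..part \<mu> r})"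
    using young_diagram_row_le_length by (auto simp: mem_young_diagram)
  then show ?thesis by (rule finite_subset) auto
qed

lemma downward_closed_eq_interval:
  fixes D :: "nat set"
  assumes "finite D" "0 \<notin> D" "\<And>c c'. c \<in> D \<Longrightarrow> 1 \<le> c' \<Longrightarrow> c' \<le> c \<Longrightarrow> c' \<in> D"
  shows "D = {1..card D}"
proof (cases "D = {}")
  case False
  have "D = {1..Max D}"
  proof
    show "D \<subseteq> {1..Max D}" using assms by (auto simp: Suc_le_eq One_nat_def intro: Nat.gr0I)
    show "{1..Max D} \<subseteq> D" using assms(3)[of "Max D"] Max_in[OF assms(1) False] by auto
  qed
  then show ?thesis by (metis card_atLeastAtMost diff_Suc_1 One_nat_def)
qed simp

definition tableau_exp :: "nat list \<Rightarrow> (nat \<times> nat \<Rightarrow> nat) \<Rightarrow> (nat \<times> nat \<Rightarrow>\<^sub>0 nat)" where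
  "tableau_exp \<mu> T = (\<Sum>x\<in>young_diagram \<mu>. unit_exp (fst x, T x))"

lemma lookup_tableau_exp:
  "lookup (tableau_exp \<mu> T) (r, j) = card {c. (r, c) \<in> young_diagram \<mu> \<and> T (r, c) = j}"
proof -
  have "lookup (tableau_exp \<mu> T) (r, j) =
      (\<Sum>x\<in>young_diagram \<mu>. if fst x = r \<and> T x = j then 1 else 0)"
    unfolding tableau_exp_def lookup_sum lookup_single by (intro sum.cong) (auto simp: when_def)
  also have "\<dots> = card {x \<in> young_diagram \<mu>. fst x = r \<and> T x = j}"
    using finite_young_diagram by (simp add: sum.If_cases Int_def)
  also have "{x \<in> young_diagram \<mu>. fst x = r \<and> T x = j} =
      Pair r ` {c. (r, c) \<in> young_diagram \<mu> \<and> T (r, c) = j}" by auto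
  also have "card \<dots> = card {c. (r, c) \<in> young_diagram \<mu> \<and> T (r, c) = j}"
    by (rule card_image) (simp add: inj_on_def)
  finally show ?thesis .
qed

text \<open>The weight \<open>replicate n l\<close> gives multiplicity 0 to every entry beyond
  \<open>n\<close>.\<close>

lemma semistandard_entry_bounds:
  assumes "T \<in> semistandard_tableaux \<mu> (replicate n l)" "x \<in> young_diagram \<mu>"
  shows "T x \<in> {1..n}"
proof -
  have "T \<in> young_diagram \<mu> \<rightarrow>\<^sub>E {1..}" using assms by (simp add: semistandard_tableaux_def)
  then have "T x \<ge> 1" using assms(2) by (auto dest: PiE_mem)
  moreover have "card {y \<in> young_diagram \<mu>. T y = T x} > 0"
    unfolding card_gt_0_iff using assms(2) finite_young_diagram[of \<mu>] by (intro conjI) (blast, simp)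
  ultimately have "part (replicate n l) (T x) > 0"
    using assms(1) by (auto simp: semistandard_tableaux_def)
  then show ?thesis by (auto simp: part_def split: if_splits)
qed

lemma finite_semistandard_tableaux: "finite (semistandard_tableaux \<mu> (replicate n l))"
proof (rule finite_subset)
  show "semistandard_tableaux \<mu> (replicate n l) \<subseteq> young_diagram \<mu> \<rightarrow>\<^sub>E {1..n}"
  proof
    fix T assume T: "T \<in> semistandard_tableaux \<mu> (replicate n l)"
    then have "T \<in> extensional (young_diagram \<mu>)"
      by (auto simp: semistandard_tableaux_def PiE_def)
    with semistandard_entry_bounds[OF T] show "T \<in> young_diagram \<mu> \<rightarrow>\<^sub>E {1..n}"
      by (auto simp: PiE_def)
  qed
  show "finite (young_diagram \<mu> \<rightarrow>\<^sub>E {1..n})" using finite_young_diagram by (intro finite_PiE) auto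
qed

lemma semistandard_row_le:
  assumes "T \<in> semistandard_tableaux \<mu> wt" "(r, c) \<in> young_diagram \<mu>" "(r, c') \<in> young_diagram \<mu>" "c \<le> c'"
  shows "T (r, c) \<le> T (r, c')"
  using assms by (cases "c = c'") (auto simp: semistandard_tableaux_def)

lemma semistandard_col_less:
  assumes "T \<in> semistandard_tableaux \<mu> wt" "(r, c) \<in> young_diagram \<mu>" "(r', c) \<in> young_diagram \<mu>" "r < r'"
  shows "T (r, c) < T (r', c)"
  using assms by (auto simp: semistandard_tableaux_def)

text \<open>Rows increase weakly, so the cells of row \<open>r\<close> with entry at most
  \<open>j\<close> form an initial segment, whose length the exponent records. Hence a tableau can
  be recovered from its exponent.\<close>

lemma semistandard_entry_le_iff:
  assumes T: "T \<in> semistandard_tableaux \<mu> (replicate n l)" and x: "(r, c) \<in> young_diagram \<mu>"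
  shows "T (r, c) \<le> j \<longleftrightarrow> c \<le> (\<Sum>k=1..j. lookup (tableau_exp \<mu> T) (r, k))"
proof -
  define D where "D = {c. (r, c) \<in> young_diagram \<mu> \<and> T (r, c) \<le> j}"
  have r: "1 \<le> r" using x by (simp add: mem_young_diagram)
  have "D \<subseteq> {1..part \<mu> r}" using young_diagram_row[OF r, of \<mu>] by (auto simp: D_def)
  then have fin: "finite D" by (rule finite_subset) simp
  have "D = {1..card D}"
  proof (rule downward_closed_eq_interval[OF fin])
    show "0 \<notin> D" by (auto simp: D_def mem_young_diagram)
    fix c c' assume "c \<in> D" "1 \<le> c'" "c' \<le> c"
    then show "c' \<in> D"
      using semistandard_row_le[OF T, of r c' c] by (auto simp: D_def mem_young_diagram)
  qed
  moreover have "card D = (\<Sum>k=1..j. lookup (tableau_exp \<mu> T) (r, k))"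
  proof -
    have "D = (\<Union>k\<in>{1..j}. {c. (r, c) \<in> young_diagram \<mu> \<and> T (r, c) = k})"
      using semistandard_entry_bounds[OF T] by (fastforce simp: D_def)
    also have "card \<dots> = (\<Sum>k=1..j. card {c. (r, c) \<in> young_diagram \<mu> \<and> T (r, c) = k})"
    proof (rule card_UN_disjoint)
      show "\<forall>k\<in>{1..j}. finite {c. (r, c) \<in> young_diagram \<mu> \<and> T (r, c) = k}"
        using fin by (auto simp: D_def elim!: rev_finite_subset)
    qed auto
    finally show ?thesis by (simp add: lookup_tableau_exp)
  qed
  moreover have "T (r, c) \<le> j \<longleftrightarrow> c \<in> D" using x by (simp add: D_def)
  moreover have "1 \<le> c" using x by (simp add: mem_young_diagram)
  ultimately show ?thesis by auto
qed

lemma tableau_exp_inj: "inj_on (tableau_exp \<mu>) (semistandard_tableaux \<mu> (replicate n l))"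
proof (rule inj_onI)
  fix T T' assume T: "T \<in> semistandard_tableaux \<mu> (replicate n l)"
    and T': "T' \<in> semistandard_tableaux \<mu> (replicate n l)"
    and eq: "tableau_exp \<mu> T = tableau_exp \<mu> T'"
  have "T (r, c) = T' (r, c)" if x: "(r, c) \<in> young_diagram \<mu>" for r c
    using semistandard_entry_le_iff[OF T x] semistandard_entry_le_iff[OF T' x] eq
    by (metis order_refl antisym)
  moreover have "T \<in> extensional (young_diagram \<mu>)" "T' \<in> extensional (young_diagram \<mu>)"
    using T T' by (auto simp: semistandard_tableaux_def PiE_def)
  ultimately show "T = T'" by (intro extensionalityI) auto
qed

text \<open>Strict increase down a column makes the entry in row \<open>r\<close> at least
  \<open>r\<close>, while entries are at most \<open>n\<close>.\<close>

lemma semistandard_length_le: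
  assumes T: "T \<in> semistandard_tableaux \<mu> (replicate n l)" and \<mu>: "is_partition \<mu> N"
    and x: "(r, c) \<in> young_diagram \<mu>"
  shows "r \<le> n"
proof -
  have "r \<le> T (r, c)" if "(r, c) \<in> young_diagram \<mu>" for r
    using that
  proof (induction r)
    case (Suc r)
    show ?case
    proof (cases "r = 0")
      case True
      then show ?thesis using semistandard_entry_bounds[OF T Suc.prems] by (auto simp: One_nat_def)
    next
      case False
      then have "(r, c) \<in> young_diagram \<mu>"
        using Suc.prems part_antimono[OF \<mu>, of r "Suc r"] by (auto simp: mem_young_diagram)
      then show ?thesis
        using Suc.IH semistandard_col_less[OF T _ Suc.prems, of r] by force
    qed
  qed simp
  then show ?thesis using x semistandard_entry_bounds[OF T x] by (meson atLeastAtMost_iff le_trans)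
qed

lemma semistandard_card_col:
  assumes T: "T \<in> semistandard_tableaux \<mu> (replicate n l)" and k: "k \<in> {1..n}"
  shows "card {x \<in> young_diagram \<mu>. T x = k} = l"
proof -
  have "\<forall>k\<ge>1. card {x \<in> young_diagram \<mu>. T x = k} = part (replicate n l) k"
    using T by (simp add: semistandard_tableaux_def)
  moreover have "k - 1 < n" using k by auto
  ultimately show ?thesis using k by (simp add: part_def)
qed

text \<open>Parts are positive, so the first \<open>n\<close> of them exhaust the sum exactly when
  none is left over.\<close>

lemma sum_part:
  assumes "is_partition \<mu> N"
  shows "(\<Sum>i=1..n. part \<mu> i) \<le> N" "(\<Sum>i=1..n. part \<mu> i) = N \<longleftrightarrow> length \<mu> \<le> n"
proof -
  have *: "(\<Sum>i=1..n. part \<mu> i) = sum_list (take n \<mu>)" for n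
  proof (induction n)
    case (Suc n)
    show ?case
    proof (cases "n < length \<mu>")
      case True
      then have "sum_list (take (Suc n) \<mu>) = sum_list (take n \<mu>) + \<mu> ! n"
        by (simp add: take_Suc_conv_app_nth)
      moreover have "part \<mu> (Suc n) = \<mu> ! n" using True by (simp add: part_def One_nat_def)
      ultimately show ?thesis using Suc.IH by (simp add: One_nat_def)
    next
      case False
      then show ?thesis using Suc.IH by (simp add: part_def One_nat_def)
    qed
  qed simp
  have N: "N = sum_list (take n \<mu>) + sum_list (drop n \<mu>)"
    using assms by (metis append_take_drop_id is_partition_def sum_list_append)
  then show "(\<Sum>i=1..n. part \<mu> i) \<le> N" by (simp add: *)
  have "sum_list (drop n \<mu>) = 0 \<longleftrightarrow> length \<mu> \<le> n"
  proof
    assume 0: "sum_list (drop n \<mu>) = 0"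
    have "set (drop n \<mu>) = {}"
    proof (rule equals0I)
      fix x assume x: "x \<in> set (drop n \<mu>)"
      then have "x = 0" using 0 by (simp add: sum_list_eq_0_iff)
      moreover have "x \<in> set \<mu>" using x by (rule in_set_dropD)
      ultimately show False using assms by (simp add: is_partition_def)
    qed
    then show "length \<mu> \<le> n" by simp
  qed simp
  with N show "(\<Sum>i=1..n. part \<mu> i) = N \<longleftrightarrow> length \<mu> \<le> n" by (simp add: *)
qed

text \<open>Gelfand-Tsetlin coordinates: the partial row sums count the entries at most
  \<open>j\<close> in row \<open>r\<close>. The last condition says that row \<open>r + 1\<close>
  has no more entries at most \<open>j\<close> than row \<open>r\<close> has entries less than
  \<open>j\<close>, which is column strictness.\<close>

definition semistandard_exps :: "nat \<Rightarrow> nat \<Rightarrow> nat list \<Rightarrow> (nat \<times> nat \<Rightarrow>\<^sub>0 nat) set" where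
  "semistandard_exps n l \<mu> = {a. keys a \<subseteq> {1..n} \<times> {1..n} \<and>
     (\<forall>r\<in>{1..n}. row_sum n a r = part \<mu> r) \<and>
     (\<forall>k\<in>{1..n}. (\<Sum>r=1..n. lookup a (r, k)) = l) \<and>
     (\<forall>r\<in>{1..n}. \<forall>j\<in>{1..n}. Suc r \<in> {1..n} \<longrightarrow>
        (\<Sum>k=1..j. lookup a (Suc r, k)) \<le> (\<Sum>k=1..<j. lookup a (r, k)))}"

lemma semistandard_exps_subset:
  assumes \<mu>: "is_partition \<mu> (n * l)"
  shows "semistandard_exps n l \<mu> \<subseteq> tableau_exp \<mu> ` semistandard_tableaux \<mu> (replicate n l)"
proof
  fix a assume a: "a \<in> semistandard_exps n l \<mu>"
  define A where "A = (\<lambda>r j. \<Sum>k=1..j. lookup a (r, k))"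
  \<comment> \<open>Row \<open>r\<close> is filled in weakly increasing order with as many entries
    \<open>j\<close> as \<open>a\<close> prescribes: cell \<open>c\<close> gets the first
    \<open>j\<close> whose partial sum reaches \<open>c\<close>.\<close>
  define T where "T = (\<lambda>x\<in>young_diagram \<mu>. LEAST j. snd x \<le> A (fst x) j)"
  have keys: "lookup a (r, k) = 0" if "r \<notin> {1..n} \<or> k \<notin> {1..n}" for r k
    using a that by (auto simp: semistandard_exps_def in_keys_iff)
  have row: "A r n = part \<mu> r" if "r \<in> {1..n}" for r
    using a that by (auto simp: semistandard_exps_def A_def row_sum_def)
  have col: "(\<Sum>r=1..n. lookup a (r, k)) = l" if "k \<in> {1..n}" for k
    using a that by (auto simp: semistandard_exps_def)
  \<comment> \<open>Counting by rows and by columns shows that the first \<open>n\<close> parts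
    exhaust \<open>n * l\<close>, so the diagram has no rows beyond \<open>n\<close>, about which
    \<open>a\<close> says nothing.\<close>
  have "(\<Sum>r=1..n. part \<mu> r) = (\<Sum>r=1..n. \<Sum>k=1..n. lookup a (r, k))"
    by (intro sum.cong) (auto simp: row[symmetric] A_def)
  also have "\<dots> = (\<Sum>k=1..n. \<Sum>r=1..n. lookup a (r, k))" by (rule sum.swap)
  also have "\<dots> = n * l" by (simp add: col)
  finally have len: "length \<mu> \<le> n" using sum_part(2)[OF \<mu>, of n] by simp
  have yd_row: "r \<in> {1..n}" "1 \<le> c" "c \<le> A r n" if "(r, c) \<in> young_diagram \<mu>" for r c
  proof -
    show r: "r \<in> {1..n}" using young_diagram_row_le_length[OF that] len that by (auto simp: mem_young_diagram)
    show "1 \<le> c" "c \<le> A r n" using that row[OF r] by (auto simp: mem_young_diagram)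
  qed
  have A_mono: "A r j \<le> A r j'" if "j \<le> j'" for r j j'
    unfolding A_def using that by (intro sum_mono2) auto
  have A_0: "A r 0 = 0" for r by (simp add: A_def)
  have A_Suc: "A r (Suc j) = A r j + lookup a (r, Suc j)" for r j by (simp add: A_def One_nat_def)
  have T_le: "T (r, c) \<le> j \<longleftrightarrow> c \<le> A r j" if x: "(r, c) \<in> young_diagram \<mu>" for r c j
  proof -
    have T: "T (r, c) = (LEAST j. c \<le> A r j)" using x by (simp add: T_def)
    have "c \<le> A r (T (r, c))" unfolding T by (rule LeastI) (rule yd_row(3)[OF x])
    moreover have "T (r, c) \<le> j" if "c \<le> A r j" unfolding T using that by (rule Least_le)
    ultimately show ?thesis using A_mono le_trans by blast
  qed
  have T_bounds: "T (r, c) \<in> {1..n}" if x: "(r, c) \<in> young_diagram \<mu>" for r c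
    using T_le[OF x, of n] T_le[OF x, of 0] yd_row[OF x] A_0 by (auto simp: One_nat_def Suc_le_eq)
  \<comment> \<open>An entry \<open>Suc j\<close> in row \<open>Suc r\<close> puts \<open>c\<close>
    within the partial sum up to \<open>Suc j\<close> of that row, hence within the partial sum up
    to \<open>j\<close> of row \<open>r\<close>.\<close>
  have col_step: "T (r, c) < T (Suc r, c)"
    if x: "(r, c) \<in> young_diagram \<mu>" and y: "(Suc r, c) \<in> young_diagram \<mu>" for r c
  proof -
    obtain j where j: "T (Suc r, c) = Suc j" using T_bounds[OF y] by (cases "T (Suc r, c)") auto
    then have j': "Suc j \<in> {1..n}" using T_bounds[OF y] by simp
    have "c \<le> A (Suc r) (Suc j)" using T_le[OF y, of "Suc j"] j by simp
    also have "\<dots> \<le> (\<Sum>k=1..<Suc j. lookup a (r, k))"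
      using a yd_row(1)[OF x] yd_row(1)[OF y] j' unfolding semistandard_exps_def A_def by blast
    also have "\<dots> = A r j" by (simp add: A_def atLeastLessThanSuc_atLeastAtMost)
    finally show ?thesis using T_le[OF x, of j] j by simp
  qed
  have yd_up: "(r, c) \<in> young_diagram \<mu>" if "(r', c) \<in> young_diagram \<mu>" "1 \<le> r" "r \<le> r'" for r r' c
    using that part_antimono[OF \<mu>, of r r'] by (auto simp: mem_young_diagram)
  have exp: "tableau_exp \<mu> T = a"
  proof (rule poly_mapping_eqI)
    fix p :: "nat \<times> nat"
    obtain r j where p: "p = (r, j)" by (cases p)
    show "lookup (tableau_exp \<mu> T) p = lookup a p"
    proof (cases "r \<in> {1..n} \<and> j \<in> {1..n}")
      case True
      then obtain i where i: "j = Suc i" by (cases j) auto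
      have "A r j \<le> part \<mu> r" using A_mono[of j n r] row True by auto
      have "(r, c) \<in> young_diagram \<mu> \<and> T (r, c) = j \<longleftrightarrow> c \<in> {A r i<..A r j}" for c
      proof (cases "(r, c) \<in> young_diagram \<mu>")
        case True
        then show ?thesis using T_le[of r c i] T_le[of r c j] i by auto
      next
        case False
        then show ?thesis using \<open>A r j \<le> part \<mu> r\<close> \<open>r \<in> {1..n} \<and> j \<in> {1..n}\<close>
          by (auto simp: mem_young_diagram)
      qed
      then have "{c. (r, c) \<in> young_diagram \<mu> \<and> T (r, c) = j} = {A r i<..A r j}" by blast
      then show ?thesis unfolding p lookup_tableau_exp by (simp add: i A_Suc)
    next
      case False
      then have "{c. (r, c) \<in> young_diagram \<mu> \<and> T (r, c) = j} = {}"
        using T_bounds yd_row(1) by blast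
      moreover have "lookup a (r, j) = 0" using keys False by blast
      ultimately show ?thesis unfolding p lookup_tableau_exp by (simp only: card.empty)
    qed
  qed
  have "T \<in> semistandard_tableaux \<mu> (replicate n l)"
    unfolding semistandard_tableaux_def
  proof (intro CollectI conjI allI impI)
    show "T \<in> young_diagram \<mu> \<rightarrow>\<^sub>E {1..}"
      using T_bounds by (auto simp: PiE_def T_def)
    fix r c c' assume "(r, c) \<in> young_diagram \<mu>" "(r, c') \<in> young_diagram \<mu>" "c < c'"
    then show "T (r, c) \<le> T (r, c')"
      using T_le[of r c "T (r, c')"] T_le[of r c' "T (r, c')"] by simp
  next
    fix r r' c assume x: "(r, c) \<in> young_diagram \<mu>" and y: "(r', c) \<in> young_diagram \<mu>" and "r < r'"
    from \<open>r < r'\<close> y show "T (r, c) < T (r', c)"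
    proof (induction r')
      case (Suc r')
      have "1 \<le> r" using x by (simp add: mem_young_diagram)
      then have y': "(r', c) \<in> young_diagram \<mu>" using Suc.prems by (intro yd_up[OF Suc.prems(2)]) auto
      show ?case
        using col_step[OF y' Suc.prems(2)] Suc.IH[OF _ y'] Suc.prems(1) by (cases "r = r'") auto
    qed simp
  next
    fix k :: nat assume k: "1 \<le> k"
    have "card {x \<in> young_diagram \<mu>. T x = k} =
        card (\<Union>r\<in>{1..n}. Pair r ` {c. (r, c) \<in> young_diagram \<mu> \<and> T (r, c) = k})"
      using yd_row(1) by (intro arg_cong[of _ _ card]) fast
    also have "\<dots> = (\<Sum>r=1..n. card (Pair r ` {c. (r, c) \<in> young_diagram \<mu> \<and> T (r, c) = k}))"
    proof (rule card_UN_disjoint)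
      have "{c. (r, c) \<in> young_diagram \<mu> \<and> T (r, c) = k} \<subseteq> {1..part \<mu> r}" for r
        by (auto simp: mem_young_diagram)
      then show "\<forall>r\<in>{1..n}. finite (Pair r ` {c. (r, c) \<in> young_diagram \<mu> \<and> T (r, c) = k})"
        by (auto intro: finite_subset)
    qed auto
    also have "\<dots> = (\<Sum>r=1..n. lookup a (r, k))"
      unfolding exp[symmetric] lookup_tableau_exp
      by (intro sum.cong refl card_image) (simp add: inj_on_def)
    also have "\<dots> = part (replicate n l) k"
      using k col[of k] keys[of _ k] by (cases "k \<in> {1..n}") (auto simp: part_def)
    finally show "card {x \<in> young_diagram \<mu>. T x = k} = part (replicate n l) k" .
  qed
  with exp show "a \<in> tableau_exp \<mu> ` semistandard_tableaux \<mu> (replicate n l)" by blast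
qed

lemma card_semistandard_exps_le:
  assumes "is_partition \<mu> (n * l)"
  shows "finite (semistandard_exps n l \<mu>)" "card (semistandard_exps n l \<mu>) \<le> kostka \<mu> (replicate n l)"
proof -
  note sub = semistandard_exps_subset[OF assms] and fin = finite_semistandard_tableaux[of \<mu> n l]
  show "finite (semistandard_exps n l \<mu>)" using finite_subset[OF sub] fin by blast
  show "card (semistandard_exps n l \<mu>) \<le> kostka \<mu> (replicate n l)"
    unfolding kostka_def using surj_card_le[OF fin sub] .
qed


section \<open>The upper bound for independent highest weight vectors\<close>

lemma restrict_poly_Const_mult: "restrict_poly P (Const c * f) = Const c * restrict_poly P f"
  by (rule poly_mapping_eqI) (simp add: lookup_restrict_poly lookup_Const_mult)

lemma restrict_poly_sum: "restrict_poly P (sum f A) = (\<Sum>x\<in>A. restrict_poly P (f x))"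
  by (rule poly_mapping_eqI) (simp add: lookup_restrict_poly lookup_sum)

text \<open>Reading off the coefficients at semistandard exponents is a linear map into a space of
  dimension at most the Kostka number. It is injective on highest weight vectors of this weight,
  because the leading coefficient of a nonzero one is among those read.\<close>

lemma independent_hw_card_le:
  assumes \<mu>: "is_partition \<mu> (n * l)"
    and B: "finite B" "poly_vs.independent B"
    and sub: "B \<subseteq> hw_space n (part \<mu>) \<inter> col_homogeneous n (\<lambda>_. l)"
  shows "card B \<le> kostka \<mu> (replicate n l)"
proof -
  define S where "S = semistandard_exps n l \<mu>"
  define \<pi> where "\<pi> = restrict_poly (\<lambda>a. a \<in> S)"
  have finS: "finite S" unfolding S_def by (rule card_semistandard_exps_le[OF \<mu>])
  have ker: "f = 0" if f: "f \<in> poly_vs.span B" and 0: "\<pi> f = 0" for f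
  proof (rule ccontr)
    assume "f \<noteq> 0"
    have "poly_vs.subspace (hw_space n (part \<mu>) \<inter> col_homogeneous n (\<lambda>_. l))"
      by (intro poly_vs.subspace_inter subspace_hw_space subspace_col_homogeneous)
    then have f: "f \<in> hw_space n (part \<mu>)" "f \<in> col_homogeneous n (\<lambda>_. l)"
      using f poly_vs.span_minimal[OF sub] by blast+
    obtain a where a: "a \<in> keys f"
      and lead: "\<And>b. b \<in> keys f \<Longrightarrow> b = a \<or> lex_less b a"
      using lex_greatest_exists[of "keys f"] \<open>f \<noteq> 0\<close> by auto
    have "a \<in> S"
      unfolding S_def semistandard_exps_def
      using hw_leading_semistandard[OF f a lead] f a
      by (auto simp: hw_space_row_sum[OF f(1) a] col_homogeneous_def)
    then have "lookup (\<pi> f) a = lookup f a"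
      by (simp add: \<pi>_def lookup_restrict_poly)
    with 0 a show False by (simp add: in_keys_iff)
  qed
  have inj: "inj_on \<pi> (poly_vs.span B)"
  proof (rule inj_onI)
    fix f g assume fg: "f \<in> poly_vs.span B" "g \<in> poly_vs.span B" "\<pi> f = \<pi> g"
    then have "\<pi> (f - g) = 0"
      by (intro poly_mapping_eqI) (auto simp: \<pi>_def lookup_restrict_poly lookup_minus poly_mapping_eq_iff
          fun_eq_iff split: if_splits)
    then show "f = g" using ker[of "f - g"] fg by (simp add: poly_vs.span_diff)
  qed
  then have injB: "inj_on \<pi> B" by (rule inj_on_subset) (rule poly_vs.span_superset)
  have "poly_vs.independent (\<pi> ` B)"
  proof
    assume "poly_vs.dependent (\<pi> ` B)"
    then obtain u b where u: "(\<Sum>v\<in>\<pi> ` B. Const (u v) * v) = 0" and b: "b \<in> B" "u (\<pi> b) \<noteq> 0"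
      unfolding poly_vs.dependent_finite[OF finite_imageI[OF B(1)]] by blast
    have "\<pi> (\<Sum>b\<in>B. Const (u (\<pi> b)) * b) = 0"
      using u unfolding sum.reindex[OF injB]
      by (simp add: \<pi>_def restrict_poly_sum restrict_poly_Const_mult)
    moreover have "(\<Sum>b\<in>B. Const (u (\<pi> b)) * b) \<in> poly_vs.span B"
      by (rule poly_vs.span_sum) (rule poly_vs.span_scale[OF poly_vs.span_base])
    ultimately have "(\<Sum>b\<in>B. Const (u (\<pi> b)) * b) = 0" by (rule ker[rotated])
    with b B(2) show False unfolding poly_vs.dependent_finite[OF B(1)] by auto
  qed
  moreover have "\<pi> ` B \<subseteq> poly_vs.span ((\<lambda>a. single a 1) ` S)"
  proof (rule image_subsetI)
    fix b
    show "\<pi> b \<in> poly_vs.span ((\<lambda>a. single a 1) ` S)"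
      unfolding \<pi>_def restrict_poly_def
    proof (rule poly_vs.span_sum)
      fix a assume "a \<in> {a \<in> keys b. a \<in> S}"
      then have "Const (lookup b a) * single a 1
          \<in> poly_vs.span ((\<lambda>a. single a 1) ` S)"
        by (intro poly_vs.span_scale poly_vs.span_base) auto
      then show "single a (lookup b a)
          \<in> poly_vs.span ((\<lambda>a. single a 1) ` S)"
        by (simp add: Const_def mult_single)
    qed
  qed
  ultimately have "card (\<pi> ` B) \<le> card ((\<lambda>a. single a 1 :: matrix_poly) ` S)"
    using finS by (intro poly_vs.independent_span_bound[THEN conjunct2]) auto
  also have "\<dots> \<le> card S" using finS by (rule card_image_le)
  also have "\<dots> \<le> kostka \<mu> (replicate n l)"
    unfolding S_def by (rule card_semistandard_exps_le[OF \<mu>])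
  finally show ?thesis using card_image[OF injB] by simp
qed

section \<open>Products of minors\<close>

definition minor :: "nat \<Rightarrow> (nat \<Rightarrow> nat) \<Rightarrow> matrix_poly" where
  "minor k s = (\<Sum>\<sigma> | \<sigma> permutes {1..k}. Const (of_int (sign \<sigma>)) * (\<Prod>r=1..k. Var r (s (\<sigma> r))))"

text \<open>The bideterminant of \<open>T\<close> paired with the tableau whose row \<open>r\<close>
  has all entries \<open>r\<close>: each column of the diagram selects the first rows of variables
  and, by its entries, their columns. The bound \<open>part \<mu> 1\<close> is the number of columns
  of the diagram.\<close>

definition tableau_minors :: "nat list \<Rightarrow> (nat \<times> nat \<Rightarrow> nat) \<Rightarrow> matrix_poly" where
  "tableau_minors \<mu> T =
     (\<Prod>c=1..part \<mu> 1. minor (card {r. (r, c) \<in> young_diagram \<mu>}) (\<lambda>r. T (r, c)))"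

section \<open>Column degrees of products and minors\<close>

lemma col_homogeneous_mult:
  assumes f: "f \<in> col_homogeneous n d" and g: "g \<in> col_homogeneous n e"
  shows "f * g \<in> col_homogeneous n (\<lambda>k. d k + e k)"
  unfolding col_homogeneous_def
proof (intro CollectI ballI)
  fix a assume "a \<in> keys (f * g)"
  then obtain b c where a: "a = b + c" and b: "b \<in> keys f" and c: "c \<in> keys g"
    using keys_mult[of f g] by blast
  have "keys b \<subseteq> {1..n} \<times> {1..n}" "keys c \<subseteq> {1..n} \<times> {1..n}"
    using f g b c by (auto simp: col_homogeneous_def)
  moreover have "(\<Sum>r=1..n. lookup a (r, k)) = d k + e k" if "k \<in> {1..n}" for k
    using f g b c that by (simp add: col_homogeneous_def a lookup_add sum.distrib)
  ultimately show "keys a \<subseteq> {1..n} \<times> {1..n} \<and>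
     (\<forall>k\<in>{1..n}. (\<Sum>r=1..n. lookup a (r, k)) = d k + e k)"
    by (simp add: a keys_plus_nat)
qed

lemma col_homogeneous_1: "1 \<in> col_homogeneous n (\<lambda>k. 0)"
  by (simp add: col_homogeneous_def)

lemma col_homogeneous_prod:
  assumes "\<And>x. x \<in> A \<Longrightarrow> f x \<in> col_homogeneous n (d x)"
  shows "(\<Prod>x\<in>A. f x) \<in> col_homogeneous n (\<lambda>k. \<Sum>x\<in>A. d x k)"
  using assms
proof (induction A rule: infinite_finite_induct)
  case (insert x A)
  then have "f x * (\<Prod>x\<in>A. f x) \<in> col_homogeneous n (\<lambda>k. d x k + (\<Sum>x\<in>A. d x k))"
    by (intro col_homogeneous_mult) auto
  then show ?case using insert.hyps by simp
qed (simp_all add: col_homogeneous_1)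

lemma col_homogeneous_power:
  assumes "f \<in> col_homogeneous n d"
  shows "f ^ m \<in> col_homogeneous n (\<lambda>k. m * d k)"
  using col_homogeneous_prod[of "{..<m}" "\<lambda>_. f" n "\<lambda>_. d"] assms by simp

lemma col_homogeneous_Var:
  assumes "i \<in> {1..n}" "j \<in> {1..n}"
  shows "Var i j \<in> col_homogeneous n (\<lambda>k. if k = j then 1 else 0)"
  using assms by (simp add: col_homogeneous_def Var_def sum_lookup_unit_exp_col)

lemma col_homogeneous_permuted_product:
  assumes \<sigma>: "\<sigma> permutes {1..k}" and "k \<le> n" "\<And>r. r \<in> {1..k} \<Longrightarrow> s r \<in> {1..n}"
  shows "(\<Prod>r=1..k. Var r (s (\<sigma> r))) \<in> col_homogeneous n (\<lambda>q. \<Sum>r=1..k. if q = s r then 1 else 0)"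
proof -
  have "(\<Prod>r=1..k. Var r (s (\<sigma> r))) \<in>
      col_homogeneous n (\<lambda>q. \<Sum>r=1..k. if q = s (\<sigma> r) then 1 else 0)"
  proof (rule col_homogeneous_prod)
    fix r assume r: "r \<in> {1..k}"
    then have "\<sigma> r \<in> {1..k}" using permutes_in_image[OF \<sigma>] by simp
    then show "Var r (s (\<sigma> r)) \<in> col_homogeneous n (\<lambda>q. if q = s (\<sigma> r) then 1 else 0)"
      using r assms by (intro col_homogeneous_Var) auto
  qed
  moreover have "(\<Sum>r=1..k. if q = s (\<sigma> r) then 1 else 0) = (\<Sum>r=1..k. if q = s r then 1 else 0 :: nat)" for q
    using sum.permute[OF \<sigma>, of "\<lambda>r. if q = s r then 1 else 0 :: nat"] by (simp add: o_def)
  ultimately show ?thesis by simp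
qed

lemma col_homogeneous_minor:
  assumes "k \<le> n" "\<And>r. r \<in> {1..k} \<Longrightarrow> s r \<in> {1..n}"
  shows "minor k s \<in> col_homogeneous n (\<lambda>q. \<Sum>r=1..k. if q = s r then 1 else 0)"
  unfolding minor_def
  using col_homogeneous_permuted_product[OF _ assms]
  by (intro poly_vs.subspace_sum poly_vs.subspace_scale subspace_col_homogeneous) auto

section \<open>Matrix units acting on minors\<close>

lemma col_op_prod_Var:
  assumes s: "\<And>r. r \<in> {1..k} \<Longrightarrow> s r \<in> {1..n}" and j: "j \<in> {1..k}"
  shows "col_op {1..n} i j (\<Prod>r=1..k. Var r (s r)) = Var i (s j) * (\<Prod>r\<in>{1..k} - {j}. Var r (s r))"
proof -
  have "col_op {1..n} i j (\<Prod>r=1..k. Var r (s r)) =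
      (\<Sum>r=1..k. if r = j then Var i (s j) * (\<Prod>r\<in>{1..k} - {j}. Var r (s r)) else 0)"
    unfolding col_op_prod[OF finite_atLeastAtMost]
    using s by (intro sum.cong) (auto simp: col_op_Var)
  then show ?thesis using j by simp
qed

lemma col_op_prod_Var_outside:
  assumes "j \<notin> {1..k}"
  shows "col_op {1..n} i j (\<Prod>r=1..k. Var r (s r)) = 0"
  unfolding col_op_prod[OF finite_atLeastAtMost]
  using assms by (intro sum.neutral) (auto simp: col_op_Var)

text \<open>Every term of the determinant expansion has exactly one factor from row \<open>i\<close>
  if \<open>i \<le> k\<close>, and none otherwise.\<close>

lemma col_op_minor_diag:
  assumes s: "\<And>r. r \<in> {1..k} \<Longrightarrow> s r \<in> {1..n}" and i: "1 \<le> i"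
  shows "col_op {1..n} i i (minor k s) = Const (of_nat (if i \<le> k then 1 else 0)) * minor k s"
proof -
  have "col_op {1..n} i i (\<Prod>r=1..k. Var r (s (\<sigma> r))) =
      Const (of_nat (if i \<le> k then 1 else 0)) * (\<Prod>r=1..k. Var r (s (\<sigma> r)))"
    if \<sigma>: "\<sigma> permutes {1..k}" for \<sigma>
  proof (cases "i \<le> k")
    case True
    then have "i \<in> {1..k}" using i by simp
    then show ?thesis
      using col_op_prod_Var[of k "\<lambda>r. s (\<sigma> r)" n i i] s permutes_in_image[OF \<sigma>] True
      by (simp add: prod.remove[of "{1..k}" i])
  qed (simp add: col_op_prod_Var_outside)
  then show ?thesis
    unfolding minor_def by (simp add: col_op_sum col_op_Const_mult sum_distrib_left mult_ac)
qed

text \<open>Replacing row \<open>j\<close> of the minor by its row \<open>i < j\<close> gives two equal rows.\<close>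

lemma col_op_minor_upper:
  assumes s: "\<And>r. r \<in> {1..k} \<Longrightarrow> s r \<in> {1..n}" and ij: "1 \<le> i" "i < j"
  shows "col_op {1..n} i j (minor k s) = 0"
proof (cases "j \<le> k")
  case False
  then show ?thesis
    unfolding minor_def by (simp add: col_op_sum col_op_Const_mult col_op_prod_Var_outside)
next
  case True
  then have i: "i \<in> {1..k}" and j: "j \<in> {1..k}" and ne: "i \<noteq> j" using ij by auto
  define R where "R = {1..k} - {j} - {i}"
  define P where "P = (\<lambda>\<sigma>. (\<Prod>r\<in>R. Var r (s (\<sigma> r))))"
  define t where "t = (\<lambda>\<sigma>. Const (of_int (sign \<sigma>)) * (Var i (s (\<sigma> j)) * (Var i (s (\<sigma> i)) * P \<sigma>)))"
  define \<tau> where "\<tau> = transpose i j"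
  have \<tau>: "\<tau> permutes {1..k}" unfolding \<tau>_def by (rule permutes_swap_id[OF i j])
  have E: "col_op {1..n} i j (minor k s) = (\<Sum>\<sigma> | \<sigma> permutes {1..k}. t \<sigma>)"
    unfolding minor_def col_op_sum
  proof (intro sum.cong refl)
    fix \<sigma> assume "\<sigma> \<in> {\<sigma>. \<sigma> permutes {1..k}}"
    then have \<sigma>: "\<sigma> permutes {1..k}" by simp
    have "col_op {1..n} i j (\<Prod>r=1..k. Var r (s (\<sigma> r))) =
        Var i (s (\<sigma> j)) * (\<Prod>r\<in>{1..k} - {j}. Var r (s (\<sigma> r)))"
      using s permutes_in_image[OF \<sigma>] j by (intro col_op_prod_Var) auto
    also have "(\<Prod>r\<in>{1..k} - {j}. Var r (s (\<sigma> r))) = Var i (s (\<sigma> i)) * P \<sigma>"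
      unfolding P_def R_def using i ne by (intro prod.remove) auto
    finally show "col_op {1..n} i j (Const (of_int (sign \<sigma>)) * (\<Prod>r=1..k. Var r (s (\<sigma> r)))) = t \<sigma>"
      by (simp add: col_op_Const_mult t_def)
  qed
  \<comment> \<open>Composition with the transposition of \<open>i\<close> and \<open>j\<close>
    exchanges the two factors from row \<open>i\<close> and reverses the sign, so the sum equals its
    own negative.\<close>
  have "(\<Sum>\<sigma> | \<sigma> permutes {1..k}. t \<sigma>) = (\<Sum>\<sigma> | \<sigma> permutes {1..k}. t (\<sigma> \<circ> \<tau>))"
    by (rule sum_permutations_compose_right[OF \<tau>])
  also have "\<dots> = (\<Sum>\<sigma> | \<sigma> permutes {1..k}. - t \<sigma>)"
  proof (intro sum.cong refl)
    fix \<sigma> assume "\<sigma> \<in> {\<sigma>. \<sigma> permutes {1..k}}"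
    then have "permutation \<sigma>" "permutation \<tau>"
      using \<tau> permutation_permutes by blast+
    then have "sign (\<sigma> \<circ> \<tau>) = - sign \<sigma>"
      using ne by (simp add: sign_compose \<tau>_def sign_swap_id)
    moreover have "P (\<sigma> \<circ> \<tau>) = P \<sigma>"
      unfolding P_def by (intro prod.cong) (auto simp: R_def \<tau>_def transpose_def)
    moreover have "\<tau> i = j" "\<tau> j = i" by (auto simp: \<tau>_def)
    ultimately show "t (\<sigma> \<circ> \<tau>) = - t \<sigma>"
      by (simp add: t_def Const_uminus mult_ac)
  qed
  finally have eq: "col_op {1..n} i j (minor k s) = - col_op {1..n} i j (minor k s)"
    by (simp add: E sum_negf)
  show ?thesis
  proof (rule poly_mapping_eqI)
    fix a
    have "lookup (col_op {1..n} i j (minor k s)) a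
        = - lookup (col_op {1..n} i j (minor k s)) a"
      by (subst eq) (rule lookup_uminus)
    then show "lookup (col_op {1..n} i j (minor k s)) a = lookup 0 a" by simp
  qed
qed

text \<open>A derivation adds the eigenvalues of the factors. The eigenvalue 0 covers the raising
  operators, so one statement serves both conditions on a highest weight vector.\<close>

lemma col_op_prod_eigen:
  assumes "\<And>x. x \<in> A \<Longrightarrow> col_op C i j (f x) = Const (of_nat (w x)) * f x"
  shows "col_op C i j (\<Prod>x\<in>A. f x) = Const (of_nat (\<Sum>x\<in>A. w x)) * (\<Prod>x\<in>A. f x)"
  using assms
proof (induction A rule: infinite_finite_induct)
  case (insert x A)
  then show ?case by (simp add: col_op_mult Const_add algebra_simps)
qed simp_all

section \<open>Leading exponents of minors and of their products\<close>

definition has_lead :: "matrix_poly \<Rightarrow> (nat \<times> nat \<Rightarrow>\<^sub>0 nat) \<Rightarrow> bool" where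
  "has_lead f a \<longleftrightarrow> lookup f a = 1 \<and>
     (\<forall>b\<in>keys f. b = a \<or> lex_less b a)"

lemma lex_less_add_mono:
  assumes "b = a \<or> lex_less b a" "d = c \<or> lex_less d c"
  shows "b + d = a + c \<or> lex_less (b + d) (a + c)"
  using assms lex_less_add_left[of d c b] lex_less_add_left[of b a c] lex_less_trans[of "b + d" "b + c" "a + c"]
  by (auto simp: add.commute)

text \<open>Once the two leading monomials are split off, the remaining products have strictly
  smaller exponents, since addition of exponents is monotone; leading coefficients 1 multiply to
  1.\<close>

lemma has_lead_mult:
  assumes f: "has_lead f a" and g: "has_lead g c"
  shows "has_lead (f * g) (a + c)"
proof -
  define f' where "f' = f - single a 1"
  define g' where "g' = g - single c 1"
  have f': "lex_less b a" if "b \<in> keys f'" for b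
    using f that by (auto simp: f'_def has_lead_def in_keys_iff lookup_minus lookup_single when_def split: if_splits)
  have g': "lex_less b c" if "b \<in> keys g'" for b
    using g that by (auto simp: g'_def has_lead_def in_keys_iff lookup_minus lookup_single when_def split: if_splits)
  have "f * g = single (a + c) 1 + (single a 1 * g' + f' * g)"
    by (simp add: f'_def g'_def algebra_simps mult_single)
  moreover have "a + c \<notin> keys (single a 1 * g')"
  proof
    assume "a + c \<in> keys (single a 1 * g')"
    then obtain d where "d \<in> keys g'" "a + c = a + d"
      using keys_mult[of "single a 1" g'] by (auto split: if_splits)
    then show False using g'[of d] by simp
  qed
  moreover have "a + c \<notin> keys (f' * g)"
  proof
    assume "a + c \<in> keys (f' * g)"
    then obtain b d where b: "b \<in> keys f'" and d: "d \<in> keys g" "a + c = b + d"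
      using keys_mult[of f' g] by blast
    have "d = c \<or> lex_less d c" using g d by (auto simp: has_lead_def)
    with f'[OF b] have "lex_less (b + d) (a + c)"
      using lex_less_add_left[of d c b] lex_less_add_left[of b a c] lex_less_trans[of "b + d" "b + c" "a + c"]
      by (auto simp: add.commute)
    with d show False by simp
  qed
  ultimately have "lookup (f * g) (a + c) = 1"
    by (simp add: lookup_add in_keys_iff)
  moreover have "b = a + c \<or> lex_less b (a + c)" if b: "b \<in> keys (f * g)" for b
  proof -
    obtain p q where "p \<in> keys f" "q \<in> keys g" "b = p + q"
      using keys_mult[of f g] b by blast
    then show ?thesis using f g lex_less_add_mono[of p a q c] by (auto simp: has_lead_def)
  qed
  ultimately show ?thesis by (simp add: has_lead_def)
qed

lemma has_lead_prod:
  assumes "\<And>x. x \<in> A \<Longrightarrow> has_lead (f x) (e x)"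
  shows "has_lead (\<Prod>x\<in>A. f x) (\<Sum>x\<in>A. e x)"
  using assms
  by (induction A rule: infinite_finite_induct) (auto simp: has_lead_mult has_lead_def[of 1 0])

lemma prod_Var_eq_single:
  "(\<Prod>r\<in>A. Var (f r) (g r)) = single (\<Sum>r\<in>A. unit_exp (f r, g r)) 1"
  by (induction A rule: infinite_finite_induct) (simp_all add: Var_def mult_single)

text \<open>The diagonal term leads. Let \<open>m\<close> be the last row moved by \<sigma>: rows
  beyond \<open>m\<close> agree with the diagonal term, and rows up to \<open>m\<close> only reach
  columns up to \<open>s m\<close>. So the most significant difference is at
  \<open>(m, s m)\<close>, where the diagonal term has a unit and the other has none.\<close>

lemma has_lead_minor:
  assumes s: "\<And>r r'. r \<in> {1..k} \<Longrightarrow> r' \<in> {1..k} \<Longrightarrow> r < r' \<Longrightarrow> s r < s r'"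
  shows "has_lead (minor k s) (\<Sum>r=1..k. unit_exp (r, s r))"
proof -
  define e where "e = (\<lambda>\<sigma>. (\<Sum>r=1..k. unit_exp (r, s (\<sigma> r))))"
  have inj_s: "r = r'" if "s r = s r'" "r \<in> {1..k}" "r' \<in> {1..k}" for r r'
    using s[of r r'] s[of r' r] that by (metis nat_neq_iff order_less_irrefl)
  have mono_s: "s r < s r' \<longleftrightarrow> r < r'" if "r \<in> {1..k}" "r' \<in> {1..k}" for r r'
    using s[of r r'] s[of r' r] inj_s that by (metis nat_neq_iff order_less_asym)
  have lookup_e: "lookup (e \<sigma>) (i, c) = (if i \<in> {1..k} \<and> c = s (\<sigma> i) then 1 else 0)" for \<sigma> i c
  proof -
    have "lookup (e \<sigma>) (i, c) = (\<Sum>r=1..k. if r = i then (if c = s (\<sigma> i) then 1 else 0) else 0)"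
      unfolding e_def lookup_sum lookup_single by (intro sum.cong) (auto simp: when_def)
    then show ?thesis by simp
  qed
  have less: "lex_less (e \<sigma>) (e id)" if \<sigma>: "\<sigma> permutes {1..k}" "\<sigma> \<noteq> id" for \<sigma>
  proof -
    define D where "D = {r \<in> {1..k}. \<sigma> r \<noteq> r}"
    have "D \<noteq> {}"
      using \<sigma> by (auto simp: D_def fun_eq_iff permutes_def)
    have fin: "finite D" by (simp add: D_def)
    define m where "m = Max D"
    have "m \<in> D" unfolding m_def by (rule Max_in[OF fin \<open>D \<noteq> {}\<close>])
    then have m: "m \<in> {1..k}" "\<sigma> m \<noteq> m" by (auto simp: D_def)
    have above: "\<sigma> r = r" if "r > m" for r
    proof (cases "r \<in> {1..k}")
      case True
      have "r \<notin> D" using that Max_ge[OF fin, of r] by (auto simp: m_def)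
      with True show ?thesis by (simp add: D_def)
    next
      case False
      then show ?thesis using \<sigma>(1) by (auto simp: permutes_def)
    qed
    have below: "\<sigma> r < r \<or> \<sigma> r \<le> m" if "r \<le> m" for r
    proof (rule ccontr)
      assume "\<not> ?thesis"
      then have "\<sigma> (\<sigma> r) = \<sigma> r" using above[of "\<sigma> r"] by simp
      then have "\<sigma> r = r" using permutes_inj[OF \<sigma>(1)] by (auto dest: injD)
      with \<open>\<not> ?thesis\<close> that show False by simp
    qed
    show ?thesis
      unfolding lex_less_def
    proof (intro exI[of _ "(m, s m)"] conjI allI impI)
      have "s m \<noteq> s (\<sigma> m)"
        using m inj_s[of m "\<sigma> m"] permutes_in_image[OF \<sigma>(1)] by auto
      then show "lookup (e \<sigma>) (m, s m) < lookup (e id) (m, s m)"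
        using m by (simp add: lookup_e)
      fix q assume q: "rank_gt q (m, s m)"
      obtain i c where ic: "q = (i, c)" by (cases q)
      show "lookup (e \<sigma>) q = lookup (e id) q"
      proof (cases "i \<in> {1..k}")
        case True
        have \<sigma>i: "\<sigma> i \<in> {1..k}" using permutes_in_image[OF \<sigma>(1)] True by simp
        show ?thesis
        proof (cases "i > m")
          case False
          then have "\<sigma> i \<le> m" using below[of i] by auto
          then have "s (\<sigma> i) \<le> s m" using mono_s[OF m(1) \<sigma>i] by simp
          moreover have "s i \<le> s m" using mono_s[OF m(1) True] False by simp
          moreover have "c > s m" using q False by (auto simp: rank_gt_def ic)
          ultimately show ?thesis unfolding ic lookup_e by simp
        qed (simp add: ic lookup_e above)
      qed (auto simp: ic lookup_e)
    qed
  qed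
  have minor: "minor k s = (\<Sum>\<sigma> | \<sigma> permutes {1..k}. single (e \<sigma>) (of_int (sign \<sigma>)))"
    unfolding minor_def
    by (simp add: prod_Var_eq_single Const_def mult_single e_def del: single_of_int)
  have "lookup (minor k s) (e id) =
      (\<Sum>\<sigma> | \<sigma> permutes {1..k}. if \<sigma> = id then 1 else 0)"
    unfolding minor lookup_sum lookup_single
  proof (intro sum.cong refl)
    fix \<sigma> assume "\<sigma> \<in> {\<sigma>. \<sigma> permutes {1..k}}"
    then show "((of_int (sign \<sigma>) :: complex) when e \<sigma> = e id) = (if \<sigma> = id then 1 else 0)"
      using less[of \<sigma>] by (cases "\<sigma> = id") auto
  qed
  then have "lookup (minor k s) (e id) = 1"
    by (simp add: finite_permutations permutes_id)
  moreover have "b = e id \<or> lex_less b (e id)" if b: "b \<in> keys (minor k s)" for b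
  proof -
    have "\<exists>\<sigma>\<in>{\<sigma>. \<sigma> permutes {1..k}}. lookup (single (e \<sigma>) (of_int (sign \<sigma>) :: complex)) b \<noteq> 0"
      using b unfolding minor in_keys_iff lookup_sum by (meson sum.neutral)
    then obtain \<sigma> where "\<sigma> permutes {1..k}" "b = e \<sigma>"
      by (auto simp: lookup_single when_def split: if_splits)
    then show ?thesis using less[of \<sigma>] by (cases "\<sigma> = id") auto
  qed
  ultimately have "has_lead (minor k s) (e id)" by (simp add: has_lead_def)
  then show ?thesis by (simp add: e_def)
qed

lemma has_lead_unique:
  assumes "has_lead f a" "has_lead f b"
  shows "a = b"
proof -
  have "a \<in> keys f" "b \<in> keys f"
    using assms by (auto simp: has_lead_def in_keys_iff)
  then have "a = b \<or> lex_less a b" "b = a \<or> lex_less b a"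
    using assms by (auto simp: has_lead_def)
  then show ?thesis using lex_less_trans[of a b a] by auto
qed

text \<open>Among the members with nonzero coefficient in a relation, the greatest of the leading
  exponents occurs in one member only, so its coefficient cannot cancel.\<close>

lemma independent_of_distinct_leads:
  assumes A: "finite A" and lead: "\<And>x. x \<in> A \<Longrightarrow> has_lead (F x) (e x)" and inj: "inj_on e A"
  shows "inj_on F A" "poly_vs.independent (F ` A)"
proof -
  show injF: "inj_on F A"
  proof (rule inj_onI)
    fix x y assume "x \<in> A" "y \<in> A" "F x = F y"
    then have "e x = e y" using lead has_lead_unique by metis
    with \<open>x \<in> A\<close> \<open>y \<in> A\<close> show "x = y" using inj by (auto dest: inj_onD)
  qed
  show "poly_vs.independent (F ` A)"
  proof
    assume "poly_vs.dependent (F ` A)"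
    then obtain u x where u: "(\<Sum>v\<in>F ` A. Const (u v) * v) = 0" and x: "x \<in> A" "u (F x) \<noteq> 0"
      unfolding poly_vs.dependent_finite[OF finite_imageI[OF A]] by blast
    define B where "B = {x \<in> A. u (F x) \<noteq> 0}"
    have "finite (e ` B)" "e ` B \<noteq> {}" using A x by (auto simp: B_def)
    then obtain a where a: "a \<in> e ` B" and max: "\<And>b. b \<in> e ` B \<Longrightarrow> b = a \<or> lex_less b a"
      by (rule lex_greatest_exists) blast
    then obtain y where y: "y \<in> B" "a = e y" by blast
    have "0 = lookup (\<Sum>x\<in>A. Const (u (F x)) * F x) a"
      using u unfolding sum.reindex[OF injF] by simp
    also have "\<dots> = (\<Sum>x\<in>A. if x = y then u (F y) else 0)"
      unfolding lookup_sum lookup_Const_mult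
    proof (intro sum.cong refl)
      fix x assume xA: "x \<in> A"
      show "u (F x) * lookup (F x) a = (if x = y then u (F y) else 0)"
      proof (cases "x = y")
        case True
        then show ?thesis using lead[OF xA] y by (simp add: has_lead_def)
      next
        case False
        have "u (F x) = 0 \<or> a \<notin> keys (F x)"
        proof (rule ccontr)
          assume "\<not> ?thesis"
          then have "x \<in> B" "a \<in> keys (F x)" using xA by (auto simp: B_def)
          then have 1: "e x = a \<or> lex_less (e x) a" and 2: "a = e x \<or> lex_less a (e x)"
            using max[of "e x"] lead[OF xA] by (auto simp: has_lead_def)
          have "e x \<noteq> a" using False inj xA y by (auto simp: B_def dest: inj_onD)
          with 1 2 show False using lex_less_trans[of a "e x" a] by auto
        qed
        then show ?thesis using False by (auto simp: in_keys_iff)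
      qed
    qed
    also have "\<dots> = u (F y)" using A y by (simp add: B_def)
    finally show False using y by (simp add: B_def)
  qed
qed

section \<open>The product of minors attached to a semistandard tableau: lead, degree and
  weight\<close>

lemma sum_young_diagram:
  assumes \<mu>: "is_partition \<mu> N"
  shows "(\<Sum>x\<in>young_diagram \<mu>. f x) =
     (\<Sum>c=1..part \<mu> 1. \<Sum>r=1..card {r. (r, c) \<in> young_diagram \<mu>}. f (r, c))"
    and "c \<in> {1..part \<mu> 1} \<Longrightarrow> {r. (r, c) \<in> young_diagram \<mu>} = {1..card {r. (r, c) \<in> young_diagram \<mu>}}"
proof -
  have fin: "finite {r. (r, c) \<in> young_diagram \<mu>}" for c
  proof -
    have "{r. (r, c) \<in> young_diagram \<mu>} \<subseteq> {..length \<mu>}" using young_diagram_row_le_length by auto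
    then show ?thesis by (rule finite_subset) simp
  qed
  show col: "{r. (r, c) \<in> young_diagram \<mu>} = {1..card {r. (r, c) \<in> young_diagram \<mu>}}" for c
  proof (rule downward_closed_eq_interval[OF fin])
    fix r r' assume "r \<in> {r. (r, c) \<in> young_diagram \<mu>}" "1 \<le> r'" "r' \<le> r"
    then show "r' \<in> {r. (r, c) \<in> young_diagram \<mu>}"
      using part_antimono[OF \<mu>, of r' r] by (auto simp: mem_young_diagram)
  qed (simp add: mem_young_diagram)
  have "young_diagram \<mu> = (\<lambda>(c, r). (r, c)) ` (SIGMA c:{1..part \<mu> 1}. {r. (r, c) \<in> young_diagram \<mu>})"
    using part_antimono[OF \<mu>, of 1] by (force simp: mem_young_diagram)
  then have "(\<Sum>x\<in>young_diagram \<mu>. f x) =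
      (\<Sum>x\<in>(\<lambda>(c, r). (r, c)) ` (SIGMA c:{1..part \<mu> 1}. {r. (r, c) \<in> young_diagram \<mu>}). f x)"
    by (rule arg_cong)
  also have "\<dots> = (\<Sum>(c, r)\<in>(SIGMA c:{1..part \<mu> 1}. {r. (r, c) \<in> young_diagram \<mu>}). f (r, c))"
    by (subst sum.reindex) (auto simp: inj_on_def case_prod_unfold)
  also have "\<dots> = (\<Sum>c=1..part \<mu> 1. \<Sum>r\<in>{r. (r, c) \<in> young_diagram \<mu>}. f (r, c))"
    by (rule sum.Sigma[symmetric]) (simp_all add: fin)
  finally show "(\<Sum>x\<in>young_diagram \<mu>. f x) =
     (\<Sum>c=1..part \<mu> 1. \<Sum>r=1..card {r. (r, c) \<in> young_diagram \<mu>}. f (r, c))"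
    by (simp only: col[symmetric])
qed

context
  fixes \<mu> :: "nat list" and n l :: nat and T
  assumes \<mu>: "is_partition \<mu> (n * l)"
    and T: "T \<in> semistandard_tableaux \<mu> (replicate n l)"
begin

private abbreviation (input) "h c \<equiv> card {r. (r, c) \<in> young_diagram \<mu>}"

private lemma column_mem: "c \<in> {1..part \<mu> 1} \<Longrightarrow> r \<in> {1..h c} \<Longrightarrow> (r, c) \<in> young_diagram \<mu>"
  using sum_young_diagram(2)[OF \<mu>, of c] by blast

private lemma height_le: "c \<in> {1..part \<mu> 1} \<Longrightarrow> h c \<le> n"
  using semistandard_length_le[OF T \<mu> column_mem[of c "h c"]] by (cases "h c = 0") auto

lemma has_lead_tableau_minors: "has_lead (tableau_minors \<mu> T) (tableau_exp \<mu> T)"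
proof -
  have "has_lead (tableau_minors \<mu> T) (\<Sum>c=1..part \<mu> 1. \<Sum>r=1..h c. unit_exp (r, T (r, c)))"
    unfolding tableau_minors_def
  proof (intro has_lead_prod has_lead_minor)
    fix c r r' assume "c \<in> {1..part \<mu> 1}" "r \<in> {1..h c}" "r' \<in> {1..h c}" "r < r'"
    then show "T (r, c) < T (r', c)"
      using semistandard_col_less[OF T column_mem column_mem] by blast
  qed
  then show ?thesis
    unfolding tableau_exp_def sum_young_diagram(1)[OF \<mu>] by simp
qed

lemma tableau_minors_col_homogeneous: "tableau_minors \<mu> T \<in> col_homogeneous n (\<lambda>_. l)"
proof -
  have "tableau_minors \<mu> T \<in> col_homogeneous n
      (\<lambda>q. \<Sum>c=1..part \<mu> 1. \<Sum>r=1..h c. if q = T (r, c) then 1 else 0)"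
    unfolding tableau_minors_def
    using height_le semistandard_entry_bounds[OF T column_mem]
    by (intro col_homogeneous_prod col_homogeneous_minor) auto
  moreover have "(\<Sum>c=1..part \<mu> 1. \<Sum>r=1..h c. if q = T (r, c) then 1 else 0) = l"
    if "q \<in> {1..n}" for q
  proof -
    have "(\<Sum>c=1..part \<mu> 1. \<Sum>r=1..h c. if q = T (r, c) then 1 else 0) =
        (\<Sum>x\<in>young_diagram \<mu>. if q = T x then 1 else 0)"
      by (rule sum_young_diagram(1)[OF \<mu>, symmetric])
    also have "\<dots> = card {x \<in> young_diagram \<mu>. T x = q}"
      using finite_young_diagram by (simp add: sum.If_cases Int_def eq_commute)
    finally show ?thesis using semistandard_card_col[OF T that] by simp
  qed
  ultimately show ?thesis by (simp add: col_homogeneous_def)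
qed

lemma tableau_minors_hw: "tableau_minors \<mu> T \<in> hw_space n (part \<mu>)"
proof -
  have s: "T (r, c) \<in> {1..n}" if "c \<in> {1..part \<mu> 1}" "r \<in> {1..h c}" for c r
    using semistandard_entry_bounds[OF T column_mem[OF that]] .
  have "col_op {1..n} i j (tableau_minors \<mu> T) = 0" if "i \<in> {1..n}" "i < j" for i j
  proof -
    have "col_op {1..n} i j (tableau_minors \<mu> T) =
        Const (of_nat (\<Sum>c=1..part \<mu> 1. 0)) * tableau_minors \<mu> T"
      unfolding tableau_minors_def
    proof (rule col_op_prod_eigen)
      fix c assume c: "c \<in> {1..part \<mu> 1}"
      show "col_op {1..n} i j (minor (h c) (\<lambda>r. T (r, c))) =
          Const (of_nat 0) * minor (h c) (\<lambda>r. T (r, c))"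
        using col_op_minor_upper[of "h c" "\<lambda>r. T (r, c)" n i j] that s[OF c] by simp
    qed
    then show ?thesis by simp
  qed
  moreover have "col_op {1..n} i i (tableau_minors \<mu> T) = Const (of_nat (part \<mu> i)) * tableau_minors \<mu> T"
    if i: "i \<in> {1..n}" for i
  proof -
    have "col_op {1..n} i i (tableau_minors \<mu> T) =
        Const (of_nat (\<Sum>c=1..part \<mu> 1. if i \<le> h c then 1 else 0)) * tableau_minors \<mu> T"
      unfolding tableau_minors_def
      using s i by (intro col_op_prod_eigen col_op_minor_diag) auto
    \<comment> \<open>The columns of length at least \<open>i\<close> are the first
      \<open>part \<mu> i\<close> ones.\<close>
    moreover have "(\<Sum>c=1..part \<mu> 1. if i \<le> h c then 1 else 0) = part \<mu> i"
    proof -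
      have "i \<le> h c \<longleftrightarrow> c \<le> part \<mu> i" if c: "c \<in> {1..part \<mu> 1}" for c
      proof -
        have "i \<le> h c \<longleftrightarrow> i \<in> {1..h c}" using i by simp
        also have "\<dots> \<longleftrightarrow> i \<in> {r. (r, c) \<in> young_diagram \<mu>}" using sum_young_diagram(2)[OF \<mu> c] by simp
        finally show ?thesis using i c by (simp add: mem_young_diagram)
      qed
      then have "(\<Sum>c=1..part \<mu> 1. if i \<le> h c then 1 else 0) =
          (\<Sum>c=1..part \<mu> 1. if c \<le> part \<mu> i then 1 else 0)"
        by (intro sum.cong) auto
      also have "\<dots> = card ({1..part \<mu> 1} \<inter> {c. c \<le> part \<mu> i})" by (simp add: sum.If_cases)
      also have "{1..part \<mu> 1} \<inter> {c. c \<le> part \<mu> i} = {1..part \<mu> i}"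
        using part_antimono[OF \<mu>, of 1 i] i by auto
      finally show ?thesis by simp
    qed
    ultimately show ?thesis by simp
  qed
  ultimately show ?thesis by (simp add: hw_space_def)
qed

end

lemma independent_tableau_minors:
  assumes \<mu>: "is_partition \<mu> (n * l)"
  obtains B where "finite B" "poly_vs.independent B" "card B = kostka \<mu> (replicate n l)"
    "B \<subseteq> hw_space n (part \<mu>) \<inter> col_homogeneous n (\<lambda>_. l)"
proof
  define S where "S = semistandard_tableaux \<mu> (replicate n l)"
  have fin: "finite S" unfolding S_def by (rule finite_semistandard_tableaux)
  note * = independent_of_distinct_leads[OF fin has_lead_tableau_minors[OF \<mu>], unfolded S_def,
      OF _ tableau_exp_inj]
  show "finite (tableau_minors \<mu> ` S)" using fin by simp
  show "poly_vs.independent (tableau_minors \<mu> ` S)" unfolding S_def by (rule *(2))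
  show "card (tableau_minors \<mu> ` S) = kostka \<mu> (replicate n l)"
    unfolding kostka_def S_def by (rule card_image) (rule *(1))
  show "tableau_minors \<mu> ` S \<subseteq> hw_space n (part \<mu>) \<inter> col_homogeneous n (\<lambda>_. l)"
    using tableau_minors_hw[OF \<mu>] tableau_minors_col_homogeneous[OF \<mu>] by (auto simp: S_def)
qed

section \<open>The \<open>\<alpha>\<close>-determinant\<close>


text \<open>\<open>perm_nu\<close> vanishes only if the points of \<open>{1..n}\<close> lie in
  different orbits, but \<open>x\<close> and \<open>\<sigma> x\<close> share one.\<close>

lemma perm_nu_eq_0_iff:
  assumes \<sigma>: "\<sigma> permutes {1..n}"
  shows "perm_nu n \<sigma> = 0 \<longleftrightarrow> \<sigma> = id"
proof
  assume "perm_nu n \<sigma> = 0"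
  then have "n \<le> card (orbit \<sigma> ` {1..n})" by (simp add: perm_nu_def)
  then have "card (orbit \<sigma> ` {1..n}) = card {1..n}"
    using card_image_le[of "{1..n}" "orbit \<sigma>"] by simp
  then have inj: "inj_on (orbit \<sigma>) {1..n}" by (intro eq_card_imp_inj_on) auto
  have "\<sigma> x = x" for x
  proof (cases "x \<in> {1..n}")
    case True
    have "orbit \<sigma> (\<sigma> x) = orbit \<sigma> x"
      using \<sigma> by (intro permutation_orbit_step) (auto simp: permutation_permutes)
    then show ?thesis
      using inj_onD[OF inj, of "\<sigma> x" x] True permutes_in_image[OF \<sigma>] by simp
  next
    case False
    then show ?thesis using \<sigma> by (auto simp: permutes_def)
  qed
  then show "\<sigma> = id" by (simp add: fun_eq_iff)
next
  assume "\<sigma> = id"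
  moreover have "orbit id x = {x}" for x :: nat by (simp add: orbit_eq_singleton_iff)
  then have "orbit id ` {1..n} = (\<lambda>x. {x}) ` {1..n}" by simp
  then have "card (orbit id ` {1..n}) = n" by (simp add: card_image)
  ultimately show "perm_nu n \<sigma> = 0" by (simp add: perm_nu_def)
qed

text \<open>As \<open>0 ^ 0 = 1\<close>, the identity is the only permutation with nonzero
  coefficient.\<close>

lemma alpha_det_0: "alpha_det n 0 = (\<Prod>i=1..n. Var i i)"
proof -
  have "alpha_det n 0 = (\<Sum>\<sigma> | \<sigma> permutes {1..n}. if \<sigma> = id then (\<Prod>i=1..n. Var i i) else 0)"
    unfolding alpha_det_def
  proof (intro sum.cong refl)
    fix \<sigma> assume "\<sigma> \<in> {\<sigma>. \<sigma> permutes {1..n}}"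
    then have "perm_nu n \<sigma> = 0 \<longleftrightarrow> \<sigma> = id" by (simp add: perm_nu_eq_0_iff)
    then show "Const (0 ^ perm_nu n \<sigma>) * (\<Prod>i=1..n. Var (\<sigma> i) i) =
        (if \<sigma> = id then (\<Prod>i=1..n. Var i i) else 0)"
      by (cases "\<sigma> = id") (auto simp: power_0_left)
  qed
  then show ?thesis by (simp add: finite_permutations permutes_id)
qed

lemma alpha_det_power_col_homogeneous: "alpha_det n \<alpha> ^ l \<in> col_homogeneous n (\<lambda>_. l)"
proof -
  have "(\<Prod>i=1..n. Var (\<sigma> i) i) \<in> col_homogeneous n (\<lambda>q. \<Sum>i=1..n. if q = i then 1 else 0)"
    if \<sigma>: "\<sigma> permutes {1..n}" for \<sigma>
    using permutes_in_image[OF \<sigma>] by (intro col_homogeneous_prod col_homogeneous_Var) auto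
  then have "alpha_det n \<alpha> \<in> col_homogeneous n (\<lambda>q. \<Sum>i=1..n. if q = i then 1 else 0)"
    unfolding alpha_det_def
    by (intro poly_vs.subspace_sum poly_vs.subspace_scale subspace_col_homogeneous) auto
  then have "alpha_det n \<alpha> ^ l \<in> col_homogeneous n (\<lambda>q. l * (\<Sum>i=1..n. if q = i then 1 else 0))"
    by (rule col_homogeneous_power)
  then show ?thesis by (simp add: col_homogeneous_def)
qed

lemma gl_stable_single:
  assumes "gl_stable n N" "single a c \<in> N" "c \<noteq> 0"
  shows "single a d \<in> N"
proof -
  have "Const (d / c) * single a c \<in> N"
    using assms by (auto simp: gl_stable_def intro: poly_vs.subspace_scale)
  then show ?thesis using assms(3) by (simp add: Const_def mult_single)
qed

text \<open>All monomials are reached from \<open>x\<^sub>1\<^sub>1\<^sup>l \<cdots> x\<^sub>n\<^sub>n\<^sup>l\<close> by filling the columns from the last one down: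
  as long as the columns before \<open>j\<close> are still diagonal, an operator \<open>E\<^sub>i\<^sub>j\<close> changes column \<open>j\<close> in
  the intended way, up to terms in which it acts on a later, hence arbitrary, column.\<close>

lemma gl_stable_diagonal_generates:
  assumes N: "gl_stable n N" and gen: "(\<Prod>i=1..n. Var i i) ^ l \<in> N"
  shows "col_homogeneous n (\<lambda>_. l) \<subseteq> N"
proof -
  \<comment> \<open>The stages of the filling: \<open>A (Suc n)\<close> contains only the exponent
    of the generator, \<open>A 1\<close> all exponents of the space.\<close>
  define A where "A = (\<lambda>j. {a. keys a \<subseteq> {1..n} \<times> {1..n} \<and>
      (\<forall>k\<in>{1..n}. (\<Sum>r=1..n. lookup a (r, k)) = l) \<and>
      (\<forall>k\<in>{1..<j}. \<forall>r. r \<noteq> k \<longrightarrow> lookup a (r, k) = 0)})"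
  have diag: "lookup a (k, k) = l" if "a \<in> A j" "k \<in> {1..<j}" "k \<in> {1..n}" for a j k
  proof -
    have "l = (\<Sum>r=1..n. lookup a (r, k))" using that by (simp add: A_def)
    also have "\<dots> = (\<Sum>r=1..n. if r = k then lookup a (k, k) else 0)"
      using that by (intro sum.cong) (auto simp: A_def)
    finally show ?thesis using that by simp
  qed
  have "single a 1 \<in> N" if "a \<in> A j" "1 \<le> j" "j \<le> Suc n" for a j
    using that(3,2,1)
  proof (induction j arbitrary: a rule: inc_induct)
    case base
    have pow: "single b (1 :: complex) ^ m =
        single (\<Sum>i<m. b) 1" for b :: "nat \<times> nat \<Rightarrow>\<^sub>0 nat" and m
      by (induction m) (simp_all add: mult_single add.commute)
    have sum_const: "lookup (\<Sum>i<m. b) p = m * lookup b p"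
      for b :: "nat \<times> nat \<Rightarrow>\<^sub>0 nat" and m p
      by (simp add: lookup_sum)
    have "a = (\<Sum>i<l. \<Sum>i=1..n. unit_exp (i, i))"
    proof (rule poly_mapping_eqI)
      fix p :: "nat \<times> nat"
      obtain r k where p: "p = (r, k)" by (cases p)
      have "lookup (\<Sum>i=1..n. unit_exp (i, i)) (r, k) =
          (\<Sum>i=1..n. if i = r then (if r = k then 1 else 0) else 0)"
        unfolding lookup_sum lookup_single by (intro sum.cong) (auto simp: when_def)
      then have R: "lookup (\<Sum>i<l. \<Sum>i=1..n. unit_exp (i, i)) (r, k) =
          l * (if r = k \<and> r \<in> {1..n} then 1 else 0)"
        unfolding sum_const by auto
      have "lookup a (r, k) = l * (if r = k \<and> r \<in> {1..n} then 1 else 0)"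
      proof (cases "k \<in> {1..n}")
        case True
        then show ?thesis using base diag[of a "Suc n" k] by (cases "r = k") (auto simp: A_def)
      next
        case False
        then have "(r, k) \<notin> keys a" using base by (auto simp: A_def)
        then show ?thesis using False by (auto simp: in_keys_iff)
      qed
      with R show "lookup a p =
          lookup (\<Sum>i<l. \<Sum>i=1..n. unit_exp (i, i)) p" by (simp only: p)
    qed
    then show ?case using gen by (simp only: prod_Var_eq_single pow)
  next
    case (step j)
    then have j: "1 \<le> j" "j \<in> {1..n}" by auto
    from \<open>a \<in> A j\<close> show ?case
    \<comment> \<open>The inner induction is on the number of units of column \<open>j\<close> off
      the diagonal.\<close>
    proof (induction "l - lookup a (j, j)" arbitrary: a rule: less_induct)
      case less
      have le_l: "lookup b (i, j) \<le> l" if "b \<in> A j" "i \<in> {1..n}" for b i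
      proof -
        have "lookup b (i, j) \<le> (\<Sum>r=1..n. lookup b (r, j))"
          using that(2) by (intro member_le_sum) auto
        then show ?thesis using that j by (simp add: A_def)
      qed
      show ?case
      proof (cases "\<exists>i. i \<noteq> j \<and> lookup a (i, j) \<noteq> 0")
        case False
        then have "a \<in> A (Suc j)" using less.prems by (auto simp: A_def less_Suc_eq)
        then show ?thesis using step.IH by simp
      next
        case True
        then obtain i where i: "i \<noteq> j" "lookup a (i, j) \<noteq> 0" by blast
        then have "(i, j) \<in> keys a" by (simp add: in_keys_iff)
        then have i_n: "i \<in> {1..n}" using less.prems by (auto simp: A_def)
        define c where "c = a - unit_exp (i, j)"
        have a: "a = c + unit_exp (i, j)"
          using i unfolding c_def
          by (intro poly_mapping_eqI) (auto simp: lookup_add lookup_minus lookup_single when_def)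
        \<comment> \<open>One unit of column \<open>j\<close> is put back on the diagonal;
          \<open>E_ij\<close> applied to the monomial of \<open>a'\<close> then produces that of
          \<open>a\<close>, along with terms from other columns.\<close>
        define a' where "a' = c + unit_exp (j, j)"
        have "keys (c + unit_exp (i, j)) \<subseteq> {1..n} \<times> {1..n}"
          using less.prems unfolding a[symmetric] by (simp add: A_def)
        then have keys_a': "keys a' \<subseteq> {1..n} \<times> {1..n}"
          using j unfolding a'_def keys_plus_nat by auto
        have col_a': "(\<Sum>r=1..n. lookup a' (r, k)) = l" if "k \<in> {1..n}" for k
        proof -
          have "(\<Sum>r=1..n. lookup a (r, k)) = l" using less.prems that by (simp add: A_def)
          then show ?thesis
            unfolding a a'_def lookup_add sum.distrib
            by (simp only: sum_lookup_unit_exp_col[OF i_n] sum_lookup_unit_exp_col[OF j(2)])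
        qed
        have off_a': "lookup a' (r, k) = 0" if "k \<in> {1..<j}" "r \<noteq> k" for r k
          using less.prems that unfolding A_def a'_def c_def
          by (auto simp: lookup_add lookup_minus lookup_single when_def)
        have a'_A: "a' \<in> A j" using keys_a' col_a' off_a' by (simp add: A_def)
        have a'_jj: "lookup a' (j, j) = Suc (lookup a (j, j))"
          using i(1) by (simp add: a a'_def lookup_add lookup_single One_nat_def)
        have bigger: "single b 1 \<in> N"
          if "b \<in> A j" "lookup b (j, j) = lookup a' (j, j)" for b
        proof (rule less.hyps[OF _ that(1)])
          show "l - lookup b (j, j) < l - lookup a (j, j)"
            using le_l[OF that(1) j(2)] that(2) a'_jj by simp
        qed
        have "single a' 1 \<in> N" using bigger[OF a'_A] by simp
        then have E: "col_op {1..n} i j (single a' 1) \<in> N"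
          using N i_n j by (simp add: gl_stable_def)
        define t where "t = (\<lambda>k. single (a' - unit_exp (j, k) + unit_exp (i, k))
            (1 * of_nat (lookup a' (j, k))) :: matrix_poly)"
        \<comment> \<open>Columns before \<open>j\<close> contribute nothing, as \<open>a'\<close>
          has no unit in row \<open>j\<close> there. A column behind \<open>j\<close> yields an
          exponent in \<open>A j\<close> with the same entry at \<open>(j, j)\<close> as
          \<open>a'\<close>, which is larger than that of \<open>a\<close>, so the induction
          hypothesis applies.\<close>
        have other: "t k \<in> N" if k: "k \<in> {1..n} - {j}" for k
        proof (cases "lookup a' (j, k) = 0")
          case True
          then show ?thesis using N by (simp add: t_def gl_stable_def poly_vs.subspace_0)
        next
          case False
          then have "k > j" using off_a'[of k j] k by force
          define e where "e = a' - unit_exp (j, k)"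
          have e: "a' = e + unit_exp (j, k)"
            using False unfolding e_def
            by (intro poly_mapping_eqI) (auto simp: lookup_add lookup_minus lookup_single when_def)
          have "e + unit_exp (i, k) \<in> A j"
            unfolding A_def
          proof (intro CollectI conjI ballI allI impI)
            show "keys (e + unit_exp (i, k)) \<subseteq> {1..n} \<times> {1..n}"
              using keys_a' i_n k unfolding e keys_plus_nat by auto
            fix q assume q: "q \<in> {1..n}"
            show "(\<Sum>r=1..n. lookup (e + unit_exp (i, k)) (r, q)) = l"
              using col_a'[OF q] unfolding e lookup_add sum.distrib
              by (simp only: sum_lookup_unit_exp_col[OF i_n] sum_lookup_unit_exp_col[OF j(2)])
          next
            fix q r assume "q \<in> {1..<j}" "r \<noteq> q"
            then show "lookup (e + unit_exp (i, k)) (r, q) = 0"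
              using off_a'[of q r] \<open>k > j\<close> unfolding e by (auto simp: lookup_add lookup_single when_def)
          qed
          moreover have "lookup (e + unit_exp (i, k)) (j, j) = lookup a' (j, j)"
            using \<open>k > j\<close> unfolding e by (simp add: lookup_add lookup_single)
          ultimately have "single (e + unit_exp (i, k)) 1 \<in> N" by (rule bigger)
          then show ?thesis unfolding t_def e_def by (rule gl_stable_single[OF N]) simp
        qed
        have "(\<Sum>k\<in>{1..n} - {j}. t k) \<in> N"
          using N other by (intro poly_vs.subspace_sum) (auto simp: gl_stable_def)
        moreover have "t j = col_op {1..n} i j (single a' 1) - (\<Sum>k\<in>{1..n} - {j}. t k)"
          unfolding col_op_single t_def[symmetric]
          using sum.remove[OF finite_atLeastAtMost j(2), of t] by (simp add: t_def)
        ultimately have "t j \<in> N"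
          using N E by (auto simp: gl_stable_def intro: poly_vs.subspace_diff)
        moreover have "a' - unit_exp (j, j) + unit_exp (i, j) = a"
          by (simp add: a a'_def)
        ultimately show ?thesis
          unfolding t_def using gl_stable_single[OF N, of a _ 1] a'_jj by (simp del: of_nat_Suc)
      qed
    qed
  qed
  then have mono: "single a 1 \<in> N" if "a \<in> A 1" for a
    using that by (simp add: One_nat_def)
  show ?thesis
  proof
    fix f assume f: "f \<in> col_homogeneous n (\<lambda>_. l)"
    show "f \<in> N"
    proof (subst matrix_poly_eq_sum_single, rule poly_vs.subspace_sum)
      show "poly_vs.subspace N" using N by (simp add: gl_stable_def)
      fix a assume "a \<in> keys f"
      then have "a \<in> A 1" using f by (auto simp: A_def col_homogeneous_def)
      then show "single a (lookup f a) \<in> N"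
        by (intro gl_stable_single[OF N mono]) auto
    qed
  qed
qed

section \<open>The enveloping algebra and its modules\<close>

abbreviation scalar_elem :: "complex \<Rightarrow> gl_word \<Rightarrow> complex" where
  "scalar_elem c \<equiv> (\<lambda>w. if w = [] then c else 0)"

abbreviation U_proj :: "nat \<Rightarrow> (gl_word \<Rightarrow> complex) \<Rightarrow> env_elem" where
  "U_proj n p \<equiv> gl_ideal n +>\<^bsub>gl_tensor_algebra n\<^esub> p"

lemma carrier_U_gl: "carrier (U_gl n) = U_proj n ` carrier (gl_tensor_algebra n)"
  by (auto simp: U_gl_def FactRing_def A_RCOSETS_def')

lemma U_proj_ring_hom: "U_proj n \<in> ring_hom (gl_tensor_algebra n) (U_gl n)"
  unfolding U_gl_def by (rule ideal.rcos_ring_hom[OF ideal_gl_ideal])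

lemma U_proj_mult:
  "p \<in> carrier (gl_tensor_algebra n) \<Longrightarrow> q \<in> carrier (gl_tensor_algebra n) \<Longrightarrow>
     U_proj n (p \<otimes>\<^bsub>gl_tensor_algebra n\<^esub> q) = U_proj n p \<otimes>\<^bsub>U_gl n\<^esub> U_proj n q"
  by (rule ring_hom_mult[OF U_proj_ring_hom])

lemma U_proj_add:
  "p \<in> carrier (gl_tensor_algebra n) \<Longrightarrow> q \<in> carrier (gl_tensor_algebra n) \<Longrightarrow>
     U_proj n (p \<oplus>\<^bsub>gl_tensor_algebra n\<^esub> q) = U_proj n p \<oplus>\<^bsub>U_gl n\<^esub> U_proj n q"
  by (rule ring_hom_add[OF U_proj_ring_hom])

lemma U_proj_closed: "p \<in> carrier (gl_tensor_algebra n) \<Longrightarrow> U_proj n p \<in> carrier (U_gl n)"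
  by (rule ring_hom_closed[OF U_proj_ring_hom])

lemma U_proj_ideal: "p \<in> gl_ideal n \<Longrightarrow> U_proj n p = \<zero>\<^bsub>U_gl n\<^esub>"
proof -
  interpret T: ring "gl_tensor_algebra n" by (rule ring_gl_tensor_algebra)
  interpret I: ideal "gl_ideal n" "gl_tensor_algebra n" by (rule ideal_gl_ideal)
  assume "p \<in> gl_ideal n"
  then have "U_proj n p = gl_ideal n" by (rule I.a_rcos_const)
  then show ?thesis by (simp add: U_gl_def FactRing_def)
qed

lemma scalar_elem_closed [simp]: "scalar_elem c \<in> carrier (gl_tensor_algebra n)"
proof -
  have "{w. scalar_elem c w \<noteq> 0} \<subseteq> {[]}" by auto
  then have "finite {w. scalar_elem c w \<noteq> 0}" by (rule finite_subset) simp
  then show ?thesis by (auto simp: gl_tensor_algebra_def)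
qed

lemma word_elem_closed: "w \<in> lists ({1..n} \<times> {1..n}) \<Longrightarrow> word_elem w \<in> carrier (gl_tensor_algebra n)"
  by (simp add: gl_tensor_algebra_def word_elem_def)

lemma scalar_elem_mult_left: "scalar_elem c \<otimes>\<^bsub>gl_tensor_algebra n\<^esub> p = (\<lambda>w. c * p w)"
proof
  fix w
  have "(\<Sum>k\<le>length w. (if take k w = [] then c else 0) * p (drop k w)) =
      c * (\<Sum>k\<le>length w. (if take k w = [] then 1 else 0) * p (drop k w))"
    unfolding sum_distrib_left by (intro sum.cong) auto
  then show "(scalar_elem c \<otimes>\<^bsub>gl_tensor_algebra n\<^esub> p) w = c * p w"
    unfolding gl_tensor_one_left by (simp add: gl_tensor_algebra_def)
qed

lemma scalar_elem_mult_right: "p \<otimes>\<^bsub>gl_tensor_algebra n\<^esub> scalar_elem c = (\<lambda>w. c * p w)"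
proof
  fix w
  have "(\<Sum>k\<le>length w. p (take k w) * (if drop k w = [] then c else 0)) =
      c * (\<Sum>k\<le>length w. p (take k w) * (if drop k w = [] then 1 else 0))"
    unfolding sum_distrib_left by (intro sum.cong) auto
  then show "(p \<otimes>\<^bsub>gl_tensor_algebra n\<^esub> scalar_elem c) w = c * p w"
    unfolding gl_tensor_one_right by (simp add: gl_tensor_algebra_def)
qed

lemma word_elem_mult: "word_elem u \<otimes>\<^bsub>gl_tensor_algebra n\<^esub> word_elem v = word_elem (u @ v)"
proof
  fix w
  have "(\<Sum>k\<le>length w. word_elem u (take k w) * word_elem v (drop k w)) =
      (\<Sum>k\<le>length w. if k = length u then word_elem (u @ v) w else 0)"
  proof (intro sum.cong refl)
    fix k assume k: "k \<in> {..length w}"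
    have "take k w = u \<and> drop k w = v \<longleftrightarrow> k = length u \<and> w = u @ v"
      using k by (auto simp: min_def)
    moreover have "word_elem u (take k w) * word_elem v (drop k w) =
        (if take k w = u \<and> drop k w = v then 1 else 0)"
      by (simp add: word_elem_def)
    moreover have "(if k = length u then word_elem (u @ v) w else 0) =
        (if k = length u \<and> w = u @ v then 1 else 0)"
      by (simp add: word_elem_def)
    ultimately show "word_elem u (take k w) * word_elem v (drop k w) =
        (if k = length u then word_elem (u @ v) w else 0)"
      by simp
  qed
  also have "\<dots> = word_elem (u @ v) w" by (auto simp: word_elem_def)
  finally show "(word_elem u \<otimes>\<^bsub>gl_tensor_algebra n\<^esub> word_elem v) w = word_elem (u @ v) w"
    by (simp add: gl_tensor_algebra_def)
qed

lemma U_scalar_closed [simp]: "U_scalar n c \<in> carrier (U_gl n)"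
  unfolding U_scalar_def by (rule U_proj_closed) simp

lemma U_unit_closed: "i \<in> {1..n} \<Longrightarrow> j \<in> {1..n} \<Longrightarrow> U_unit n i j \<in> carrier (U_gl n)"
  unfolding U_unit_def by (intro U_proj_closed word_elem_closed) auto

lemma U_scalar_add: "U_scalar n (c + d) = U_scalar n c \<oplus>\<^bsub>U_gl n\<^esub> U_scalar n d"
proof -
  have "scalar_elem (c + d) = scalar_elem c \<oplus>\<^bsub>gl_tensor_algebra n\<^esub> scalar_elem d"
    by (auto simp: gl_tensor_algebra_def)
  then show ?thesis unfolding U_scalar_def by (simp only: U_proj_add scalar_elem_closed)
qed

lemma U_scalar_mult: "U_scalar n (c * d) = U_scalar n c \<otimes>\<^bsub>U_gl n\<^esub> U_scalar n d"
proof -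
  have "scalar_elem (c * d) = scalar_elem c \<otimes>\<^bsub>gl_tensor_algebra n\<^esub> scalar_elem d"
    unfolding scalar_elem_mult_left by auto
  then show ?thesis unfolding U_scalar_def by (simp only: U_proj_mult scalar_elem_closed)
qed

lemma U_scalar_1: "U_scalar n 1 = \<one>\<^bsub>U_gl n\<^esub>"
  using ring_hom_one[OF U_proj_ring_hom, of n] by (simp add: U_scalar_def gl_tensor_algebra_def)

lemma U_scalar_0: "U_scalar n 0 = \<zero>\<^bsub>U_gl n\<^esub>"
proof -
  interpret U: ring "U_gl n" by (rule ring_U_gl)
  have "U_scalar n 0 \<oplus>\<^bsub>U_gl n\<^esub> U_scalar n 0 = U_scalar n 0"
    using U_scalar_add[of n 0 0] by simp
  then show ?thesis using U.add.l_cancel_one by simp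
qed

lemma U_scalar_central:
  assumes "u \<in> carrier (U_gl n)"
  shows "u \<otimes>\<^bsub>U_gl n\<^esub> U_scalar n c = U_scalar n c \<otimes>\<^bsub>U_gl n\<^esub> u"
proof -
  obtain p where p: "p \<in> carrier (gl_tensor_algebra n)" "u = U_proj n p"
    using assms unfolding carrier_U_gl by blast
  have "p \<otimes>\<^bsub>gl_tensor_algebra n\<^esub> scalar_elem c = scalar_elem c \<otimes>\<^bsub>gl_tensor_algebra n\<^esub> p"
    by (simp add: scalar_elem_mult_left scalar_elem_mult_right)
  then show ?thesis
    unfolding p(2) U_scalar_def using p(1) by (metis U_proj_mult scalar_elem_closed)
qed

lemma gl_tensor_induct [consumes 1, case_names single add]:
  assumes p: "p \<in> carrier (gl_tensor_algebra n)"
    and single: "\<And>c w. w \<in> lists ({1..n} \<times> {1..n}) \<Longrightarrow> P (\<lambda>v. c * word_elem w v)"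
    and add: "\<And>p q. p \<in> carrier (gl_tensor_algebra n) \<Longrightarrow> q \<in> carrier (gl_tensor_algebra n) \<Longrightarrow>
      P p \<Longrightarrow> P q \<Longrightarrow> P (p \<oplus>\<^bsub>gl_tensor_algebra n\<^esub> q)"
  shows "P p"
proof -
  have "P p" if "finite A" "p \<in> carrier (gl_tensor_algebra n)" "{w. p w \<noteq> 0} \<subseteq> A" for A p
    using that
  proof (induction A arbitrary: p)
    case empty
    then have "p = (\<lambda>v. 0 * word_elem [] v)" by auto
    then show ?case using single[of "[]" 0] by simp
  next
    case (insert w A)
    show ?case
    proof (cases "p w = 0")
      case True
      then have "{w. p w \<noteq> 0} \<subseteq> A" using insert.prems by auto
      then show ?thesis using insert by blast
    next
      case False
      then have w: "w \<in> lists ({1..n} \<times> {1..n})" using insert.prems by (auto simp: gl_tensor_algebra_def)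
      define q where "q = p(w := 0)"
      have sub: "{v. q v \<noteq> 0} \<subseteq> {v. p v \<noteq> 0}" by (auto simp: q_def)
      have fin: "finite {v. p v \<noteq> 0}" "{v. p v \<noteq> 0} \<subseteq> lists ({1..n} \<times> {1..n})"
        using insert.prems by (auto simp: gl_tensor_algebra_def)
      have q: "q \<in> carrier (gl_tensor_algebra n)"
        using finite_subset[OF sub fin(1)] subset_trans[OF sub fin(2)] by (simp add: gl_tensor_algebra_def)
      have "{v. q v \<noteq> 0} \<subseteq> A" using insert.prems by (auto simp: q_def)
      then have "P q" using insert.IH[OF q] by blast
      moreover have "(\<lambda>v. p w * word_elem w v) \<in> carrier (gl_tensor_algebra n)"
        using w False by (simp add: gl_tensor_algebra_def word_elem_def)
      moreover have "p = (\<lambda>v. p w * word_elem w v) \<oplus>\<^bsub>gl_tensor_algebra n\<^esub> q"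
        by (auto simp: gl_tensor_algebra_def word_elem_def q_def)
      ultimately show ?thesis using add[OF _ q single[OF w]] by metis
    qed
  qed
  from this[of "{w. p w \<noteq> 0}" p] p show ?thesis by (simp add: gl_tensor_algebra_def)
qed

text \<open>A word is built up by left multiplication with matrix units, so a property of the
  vectors \<open>u x\<close>, for fixed \<open>x\<close>, can be proved by applying one unit at a
  time.\<close>

lemma U_gl_induct [consumes 1, case_names one add scalar unit]:
  assumes u: "u \<in> carrier (U_gl n)"
    and one: "P \<one>\<^bsub>U_gl n\<^esub>"
    and add: "\<And>x y. x \<in> carrier (U_gl n) \<Longrightarrow> y \<in> carrier (U_gl n) \<Longrightarrow> P x \<Longrightarrow> P y \<Longrightarrow> P (x \<oplus>\<^bsub>U_gl n\<^esub> y)"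
    and scalar: "\<And>c x. x \<in> carrier (U_gl n) \<Longrightarrow> P x \<Longrightarrow> P (U_scalar n c \<otimes>\<^bsub>U_gl n\<^esub> x)"
    and unit: "\<And>i j x. x \<in> carrier (U_gl n) \<Longrightarrow> i \<in> {1..n} \<Longrightarrow> j \<in> {1..n} \<Longrightarrow> P x \<Longrightarrow>
      P (U_unit n i j \<otimes>\<^bsub>U_gl n\<^esub> x)"
  shows "P u"
proof -
  have word: "P (U_proj n (word_elem w))" if "w \<in> lists ({1..n} \<times> {1..n})" for w
    using that
  proof (induction w)
    case Nil
    have "word_elem [] = \<one>\<^bsub>gl_tensor_algebra n\<^esub>" by (simp add: word_elem_def gl_tensor_algebra_def)
    then show ?case using one ring_hom_one[OF U_proj_ring_hom, of n] by simp
  next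
    case (Cons x w)
    obtain i j where x: "x = (i, j)" by (cases x)
    have w: "w \<in> lists ({1..n} \<times> {1..n})" and ij: "i \<in> {1..n}" "j \<in> {1..n}" using Cons.hyps x by auto
    have "U_proj n (word_elem (x # w)) = U_unit n i j \<otimes>\<^bsub>U_gl n\<^esub> U_proj n (word_elem w)"
      unfolding U_unit_def using w ij word_elem_mult[where u = "[x]" and v = w and n = n] x
      by (subst U_proj_mult[symmetric]) (auto intro!: word_elem_closed)
    then show ?case
      using unit[OF U_proj_closed[OF word_elem_closed[OF w]] ij] Cons.IH by simp
  qed
  obtain p where p: "p \<in> carrier (gl_tensor_algebra n)" "u = U_proj n p"
    using u unfolding carrier_U_gl by blast
  from p(1) have "P (U_proj n p)"
  proof (induction p rule: gl_tensor_induct)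
    case (single c w)
    have "U_proj n (\<lambda>v. c * word_elem w v) = U_scalar n c \<otimes>\<^bsub>U_gl n\<^esub> U_proj n (word_elem w)"
      unfolding U_scalar_def scalar_elem_mult_left[where c = c and n = n and p = "word_elem w", symmetric]
      using word_elem_closed[OF single] by (intro U_proj_mult) auto
    then show ?case using scalar[OF U_proj_closed[OF word_elem_closed[OF single]] word[OF single]] by simp
  next
    case (add p q)
    then show ?case using assms(3)[OF U_proj_closed U_proj_closed] by (simp add: U_proj_add)
  qed
  then show ?thesis by (simp add: p(2))
qed

text \<open>The image of \<open>gl_relation\<close> vanishes in the quotient. Structure constants
  are kept as scalars of \<open>U_gl n\<close>, so that one identity covers all coincidences of
  indices.\<close>

lemma U_unit_commutator:
  assumes ij: "i \<in> {1..n}" "j \<in> {1..n}" and kl: "k \<in> {1..n}" "l \<in> {1..n}"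
  shows "U_unit n i j \<otimes>\<^bsub>U_gl n\<^esub> U_unit n k l = U_unit n k l \<otimes>\<^bsub>U_gl n\<^esub> U_unit n i j \<oplus>\<^bsub>U_gl n\<^esub>
     (U_scalar n (if j = k then 1 else 0) \<otimes>\<^bsub>U_gl n\<^esub> U_unit n i l \<oplus>\<^bsub>U_gl n\<^esub>
      U_scalar n (if l = i then - 1 else 0) \<otimes>\<^bsub>U_gl n\<^esub> U_unit n k j)"
proof -
  let ?T = "gl_tensor_algebra n"
  interpret U: ring "U_gl n" by (rule ring_U_gl)
  interpret T: ring ?T by (rule ring_gl_tensor_algebra)
  interpret I: ideal "gl_ideal n" ?T by (rule ideal_gl_ideal)
  have rel: "gl_relation i j k l \<in> gl_ideal n"
    unfolding gl_ideal_def
    by (rule subsetD[OF T.genideal_self]) (use gl_relation_closed assms in blast)+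
  have word: "word_elem [(a, b)] \<in> carrier ?T" if "a \<in> {1..n}" "b \<in> {1..n}" for a b
    using that by (intro word_elem_closed) auto
  define d1 where "d1 = (if j = k then 1 else 0 :: complex)"
  define d2 where "d2 = (if l = i then - 1 else 0 :: complex)"
  have eq: "word_elem [(i, j)] \<otimes>\<^bsub>?T\<^esub> word_elem [(k, l)] =
      gl_relation i j k l \<oplus>\<^bsub>?T\<^esub> (word_elem [(k, l)] \<otimes>\<^bsub>?T\<^esub> word_elem [(i, j)] \<oplus>\<^bsub>?T\<^esub>
        (scalar_elem d1 \<otimes>\<^bsub>?T\<^esub> word_elem [(i, l)] \<oplus>\<^bsub>?T\<^esub> scalar_elem d2 \<otimes>\<^bsub>?T\<^esub> word_elem [(k, j)]))"
    unfolding word_elem_mult scalar_elem_mult_left gl_relation_def d1_def d2_def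
    by (simp add: gl_tensor_algebra_def fun_eq_iff)
  have "U_unit n i j \<otimes>\<^bsub>U_gl n\<^esub> U_unit n k l = U_proj n (word_elem [(i, j)] \<otimes>\<^bsub>?T\<^esub> word_elem [(k, l)])"
    unfolding U_unit_def using assms by (simp add: U_proj_mult word)
  also have "\<dots> = U_proj n (gl_relation i j k l) \<oplus>\<^bsub>U_gl n\<^esub>
      (U_unit n k l \<otimes>\<^bsub>U_gl n\<^esub> U_unit n i j \<oplus>\<^bsub>U_gl n\<^esub>
        (U_scalar n d1 \<otimes>\<^bsub>U_gl n\<^esub> U_unit n i l \<oplus>\<^bsub>U_gl n\<^esub> U_scalar n d2 \<otimes>\<^bsub>U_gl n\<^esub> U_unit n k j))"
    unfolding eq U_unit_def U_scalar_def
    using I.a_subset rel word[OF ij] word[OF kl] word[OF ij(1) kl(2)] word[OF kl(1) ij(2)]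
    by (simp add: U_proj_add U_proj_mult T.m_closed T.a_closed subset_iff)
  also have "U_proj n (gl_relation i j k l) = \<zero>\<^bsub>U_gl n\<^esub>" by (rule U_proj_ideal[OF rel])
  finally show ?thesis
    using assms by (simp add: U_unit_closed d1_def d2_def)
qed


subsection \<open>Lowering elements\<close>

text \<open>The subalgebra generated by the strictly lower triangular units, built by left
  multiplication to match the order in which units act on a vector.\<close>

inductive_set U_low :: "nat \<Rightarrow> env_elem set" for n where
  one: "\<one>\<^bsub>U_gl n\<^esub> \<in> U_low n"
| add: "x \<in> U_low n \<Longrightarrow> y \<in> U_low n \<Longrightarrow> x \<oplus>\<^bsub>U_gl n\<^esub> y \<in> U_low n"
| scalar: "x \<in> U_low n \<Longrightarrow> U_scalar n c \<otimes>\<^bsub>U_gl n\<^esub> x \<in> U_low n"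
| unit: "x \<in> U_low n \<Longrightarrow> i \<in> {1..n} \<Longrightarrow> j \<in> {1..n} \<Longrightarrow> j < i \<Longrightarrow> U_unit n i j \<otimes>\<^bsub>U_gl n\<^esub> x \<in> U_low n"

text \<open>Up to scalars, the sums of products that begin with a lowering unit; this first factor
  is what the grading and the orthogonality arguments exploit.\<close>

inductive_set U_strictly_low :: "nat \<Rightarrow> env_elem set" for n where
  zero: "\<zero>\<^bsub>U_gl n\<^esub> \<in> U_strictly_low n"
| add: "x \<in> U_strictly_low n \<Longrightarrow> y \<in> U_strictly_low n \<Longrightarrow> x \<oplus>\<^bsub>U_gl n\<^esub> y \<in> U_strictly_low n"
| scalar: "x \<in> U_strictly_low n \<Longrightarrow> U_scalar n c \<otimes>\<^bsub>U_gl n\<^esub> x \<in> U_strictly_low n"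
| unit: "x \<in> U_strictly_low n \<Longrightarrow> i \<in> {1..n} \<Longrightarrow> j \<in> {1..n} \<Longrightarrow> j < i \<Longrightarrow>
    U_unit n i j \<otimes>\<^bsub>U_gl n\<^esub> (U_scalar n c \<oplus>\<^bsub>U_gl n\<^esub> x) \<in> U_strictly_low n"

context
  fixes n :: nat
begin

interpretation U: ring "U_gl n" by (rule ring_U_gl)

lemma U_low_closed: "x \<in> U_low n \<Longrightarrow> x \<in> carrier (U_gl n)"
  by (induction rule: U_low.induct) (auto intro!: U.a_closed U.m_closed U_unit_closed)

lemma U_strictly_low_closed: "x \<in> U_strictly_low n \<Longrightarrow> x \<in> carrier (U_gl n)"
  by (induction rule: U_strictly_low.induct) (auto intro!: U.a_closed U.m_closed U_unit_closed)

text \<open>The scalar is a constant term, for which only existence is claimed; on highest weight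
  vectors \<open>hw_lower_independent\<close> shows that it is determined.\<close>

lemma U_low_decompose:
  assumes "x \<in> U_low n"
  obtains c q where "q \<in> U_strictly_low n" "x = U_scalar n c \<oplus>\<^bsub>U_gl n\<^esub> q"
proof -
  have "\<exists>c. \<exists>q\<in>U_strictly_low n. x = U_scalar n c \<oplus>\<^bsub>U_gl n\<^esub> q"
    using assms
  proof (induction rule: U_low.induct)
    case one
    then show ?case
      by (intro exI[of _ 1] bexI[of _ "\<zero>\<^bsub>U_gl n\<^esub>"]) (auto simp: U_scalar_1 intro: U_strictly_low.zero)
  next
    case (add x y)
    then obtain c q d r where q: "q \<in> U_strictly_low n" "x = U_scalar n c \<oplus>\<^bsub>U_gl n\<^esub> q"
      and r: "r \<in> U_strictly_low n" "y = U_scalar n d \<oplus>\<^bsub>U_gl n\<^esub> r" by blast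
    have "x \<oplus>\<^bsub>U_gl n\<^esub> y = U_scalar n (c + d) \<oplus>\<^bsub>U_gl n\<^esub> (q \<oplus>\<^bsub>U_gl n\<^esub> r)"
      using q r by (simp add: U_scalar_add U_strictly_low_closed U.a_ac)
    then show ?case using U_strictly_low.add[OF q(1) r(1)] by blast
  next
    case (scalar x a)
    then obtain c q where q: "q \<in> U_strictly_low n" "x = U_scalar n c \<oplus>\<^bsub>U_gl n\<^esub> q" by blast
    then have "U_scalar n a \<otimes>\<^bsub>U_gl n\<^esub> x = U_scalar n (a * c) \<oplus>\<^bsub>U_gl n\<^esub> U_scalar n a \<otimes>\<^bsub>U_gl n\<^esub> q"
      by (simp add: U_scalar_mult U_strictly_low_closed U.r_distr)
    then show ?case using U_strictly_low.scalar[OF q(1)] by blast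
  next
    case (unit x i j)
    then obtain c q where q: "q \<in> U_strictly_low n" "x = U_scalar n c \<oplus>\<^bsub>U_gl n\<^esub> q" by blast
    have low: "U_unit n i j \<otimes>\<^bsub>U_gl n\<^esub> x \<in> U_strictly_low n"
      unfolding q(2) using q(1) unit by (intro U_strictly_low.unit)
    then have "U_unit n i j \<otimes>\<^bsub>U_gl n\<^esub> x = U_scalar n 0 \<oplus>\<^bsub>U_gl n\<^esub> U_unit n i j \<otimes>\<^bsub>U_gl n\<^esub> x"
      by (simp add: U_scalar_0 U_strictly_low_closed)
    then show ?case using low by blast
  qed
  then show ?thesis using that by blast
qed

text \<open>A left ideal \<open>J\<close> as below annihilates highest weight vectors of weight \<open>\<mu>\<close>; modulo \<open>J\<close>, the
  lowering operators suffice.\<close>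

lemma U_gl_low_plus_ideal:
  assumes J_sub: "J \<subseteq> carrier (U_gl n)"
    and J_zero: "\<zero>\<^bsub>U_gl n\<^esub> \<in> J"
    and J_add: "\<And>x y. x \<in> J \<Longrightarrow> y \<in> J \<Longrightarrow> x \<oplus>\<^bsub>U_gl n\<^esub> y \<in> J"
    and J_mult: "\<And>u x. u \<in> carrier (U_gl n) \<Longrightarrow> x \<in> J \<Longrightarrow> u \<otimes>\<^bsub>U_gl n\<^esub> x \<in> J"
    and J_upper: "\<And>i j. i \<in> {1..n} \<Longrightarrow> j \<in> {1..n} \<Longrightarrow> i < j \<Longrightarrow> U_unit n i j \<in> J"
    and J_diag: "\<And>i. i \<in> {1..n} \<Longrightarrow> U_unit n i i \<oplus>\<^bsub>U_gl n\<^esub> U_scalar n (- \<mu> i) \<in> J"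
    and u: "u \<in> carrier (U_gl n)"
  shows "\<exists>x\<in>U_low n. \<exists>y\<in>J. u = x \<oplus>\<^bsub>U_gl n\<^esub> y"
proof -
  define L where "L = {x \<oplus>\<^bsub>U_gl n\<^esub> y | x y. x \<in> U_low n \<and> y \<in> J}"
  have J_closed: "y \<in> carrier (U_gl n)" if "y \<in> J" for y using that J_sub by blast
  have L_low: "x \<in> L" if "x \<in> U_low n" for x
  proof -
    have "x = x \<oplus>\<^bsub>U_gl n\<^esub> \<zero>\<^bsub>U_gl n\<^esub>" using that by (simp add: U_low_closed)
    then show ?thesis using that J_zero unfolding L_def by blast
  qed
  have zero_low: "\<zero>\<^bsub>U_gl n\<^esub> \<in> U_low n"
    using U_low.scalar[OF U_low.one, of n 0] by (simp add: U_scalar_0)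
  have L_J: "y \<in> L" if "y \<in> J" for y
  proof -
    have "y = \<zero>\<^bsub>U_gl n\<^esub> \<oplus>\<^bsub>U_gl n\<^esub> y" using that by (simp add: J_closed)
    then show ?thesis using that zero_low unfolding L_def by blast
  qed
  have L_closed: "x \<in> carrier (U_gl n)" if "x \<in> L" for x
    using that unfolding L_def by (auto intro: U_low_closed J_closed)
  have L_add: "x \<oplus>\<^bsub>U_gl n\<^esub> y \<in> L" if xy: "x \<in> L" "y \<in> L" for x y
  proof -
    obtain a b c d where a: "a \<in> U_low n" "b \<in> J" "x = a \<oplus>\<^bsub>U_gl n\<^esub> b"
      and c: "c \<in> U_low n" "d \<in> J" "y = c \<oplus>\<^bsub>U_gl n\<^esub> d"
      using xy unfolding L_def by blast
    have "x \<oplus>\<^bsub>U_gl n\<^esub> y = (a \<oplus>\<^bsub>U_gl n\<^esub> c) \<oplus>\<^bsub>U_gl n\<^esub> (b \<oplus>\<^bsub>U_gl n\<^esub> d)"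
      using a c by (simp add: U_low_closed J_closed U.a_ac)
    then show ?thesis using U_low.add[OF a(1) c(1)] J_add[OF a(2) c(2)] unfolding L_def by blast
  qed
  have L_scalar: "U_scalar n a \<otimes>\<^bsub>U_gl n\<^esub> x \<in> L" if x: "x \<in> L" for a x
  proof -
    obtain b c where b: "b \<in> U_low n" "c \<in> J" "x = b \<oplus>\<^bsub>U_gl n\<^esub> c"
      using x unfolding L_def by blast
    then have "U_scalar n a \<otimes>\<^bsub>U_gl n\<^esub> x = U_scalar n a \<otimes>\<^bsub>U_gl n\<^esub> b \<oplus>\<^bsub>U_gl n\<^esub> U_scalar n a \<otimes>\<^bsub>U_gl n\<^esub> c"
      by (simp add: U_low_closed J_closed U.r_distr)
    then show ?thesis
      using U_low.scalar[OF b(1)] J_mult[OF U_scalar_closed b(2)] unfolding L_def by blast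
  qed
  have L_lower: "U_unit n i j \<otimes>\<^bsub>U_gl n\<^esub> x \<in> L" if x: "x \<in> L" and ij: "i \<in> {1..n}" "j \<in> {1..n}" "j < i" for x i j
  proof -
    obtain b c where b: "b \<in> U_low n" "c \<in> J" "x = b \<oplus>\<^bsub>U_gl n\<^esub> c"
      using x unfolding L_def by blast
    then have "U_unit n i j \<otimes>\<^bsub>U_gl n\<^esub> x = U_unit n i j \<otimes>\<^bsub>U_gl n\<^esub> b \<oplus>\<^bsub>U_gl n\<^esub> U_unit n i j \<otimes>\<^bsub>U_gl n\<^esub> c"
      using ij by (simp add: U_low_closed J_closed U.r_distr U_unit_closed)
    then show ?thesis
      using U_low.unit[OF b(1) ij] J_mult[OF U_unit_closed[OF ij(1,2)] b(2)] unfolding L_def by blast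
  qed
  \<comment> \<open>The heart of the argument: every matrix unit, not only the lowering ones, sends
    \<open>U_low n\<close> into \<open>L\<close>.\<close>
  have unit_low: "\<forall>i\<in>{1..n}. \<forall>j\<in>{1..n}. U_unit n i j \<otimes>\<^bsub>U_gl n\<^esub> x \<in> L" if "x \<in> U_low n" for x
    using that
  proof (induction rule: U_low.induct)
    case one
    show ?case
    proof (intro ballI)
      fix i j assume ij: "i \<in> {1..n}" "j \<in> {1..n}"
      note closed = U_unit_closed[OF ij]
      consider "i < j" | "i = j" | "j < i" by linarith
      then show "U_unit n i j \<otimes>\<^bsub>U_gl n\<^esub> \<one>\<^bsub>U_gl n\<^esub> \<in> L"
      proof cases
        case 1
        then show ?thesis using L_J[OF J_upper[OF ij]] closed by simp
      next
        \<comment> \<open>\<open>E_ii\<close> is the scalar \<open>\<mu> i\<close> plus an element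
          of \<open>J\<close>.\<close>
        case 2
        have "U_scalar n (\<mu> i) \<otimes>\<^bsub>U_gl n\<^esub> \<one>\<^bsub>U_gl n\<^esub> \<in> L"
          by (intro L_low U_low.scalar U_low.one)
        from L_add[OF this L_J[OF J_diag[OF ij(1)]]]
        have "U_scalar n (\<mu> i) \<oplus>\<^bsub>U_gl n\<^esub> (U_unit n i i \<oplus>\<^bsub>U_gl n\<^esub> U_scalar n (- \<mu> i)) \<in> L" by simp
        also have "U_scalar n (\<mu> i) \<oplus>\<^bsub>U_gl n\<^esub> (U_unit n i i \<oplus>\<^bsub>U_gl n\<^esub> U_scalar n (- \<mu> i)) =
            U_unit n i i \<oplus>\<^bsub>U_gl n\<^esub> U_scalar n (\<mu> i + - \<mu> i)"
          using closed 2 by (simp only: U_scalar_add U.a_lcomm U_scalar_closed)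
        also have "\<dots> = U_unit n i i" using closed 2 by (simp add: U_scalar_0)
        finally show ?thesis using closed 2 by simp
      next
        case 3
        then show ?thesis using L_lower[OF L_low[OF U_low.one] ij] by simp
      qed
    qed
  next
    case (add x y)
    then show ?case by (auto simp: U.r_distr U_unit_closed U_low_closed intro!: L_add)
  next
    case (scalar x c)
    show ?case
    proof (intro ballI)
      fix i j assume ij: "i \<in> {1..n}" "j \<in> {1..n}"
      have "U_unit n i j \<otimes>\<^bsub>U_gl n\<^esub> (U_scalar n c \<otimes>\<^bsub>U_gl n\<^esub> x) =
          U_scalar n c \<otimes>\<^bsub>U_gl n\<^esub> (U_unit n i j \<otimes>\<^bsub>U_gl n\<^esub> x)"
        using U_unit_closed[OF ij] U_low_closed[OF scalar.hyps]
        by (simp add: U.m_assoc[symmetric] U_scalar_central)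
      then show "U_unit n i j \<otimes>\<^bsub>U_gl n\<^esub> (U_scalar n c \<otimes>\<^bsub>U_gl n\<^esub> x) \<in> L"
        using scalar.IH ij by (simp add: L_scalar)
    qed
  next
    case (unit x k l)
    show ?case
    proof (intro ballI)
      fix i j assume ij: "i \<in> {1..n}" "j \<in> {1..n}"
      define a where "a = (if j = k then 1 else 0 :: complex)"
      define b where "b = (if l = i then - 1 else 0 :: complex)"
      have x: "x \<in> carrier (U_gl n)" using unit.hyps(1) by (rule U_low_closed)
      \<comment> \<open>\<open>E_ij\<close> is moved to the right of the lowering unit
        \<open>E_kl\<close>. The commutator is a combination of units applied to the shorter element
        \<open>x\<close>, which the induction hypothesis covers.\<close>
      have "U_unit n i j \<otimes>\<^bsub>U_gl n\<^esub> (U_unit n k l \<otimes>\<^bsub>U_gl n\<^esub> x) =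
          (U_unit n i j \<otimes>\<^bsub>U_gl n\<^esub> U_unit n k l) \<otimes>\<^bsub>U_gl n\<^esub> x"
        using ij unit.hyps x by (simp add: U.m_assoc U_unit_closed)
      also have "\<dots> = U_unit n k l \<otimes>\<^bsub>U_gl n\<^esub> (U_unit n i j \<otimes>\<^bsub>U_gl n\<^esub> x) \<oplus>\<^bsub>U_gl n\<^esub>
        (U_scalar n a \<otimes>\<^bsub>U_gl n\<^esub> (U_unit n i l \<otimes>\<^bsub>U_gl n\<^esub> x) \<oplus>\<^bsub>U_gl n\<^esub>
         U_scalar n b \<otimes>\<^bsub>U_gl n\<^esub> (U_unit n k j \<otimes>\<^bsub>U_gl n\<^esub> x))"
        unfolding U_unit_commutator[OF ij unit.hyps(2,3)] a_def[symmetric] b_def[symmetric]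
        using ij unit.hyps x by (simp add: U.m_assoc U_unit_closed U.l_distr)
      also have "\<dots> \<in> L"
        using unit.IH ij unit.hyps by (intro L_add L_scalar L_lower[OF _ unit.hyps(2-4)]) auto
      finally show "U_unit n i j \<otimes>\<^bsub>U_gl n\<^esub> (U_unit n k l \<otimes>\<^bsub>U_gl n\<^esub> x) \<in> L" .
    qed
  qed
  from u have "u \<in> L"
  proof (induction rule: U_gl_induct)
    case (unit i j x)
    obtain b c where b: "b \<in> U_low n" "c \<in> J" "x = b \<oplus>\<^bsub>U_gl n\<^esub> c"
      using unit.IH unfolding L_def by blast
    then have "U_unit n i j \<otimes>\<^bsub>U_gl n\<^esub> x = U_unit n i j \<otimes>\<^bsub>U_gl n\<^esub> b \<oplus>\<^bsub>U_gl n\<^esub> U_unit n i j \<otimes>\<^bsub>U_gl n\<^esub> c"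
      using unit.hyps by (simp add: U_low_closed J_closed U.r_distr U_unit_closed)
    then show ?case
      using unit_low[OF b(1)] unit.hyps L_J[OF J_mult[OF U_unit_closed b(2)]] by (simp add: L_add)
  qed (auto intro: L_low U_low.one L_add L_scalar)
  then show ?thesis unfolding L_def by blast
qed

end

subsection \<open>Uniqueness of irreducible highest weight modules\<close>

context left_module
begin

lemma smult_r_zero [simp]: "a \<in> carrier R \<Longrightarrow> a \<odot>\<^bsub>M\<^esub> \<zero>\<^bsub>M\<^esub> = \<zero>\<^bsub>M\<^esub>"
  using smult_r_distr[of a "\<zero>\<^bsub>M\<^esub>" "\<zero>\<^bsub>M\<^esub>"] M.add.l_cancel_one[of "a \<odot>\<^bsub>M\<^esub> \<zero>\<^bsub>M\<^esub>" "a \<odot>\<^bsub>M\<^esub> \<zero>\<^bsub>M\<^esub>"]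
  by (simp add: smult_closed)

lemma smult_l_zero [simp]: "x \<in> carrier M \<Longrightarrow> \<zero>\<^bsub>R\<^esub> \<odot>\<^bsub>M\<^esub> x = \<zero>\<^bsub>M\<^esub>"
  using smult_l_distr[of "\<zero>\<^bsub>R\<^esub>" "\<zero>\<^bsub>R\<^esub>" x] M.add.l_cancel_one[of "\<zero>\<^bsub>R\<^esub> \<odot>\<^bsub>M\<^esub> x" "\<zero>\<^bsub>R\<^esub> \<odot>\<^bsub>M\<^esub> x"]
  by (simp add: smult_closed)

lemma smult_l_minus:
  assumes "a \<in> carrier R" "x \<in> carrier M"
  shows "(\<ominus>\<^bsub>R\<^esub> a) \<odot>\<^bsub>M\<^esub> x = \<ominus>\<^bsub>M\<^esub> (a \<odot>\<^bsub>M\<^esub> x)"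
proof -
  have "(\<ominus>\<^bsub>R\<^esub> a) \<odot>\<^bsub>M\<^esub> x \<oplus>\<^bsub>M\<^esub> a \<odot>\<^bsub>M\<^esub> x = \<zero>\<^bsub>M\<^esub>"
    using assms by (simp add: smult_l_distr[symmetric] R.l_neg)
  then show ?thesis using assms by (simp add: M.minus_equality smult_closed)
qed

lemma smult_diff_eq_zero_iff:
  assumes "a \<in> carrier R" "b \<in> carrier R" "x \<in> carrier M"
  shows "(a \<oplus>\<^bsub>R\<^esub> (\<ominus>\<^bsub>R\<^esub> b)) \<odot>\<^bsub>M\<^esub> x = \<zero>\<^bsub>M\<^esub> \<longleftrightarrow> a \<odot>\<^bsub>M\<^esub> x = b \<odot>\<^bsub>M\<^esub> x"
proof -
  have closed: "a \<odot>\<^bsub>M\<^esub> x \<in> carrier M" "b \<odot>\<^bsub>M\<^esub> x \<in> carrier M"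
    using assms by (simp_all add: smult_closed)
  have "a \<odot>\<^bsub>M\<^esub> x = b \<odot>\<^bsub>M\<^esub> x" if "a \<odot>\<^bsub>M\<^esub> x \<oplus>\<^bsub>M\<^esub> (\<ominus>\<^bsub>M\<^esub> (b \<odot>\<^bsub>M\<^esub> x)) = \<zero>\<^bsub>M\<^esub>"
    using M.minus_equality[OF that] closed by simp
  then show ?thesis
    using assms closed by (auto simp: smult_l_distr smult_l_minus M.r_neg)
qed

text \<open>Negatives come from multiplication by minus one.\<close>

lemma submoduleI_left:
  assumes "H \<subseteq> carrier M" "\<zero>\<^bsub>M\<^esub> \<in> H"
    and "\<And>x y. x \<in> H \<Longrightarrow> y \<in> H \<Longrightarrow> x \<oplus>\<^bsub>M\<^esub> y \<in> H"
    and smult: "\<And>a x. a \<in> carrier R \<Longrightarrow> x \<in> H \<Longrightarrow> a \<odot>\<^bsub>M\<^esub> x \<in> H"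
  shows "submodule H R M"
proof (intro submodule.intro subgroup.intro submodule_axioms.intro)
  fix x assume x: "x \<in> H"
  then have "(\<ominus>\<^bsub>R\<^esub> \<one>\<^bsub>R\<^esub>) \<odot>\<^bsub>M\<^esub> x \<in> H" by (intro smult) simp_all
  moreover have "x \<in> carrier M" using x assms(1) by blast
  ultimately have "\<ominus>\<^bsub>M\<^esub> x \<in> H" by (simp add: smult_l_minus smult_one)
  then show "inv\<^bsub>add_monoid M\<^esub> x \<in> H" by (simp add: a_inv_def)
qed (use assms in auto)

lemma submodule_cyclic:
  assumes x: "x \<in> carrier M"
  shows "submodule {a \<odot>\<^bsub>M\<^esub> x | a. a \<in> carrier R} R M"
proof (rule submoduleI_left)
  show "{a \<odot>\<^bsub>M\<^esub> x | a. a \<in> carrier R} \<subseteq> carrier M" using x by (auto intro: smult_closed)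
  show "\<zero>\<^bsub>M\<^esub> \<in> {a \<odot>\<^bsub>M\<^esub> x | a. a \<in> carrier R}"
    using x smult_l_zero[OF x] R.zero_closed by (metis (mono_tags, lifting) CollectI)
next
  fix y z assume "y \<in> {a \<odot>\<^bsub>M\<^esub> x | a. a \<in> carrier R}" "z \<in> {a \<odot>\<^bsub>M\<^esub> x | a. a \<in> carrier R}"
  then obtain a b where "a \<in> carrier R" "y = a \<odot>\<^bsub>M\<^esub> x" "b \<in> carrier R" "z = b \<odot>\<^bsub>M\<^esub> x" by blast
  then show "y \<oplus>\<^bsub>M\<^esub> z \<in> {a \<odot>\<^bsub>M\<^esub> x | a. a \<in> carrier R}"
    using x by (intro CollectI exI[of _ "a \<oplus>\<^bsub>R\<^esub> b"]) (simp add: smult_l_distr)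
next
  fix c y assume "c \<in> carrier R" "y \<in> {a \<odot>\<^bsub>M\<^esub> x | a. a \<in> carrier R}"
  then obtain a where "c \<in> carrier R" "a \<in> carrier R" "y = a \<odot>\<^bsub>M\<^esub> x" by blast
  then show "c \<odot>\<^bsub>M\<^esub> y \<in> {a \<odot>\<^bsub>M\<^esub> x | a. a \<in> carrier R}"
    using x by (intro CollectI exI[of _ "c \<otimes>\<^bsub>R\<^esub> a"]) (simp add: smult_assoc)
qed

end

lemma irreducible_module_cyclic:
  assumes M: "irreducible_module R M" and x: "x \<in> carrier M" "x \<noteq> \<zero>\<^bsub>M\<^esub>" and y: "y \<in> carrier M"
  obtains a where "a \<in> carrier R" "y = a \<odot>\<^bsub>M\<^esub> x"
proof -
  interpret left_module R M using M by (simp add: irreducible_module_def)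
  have "x = \<one>\<^bsub>R\<^esub> \<odot>\<^bsub>M\<^esub> x" using x by (simp add: smult_one)
  then have "{a \<odot>\<^bsub>M\<^esub> x | a. a \<in> carrier R} \<noteq> {\<zero>\<^bsub>M\<^esub>}"
    using x(2) R.one_closed by (metis (mono_tags, lifting) mem_Collect_eq singletonD)
  then have "{a \<odot>\<^bsub>M\<^esub> x | a. a \<in> carrier R} = carrier M"
    using M submodule_cyclic[OF x(1)] unfolding irreducible_module_def by blast
  then show ?thesis using y that by blast
qed

text \<open>At \<open>m = n\<close> this is the grading element, the sum of \<open>k E_kk\<close>,
  whose commutator with \<open>E_ij\<close> is \<open>(i - j) E_ij\<close>. The partial sums serve
  the induction that proves this.\<close>

primrec U_grade :: "nat \<Rightarrow> nat \<Rightarrow> env_elem" where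
  "U_grade n 0 = \<zero>\<^bsub>U_gl n\<^esub>"
| "U_grade n (Suc m) = U_grade n m \<oplus>\<^bsub>U_gl n\<^esub>
     (U_scalar n (of_nat (Suc m)) \<otimes>\<^bsub>U_gl n\<^esub> U_unit n (Suc m) (Suc m))"

text \<open>The grading element minus \<open>c\<close>, a linear factor that kills the vectors of
  grade \<open>c\<close>.\<close>

definition U_shift :: "nat \<Rightarrow> complex \<Rightarrow> env_elem" where
  "U_shift n c = U_grade n n \<oplus>\<^bsub>U_gl n\<^esub> U_scalar n (- c)"

context
  fixes n :: nat
begin

interpretation U: ring "U_gl n" by (rule ring_U_gl)

lemma U_grade_closed: "m \<le> n \<Longrightarrow> U_grade n m \<in> carrier (U_gl n)"
  by (induction m) (auto intro!: U.a_closed U.m_closed U_unit_closed simp: One_nat_def)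

lemma U_grade_unit:
  assumes ij: "i \<in> {1..n}" "j \<in> {1..n}" and m: "m \<le> n"
  shows "U_grade n m \<otimes>\<^bsub>U_gl n\<^esub> U_unit n i j = U_unit n i j \<otimes>\<^bsub>U_gl n\<^esub> U_grade n m \<oplus>\<^bsub>U_gl n\<^esub>
    U_scalar n ((if i \<le> m then of_nat i else 0) - (if j \<le> m then of_nat j else 0)) \<otimes>\<^bsub>U_gl n\<^esub> U_unit n i j"
  using m
proof (induction m)
  case 0
  then show ?case using ij by (simp add: U_scalar_0 U_unit_closed)
next
  case (Suc m)
  define k where "k = Suc m"
  have k: "k \<in> {1..n}" using Suc.prems by (simp add: k_def)
  define d where "d = (\<lambda>m. (if i \<le> m then of_nat i else 0) - (if j \<le> m then of_nat j else 0 :: complex))"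
  define \<delta> where "\<delta> = (if k = i then 1 else 0) - (if k = j then 1 else 0 :: complex)"
  let ?E = "U_unit n i j" and ?K = "U_unit n k k" and ?G = "U_grade n m"
  let ?s = "U_scalar n (of_nat k)"
  note closed [simp] = U_unit_closed[OF ij] U_unit_closed[OF k k] U_unit_closed[OF k ij(2)]
    U_unit_closed[OF ij(1) k]
  have G [simp]: "?G \<in> carrier (U_gl n)" using Suc.prems by (simp add: U_grade_closed)
  have "U_scalar n (if k = i then 1 else 0) \<otimes>\<^bsub>U_gl n\<^esub> U_unit n k j =
      U_scalar n (if k = i then 1 else 0) \<otimes>\<^bsub>U_gl n\<^esub> ?E"
    by (auto simp: U_scalar_0)
  moreover have "U_scalar n (if j = k then - 1 else 0) \<otimes>\<^bsub>U_gl n\<^esub> U_unit n i k =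
      U_scalar n (if j = k then - 1 else 0) \<otimes>\<^bsub>U_gl n\<^esub> ?E"
    by (auto simp: U_scalar_0)
  ultimately have KE: "?K \<otimes>\<^bsub>U_gl n\<^esub> ?E = ?E \<otimes>\<^bsub>U_gl n\<^esub> ?K \<oplus>\<^bsub>U_gl n\<^esub> U_scalar n \<delta> \<otimes>\<^bsub>U_gl n\<^esub> ?E"
    unfolding U_unit_commutator[OF k k ij] \<delta>_def diff_conv_add_uminus U_scalar_add
    by (simp add: U.l_distr)
  have "(?s \<otimes>\<^bsub>U_gl n\<^esub> ?K) \<otimes>\<^bsub>U_gl n\<^esub> ?E = ?s \<otimes>\<^bsub>U_gl n\<^esub> (?E \<otimes>\<^bsub>U_gl n\<^esub> ?K \<oplus>\<^bsub>U_gl n\<^esub> U_scalar n \<delta> \<otimes>\<^bsub>U_gl n\<^esub> ?E)"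
    by (simp add: U.m_assoc KE)
  also have "\<dots> = ?E \<otimes>\<^bsub>U_gl n\<^esub> (?s \<otimes>\<^bsub>U_gl n\<^esub> ?K) \<oplus>\<^bsub>U_gl n\<^esub> U_scalar n (of_nat k * \<delta>) \<otimes>\<^bsub>U_gl n\<^esub> ?E"
  proof -
    have "?s \<otimes>\<^bsub>U_gl n\<^esub> (?E \<otimes>\<^bsub>U_gl n\<^esub> ?K) = ?E \<otimes>\<^bsub>U_gl n\<^esub> (?s \<otimes>\<^bsub>U_gl n\<^esub> ?K)"
      by (simp add: U.m_assoc[symmetric] U_scalar_central)
    then show ?thesis by (simp add: U.r_distr U_scalar_mult U.m_assoc)
  qed
  finally have sKE: "(?s \<otimes>\<^bsub>U_gl n\<^esub> ?K) \<otimes>\<^bsub>U_gl n\<^esub> ?E =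
      ?E \<otimes>\<^bsub>U_gl n\<^esub> (?s \<otimes>\<^bsub>U_gl n\<^esub> ?K) \<oplus>\<^bsub>U_gl n\<^esub> U_scalar n (of_nat k * \<delta>) \<otimes>\<^bsub>U_gl n\<^esub> ?E" .
  have GE: "?G \<otimes>\<^bsub>U_gl n\<^esub> ?E = ?E \<otimes>\<^bsub>U_gl n\<^esub> ?G \<oplus>\<^bsub>U_gl n\<^esub> U_scalar n (d m) \<otimes>\<^bsub>U_gl n\<^esub> ?E"
    using Suc by (simp add: d_def)
  have d_Suc: "d (Suc m) = d m + of_nat k * \<delta>"
    by (auto simp: d_def \<delta>_def k_def le_Suc_eq)
  have GS: "U_grade n (Suc m) = ?G \<oplus>\<^bsub>U_gl n\<^esub> ?s \<otimes>\<^bsub>U_gl n\<^esub> ?K"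
    by (simp only: U_grade.simps k_def)
  then have "U_grade n (Suc m) \<otimes>\<^bsub>U_gl n\<^esub> ?E = (?G \<oplus>\<^bsub>U_gl n\<^esub> ?s \<otimes>\<^bsub>U_gl n\<^esub> ?K) \<otimes>\<^bsub>U_gl n\<^esub> ?E"
    by simp
  also have "\<dots> = ?G \<otimes>\<^bsub>U_gl n\<^esub> ?E \<oplus>\<^bsub>U_gl n\<^esub> (?s \<otimes>\<^bsub>U_gl n\<^esub> ?K) \<otimes>\<^bsub>U_gl n\<^esub> ?E"
    by (simp add: U.l_distr)
  also have "\<dots> = (?E \<otimes>\<^bsub>U_gl n\<^esub> ?G \<oplus>\<^bsub>U_gl n\<^esub> ?E \<otimes>\<^bsub>U_gl n\<^esub> (?s \<otimes>\<^bsub>U_gl n\<^esub> ?K)) \<oplus>\<^bsub>U_gl n\<^esub>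
      (U_scalar n (d m) \<otimes>\<^bsub>U_gl n\<^esub> ?E \<oplus>\<^bsub>U_gl n\<^esub> U_scalar n (of_nat k * \<delta>) \<otimes>\<^bsub>U_gl n\<^esub> ?E)"
    unfolding GE sKE by (simp add: U.a_ac)
  also have "\<dots> = ?E \<otimes>\<^bsub>U_gl n\<^esub> U_grade n (Suc m) \<oplus>\<^bsub>U_gl n\<^esub> U_scalar n (d (Suc m)) \<otimes>\<^bsub>U_gl n\<^esub> ?E"
    unfolding GS d_Suc U_scalar_add by (simp add: U.l_distr U.r_distr)
  finally show ?case by (simp add: d_def)
qed

lemma U_shift_closed: "U_shift n c \<in> carrier (U_gl n)"
  unfolding U_shift_def by (simp add: U_grade_closed)

text \<open>\<open>E_ij\<close> raises eigenvalues of the grading element by \<open>i - j\<close>,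
  so a root moves by this amount when the factor passes the unit.\<close>

lemma U_shift_unit:
  assumes ij: "i \<in> {1..n}" "j \<in> {1..n}"
  shows "U_shift n (c + (of_nat i - of_nat j)) \<otimes>\<^bsub>U_gl n\<^esub> U_unit n i j = U_unit n i j \<otimes>\<^bsub>U_gl n\<^esub> U_shift n c"
proof -
  note [simp] = U_unit_closed[OF ij] U_grade_closed[OF order_refl]
  have 1: "U_grade n n \<otimes>\<^bsub>U_gl n\<^esub> U_unit n i j = U_unit n i j \<otimes>\<^bsub>U_gl n\<^esub> U_grade n n \<oplus>\<^bsub>U_gl n\<^esub>
      U_scalar n (of_nat i - of_nat j) \<otimes>\<^bsub>U_gl n\<^esub> U_unit n i j"
    using U_grade_unit[OF ij order_refl] ij by simp
  have "U_shift n (c + (of_nat i - of_nat j)) \<otimes>\<^bsub>U_gl n\<^esub> U_unit n i j =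
      U_unit n i j \<otimes>\<^bsub>U_gl n\<^esub> U_grade n n \<oplus>\<^bsub>U_gl n\<^esub>
      (U_scalar n (of_nat i - of_nat j) \<oplus>\<^bsub>U_gl n\<^esub> U_scalar n (- (c + (of_nat i - of_nat j)))) \<otimes>\<^bsub>U_gl n\<^esub> U_unit n i j"
    unfolding U_shift_def by (simp add: U.l_distr 1 U.a_assoc)
  also have "U_scalar n (of_nat i - of_nat j) \<oplus>\<^bsub>U_gl n\<^esub> U_scalar n (- (c + (of_nat i - of_nat j))) = U_scalar n (- c)"
    by (simp add: U_scalar_add[symmetric])
  also have "U_unit n i j \<otimes>\<^bsub>U_gl n\<^esub> U_grade n n \<oplus>\<^bsub>U_gl n\<^esub> U_scalar n (- c) \<otimes>\<^bsub>U_gl n\<^esub> U_unit n i j =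
      U_unit n i j \<otimes>\<^bsub>U_gl n\<^esub> U_shift n c"
    unfolding U_shift_def by (simp add: U.r_distr U_scalar_central)
  finally show ?thesis .
qed

lemma U_shift_commute: "U_shift n c \<otimes>\<^bsub>U_gl n\<^esub> U_shift n d = U_shift n d \<otimes>\<^bsub>U_gl n\<^esub> U_shift n c"
proof -
  note [simp] = U_grade_closed[OF order_refl]
  have "U_scalar n (- c) \<otimes>\<^bsub>U_gl n\<^esub> U_scalar n (- d) = U_scalar n (- d) \<otimes>\<^bsub>U_gl n\<^esub> U_scalar n (- c)"
    by (rule U_scalar_central) simp
  then show ?thesis
    unfolding U_shift_def
    by (simp add: U.l_distr U.r_distr U.a_ac U_scalar_central[OF U_grade_closed[OF order_refl]])
qed

end

section \<open>Separating a highest weight vector from the vectors below it\<close>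

locale gl_hw_module = left_module "U_gl n" M for n :: nat and M :: "(env_elem, 'c) module" +
  fixes \<mu> :: "nat list" and v :: 'c
  assumes hw: "highest_weight_vector n \<mu> M v"
begin

lemma v_closed [simp]: "v \<in> carrier M" and v_nonzero: "v \<noteq> \<zero>\<^bsub>M\<^esub>"
  using hw by (simp_all add: highest_weight_vector_def)

lemma upper_v: "i \<in> {1..n} \<Longrightarrow> j \<in> {1..n} \<Longrightarrow> i < j \<Longrightarrow> U_unit n i j \<odot>\<^bsub>M\<^esub> v = \<zero>\<^bsub>M\<^esub>"
  using hw by (simp add: highest_weight_vector_def)

lemma diag_v: "i \<in> {1..n} \<Longrightarrow> U_unit n i i \<odot>\<^bsub>M\<^esub> v = U_scalar n (of_nat (part \<mu> i)) \<odot>\<^bsub>M\<^esub> v"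
  using hw by (simp add: highest_weight_vector_def)

lemma diag_shift_v:
  assumes i: "i \<in> {1..n}"
  shows "(U_unit n i i \<oplus>\<^bsub>U_gl n\<^esub> U_scalar n (- of_nat (part \<mu> i))) \<odot>\<^bsub>M\<^esub> v = \<zero>\<^bsub>M\<^esub>"
proof -
  have "(U_unit n i i \<oplus>\<^bsub>U_gl n\<^esub> U_scalar n (- of_nat (part \<mu> i))) \<odot>\<^bsub>M\<^esub> v =
      U_scalar n (of_nat (part \<mu> i)) \<odot>\<^bsub>M\<^esub> v \<oplus>\<^bsub>M\<^esub> U_scalar n (- of_nat (part \<mu> i)) \<odot>\<^bsub>M\<^esub> v"
    using i by (simp add: smult_l_distr U_unit_closed diag_v)
  also have "\<dots> = U_scalar n (of_nat (part \<mu> i) + - of_nat (part \<mu> i)) \<odot>\<^bsub>M\<^esub> v"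
    by (simp only: smult_l_distr[OF U_scalar_closed U_scalar_closed v_closed] U_scalar_add)
  finally show ?thesis by (simp add: U_scalar_0)
qed

definition grade :: complex where
  "grade = (\<Sum>k=1..n. of_nat k * of_nat (part \<mu> k))"

lemma U_grade_v:
  assumes "m \<le> n"
  shows "U_grade n m \<odot>\<^bsub>M\<^esub> v = U_scalar n (\<Sum>k=1..m. of_nat k * of_nat (part \<mu> k)) \<odot>\<^bsub>M\<^esub> v"
  using assms
proof (induction m)
  case (Suc m)
  have k: "Suc m \<in> {1..n}" using Suc.prems by simp
  have "U_grade n (Suc m) \<odot>\<^bsub>M\<^esub> v = U_grade n m \<odot>\<^bsub>M\<^esub> v \<oplus>\<^bsub>M\<^esub>
      U_scalar n (of_nat (Suc m)) \<odot>\<^bsub>M\<^esub> (U_unit n (Suc m) (Suc m) \<odot>\<^bsub>M\<^esub> v)"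
    using Suc.prems U_unit_closed[OF k k]
    by (simp add: smult_l_distr smult_assoc U_grade_closed R.m_closed del: of_nat_Suc)
  also have "\<dots> = U_scalar n ((\<Sum>k=1..m. of_nat k * of_nat (part \<mu> k)) + of_nat (Suc m) * of_nat (part \<mu> (Suc m))) \<odot>\<^bsub>M\<^esub> v"
    using Suc diag_v[OF k]
    by (simp add: U_scalar_add U_scalar_mult smult_l_distr smult_assoc R.m_closed del: of_nat_Suc)
  finally show ?case by (simp add: One_nat_def del: of_nat_Suc)
qed (simp add: U_scalar_0)

lemma U_shift_v: "U_shift n c \<odot>\<^bsub>M\<^esub> v = U_scalar n (grade - c) \<odot>\<^bsub>M\<^esub> v"
  unfolding U_shift_def diff_conv_add_uminus U_scalar_add
  using U_grade_v[OF order_refl] by (simp add: smult_l_distr U_grade_closed grade_def)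

text \<open>A polynomial in the grading element, given by the list of its roots, applied to
  \<open>x\<close>.\<close>

definition shifts :: "complex list \<Rightarrow> 'c \<Rightarrow> 'c" where
  "shifts cs x = foldr (\<lambda>c y. U_shift n c \<odot>\<^bsub>M\<^esub> y) cs x"

lemma shifts_Nil [simp]: "shifts [] x = x"
  and shifts_Cons [simp]: "shifts (c # cs) x = U_shift n c \<odot>\<^bsub>M\<^esub> shifts cs x"
  by (simp_all add: shifts_def)

lemma shifts_closed [simp]: "x \<in> carrier M \<Longrightarrow> shifts cs x \<in> carrier M"
  by (induction cs) (simp_all add: smult_closed U_shift_closed)

lemma shifts_zero [simp]: "shifts cs \<zero>\<^bsub>M\<^esub> = \<zero>\<^bsub>M\<^esub>"
  by (induction cs) (simp_all add: U_shift_closed)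

lemma shifts_add:
  "x \<in> carrier M \<Longrightarrow> y \<in> carrier M \<Longrightarrow> shifts cs (x \<oplus>\<^bsub>M\<^esub> y) = shifts cs x \<oplus>\<^bsub>M\<^esub> shifts cs y"
  by (induction cs) (simp_all add: smult_r_distr U_shift_closed)

lemma shifts_scalar:
  "x \<in> carrier M \<Longrightarrow> shifts cs (U_scalar n a \<odot>\<^bsub>M\<^esub> x) = U_scalar n a \<odot>\<^bsub>M\<^esub> shifts cs x"
  by (induction cs)
    (simp_all add: smult_assoc[symmetric] U_shift_closed U_scalar_central)

lemma shifts_shift:
  "x \<in> carrier M \<Longrightarrow> shifts cs (U_shift n d \<odot>\<^bsub>M\<^esub> x) = U_shift n d \<odot>\<^bsub>M\<^esub> shifts cs x"
  by (induction cs)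
    (simp_all add: smult_assoc[symmetric] U_shift_closed U_shift_commute[of n _ d])

lemma shifts_append: "shifts (cs @ ds) x = shifts cs (shifts ds x)"
  by (simp add: shifts_def)

lemma shifts_commute:
  "x \<in> carrier M \<Longrightarrow> shifts cs (shifts ds x) = shifts ds (shifts cs x)"
  by (induction ds) (simp_all add: shifts_shift)

lemma shifts_unit:
  assumes "x \<in> carrier M" "i \<in> {1..n}" "j \<in> {1..n}"
  shows "shifts (map (\<lambda>c. c + (of_nat i - of_nat j)) cs) (U_unit n i j \<odot>\<^bsub>M\<^esub> x) =
    U_unit n i j \<odot>\<^bsub>M\<^esub> shifts cs x"
  using assms
  by (induction cs)
    (simp_all add: smult_assoc[symmetric] U_shift_closed U_unit_closed U_shift_unit)

lemma shifts_v: "shifts cs v = U_scalar n (\<Prod>c\<leftarrow>cs. grade - c) \<odot>\<^bsub>M\<^esub> v"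
proof (induction cs)
  case Nil
  then show ?case by (simp add: U_scalar_1 smult_one)
next
  case (Cons c cs)
  have "shifts (c # cs) v = U_scalar n (\<Prod>c\<leftarrow>cs. grade - c) \<odot>\<^bsub>M\<^esub> (U_shift n c \<odot>\<^bsub>M\<^esub> v)"
    using Cons.IH by (simp add: smult_assoc[symmetric] U_shift_closed U_scalar_central)
  also have "\<dots> = U_scalar n ((\<Prod>c\<leftarrow>cs. grade - c) * (grade - c)) \<odot>\<^bsub>M\<^esub> v"
    unfolding U_shift_v U_scalar_mult by (simp add: smult_assoc)
  finally show ?case by (simp add: mult.commute)
qed

text \<open>A lowering unit \<open>E_ij\<close>, \<open>j < i\<close>, raises the eigenvalue of the
  grading element by \<open>i - j \<ge> 1\<close>. So \<open>q v\<close> is killed by a polynomial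
  in that element all of whose roots exceed the grade of \<open>v\<close>; it is built along
  \<open>q\<close>, without decomposing the module into weight spaces.\<close>

lemma strictly_low_annihilated:
  assumes "q \<in> U_strictly_low n"
  shows "\<exists>cs. (\<forall>c\<in>set cs. \<exists>k\<ge>1. c = grade + of_nat k) \<and> shifts cs (q \<odot>\<^bsub>M\<^esub> v) = \<zero>\<^bsub>M\<^esub>"
  using assms
proof (induction rule: U_strictly_low.induct)
  case zero
  then show ?case by (intro exI[of _ "[]"]) simp
next
  case (add x y)
  then obtain cs ds where cs: "\<forall>c\<in>set cs. \<exists>k\<ge>1. c = grade + of_nat k" "shifts cs (x \<odot>\<^bsub>M\<^esub> v) = \<zero>\<^bsub>M\<^esub>"
    and ds: "\<forall>c\<in>set ds. \<exists>k\<ge>1. c = grade + of_nat k" "shifts ds (y \<odot>\<^bsub>M\<^esub> v) = \<zero>\<^bsub>M\<^esub>" by blast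
  note [simp] = add.hyps[THEN U_strictly_low_closed]
  have "shifts (cs @ ds) ((x \<oplus>\<^bsub>U_gl n\<^esub> y) \<odot>\<^bsub>M\<^esub> v) =
      shifts ds (shifts cs (x \<odot>\<^bsub>M\<^esub> v)) \<oplus>\<^bsub>M\<^esub> shifts cs (shifts ds (y \<odot>\<^bsub>M\<^esub> v))"
    by (simp add: smult_l_distr shifts_append shifts_add smult_closed shifts_commute[of "x \<odot>\<^bsub>M\<^esub> v"])
  then show ?case using cs ds by (intro exI[of _ "cs @ ds"]) auto
next
  case (scalar x a)
  then obtain cs where cs: "\<forall>c\<in>set cs. \<exists>k\<ge>1. c = grade + of_nat k" "shifts cs (x \<odot>\<^bsub>M\<^esub> v) = \<zero>\<^bsub>M\<^esub>" by blast
  then have "shifts cs ((U_scalar n a \<otimes>\<^bsub>U_gl n\<^esub> x) \<odot>\<^bsub>M\<^esub> v) = \<zero>\<^bsub>M\<^esub>"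
    using U_strictly_low_closed[OF scalar.hyps] by (simp add: smult_assoc shifts_scalar smult_closed)
  then show ?case using cs(1) by blast
next
  case (unit x i j a)
  then obtain cs where cs: "\<forall>c\<in>set cs. \<exists>k\<ge>1. c = grade + of_nat k" "shifts cs (x \<odot>\<^bsub>M\<^esub> v) = \<zero>\<^bsub>M\<^esub>" by blast
  note [simp] = U_strictly_low_closed[OF unit.hyps(1)] U_unit_closed[OF unit.hyps(2,3)]
  \<comment> \<open>The root \<open>grade\<close> is added to kill the scalar multiple of
    \<open>v\<close>; afterwards all roots move up by \<open>i - j\<close>, which takes this one
    past \<open>grade\<close> too.\<close>
  have "shifts [grade] v = \<zero>\<^bsub>M\<^esub>" by (simp add: shifts_v U_scalar_0 del: shifts_Cons)
  then have "shifts (grade # cs) v = \<zero>\<^bsub>M\<^esub>" using shifts_commute[of v "[grade]" cs] by simp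
  then have "shifts (grade # cs) (U_scalar n a \<odot>\<^bsub>M\<^esub> v) = \<zero>\<^bsub>M\<^esub>"
    by (simp add: shifts_scalar del: shifts_Cons)
  moreover have "shifts (grade # cs) (x \<odot>\<^bsub>M\<^esub> v) = \<zero>\<^bsub>M\<^esub>" by (simp add: cs(2) U_shift_closed)
  ultimately have *: "shifts (grade # cs) ((U_scalar n a \<oplus>\<^bsub>U_gl n\<^esub> x) \<odot>\<^bsub>M\<^esub> v) = \<zero>\<^bsub>M\<^esub>"
    by (simp add: smult_l_distr shifts_add smult_closed del: shifts_Cons)
  define ds where "ds = map (\<lambda>c. c + (of_nat i - of_nat j)) (grade # cs)"
  have "shifts ds ((U_unit n i j \<otimes>\<^bsub>U_gl n\<^esub> (U_scalar n a \<oplus>\<^bsub>U_gl n\<^esub> x)) \<odot>\<^bsub>M\<^esub> v) = \<zero>\<^bsub>M\<^esub>"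
    unfolding ds_def
    using unit.hyps by (simp add: smult_assoc shifts_unit smult_closed * del: shifts_Cons list.map)
  moreover have "\<exists>k\<ge>1. c = grade + of_nat k" if c: "c \<in> set ds" for c
  proof -
    have ij: "of_nat i - of_nat j = (of_nat (i - j) :: complex)" "i - j \<ge> 1"
      using unit.hyps by (auto simp: of_nat_diff)
    have "\<exists>k. c = grade + of_nat k + of_nat (i - j)"
      using c cs(1) unfolding ds_def ij by (auto intro: exI[of _ 0])
    then obtain k where "c = grade + of_nat (k + (i - j))" by (auto simp: add.assoc)
    then show ?thesis using ij(2) by (intro exI[of _ "k + (i - j)"]) auto
  qed
  ultimately show ?case by blast
qed

text \<open>The polynomial that annihilates \<open>q v\<close> does not vanish at the grade of
  \<open>v\<close>, so it acts on \<open>v\<close> by a nonzero scalar \<open>p\<close>; applied to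
  the relation it leaves \<open>c p v = 0\<close>.\<close>

lemma hw_lower_independent:
  assumes q: "q \<in> U_strictly_low n" and eq: "U_scalar n c \<odot>\<^bsub>M\<^esub> v \<oplus>\<^bsub>M\<^esub> q \<odot>\<^bsub>M\<^esub> v = \<zero>\<^bsub>M\<^esub>"
  shows "c = 0"
proof (rule ccontr)
  assume c: "c \<noteq> 0"
  obtain cs where cs: "\<forall>c\<in>set cs. \<exists>k\<ge>1. c = grade + of_nat k" "shifts cs (q \<odot>\<^bsub>M\<^esub> v) = \<zero>\<^bsub>M\<^esub>"
    using strictly_low_annihilated[OF q] by blast
  define p where "p = (\<Prod>c\<leftarrow>cs. grade - c)"
  have p: "p \<noteq> 0" using cs(1) by (auto simp: p_def prod_list_zero_iff)
  note [simp] = U_strictly_low_closed[OF q]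
  have "shifts cs (U_scalar n c \<odot>\<^bsub>M\<^esub> v \<oplus>\<^bsub>M\<^esub> q \<odot>\<^bsub>M\<^esub> v) = U_scalar n (c * p) \<odot>\<^bsub>M\<^esub> v"
    using cs(2) by (simp add: shifts_add smult_closed shifts_scalar shifts_v p_def U_scalar_mult smult_assoc)
  then have "U_scalar n (c * p) \<odot>\<^bsub>M\<^esub> v = \<zero>\<^bsub>M\<^esub>" by (simp add: eq)
  then have "U_scalar n (inverse (c * p)) \<odot>\<^bsub>M\<^esub> (U_scalar n (c * p) \<odot>\<^bsub>M\<^esub> v) = \<zero>\<^bsub>M\<^esub>" by simp
  moreover have "U_scalar n (inverse (c * p)) \<odot>\<^bsub>M\<^esub> (U_scalar n (c * p) \<odot>\<^bsub>M\<^esub> v) =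
      U_scalar n (inverse (c * p) * (c * p)) \<odot>\<^bsub>M\<^esub> v"
    by (simp only: U_scalar_mult[of n "inverse (c * p)"] smult_assoc[OF U_scalar_closed U_scalar_closed v_closed])
  moreover have "inverse (c * p) * (c * p) = 1" using c p by (intro left_inverse) simp
  ultimately have "U_scalar n 1 \<odot>\<^bsub>M\<^esub> v = \<zero>\<^bsub>M\<^esub>" by (simp only:)
  then show False using v_nonzero by (simp add: U_scalar_1 smult_one)
qed

end

text \<open>The common annihilator of \<open>v1\<close> and \<open>v2\<close> is a left ideal of the
  kind required by \<open>U_gl_low_plus_ideal\<close>, so the same \<open>c\<close> and
  \<open>q\<close> serve both modules. This is what makes the two comparable.\<close>

lemma hw_simultaneous_decomposition:
  assumes M1: "gl_hw_module n M1 \<mu> v1" and M2: "gl_hw_module n M2 \<mu> v2"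
    and u: "u \<in> carrier (U_gl n)"
  obtains c q where "q \<in> U_strictly_low n"
    "u \<odot>\<^bsub>M1\<^esub> v1 = U_scalar n c \<odot>\<^bsub>M1\<^esub> v1 \<oplus>\<^bsub>M1\<^esub> q \<odot>\<^bsub>M1\<^esub> v1"
    "u \<odot>\<^bsub>M2\<^esub> v2 = U_scalar n c \<odot>\<^bsub>M2\<^esub> v2 \<oplus>\<^bsub>M2\<^esub> q \<odot>\<^bsub>M2\<^esub> v2"
proof -
  interpret M1: gl_hw_module n M1 \<mu> v1 by (rule M1)
  interpret M2: gl_hw_module n M2 \<mu> v2 by (rule M2)
  define J where "J = {x \<in> carrier (U_gl n). x \<odot>\<^bsub>M1\<^esub> v1 = \<zero>\<^bsub>M1\<^esub> \<and> x \<odot>\<^bsub>M2\<^esub> v2 = \<zero>\<^bsub>M2\<^esub>}"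
  have "\<exists>x\<in>U_low n. \<exists>y\<in>J. u = x \<oplus>\<^bsub>U_gl n\<^esub> y"
  proof (rule U_gl_low_plus_ideal[where \<mu> = "\<lambda>i. of_nat (part \<mu> i)", OF _ _ _ _ _ _ u])
    show "U_unit n i i \<oplus>\<^bsub>U_gl n\<^esub> U_scalar n (- of_nat (part \<mu> i)) \<in> J" if "i \<in> {1..n}" for i
      using that M1.diag_shift_v M2.diag_shift_v by (simp add: J_def U_unit_closed M1.R.a_closed)
  qed (auto simp: J_def M1.smult_l_distr M2.smult_l_distr M1.smult_assoc M2.smult_assoc
      U_unit_closed M1.upper_v M2.upper_v)
  then obtain x y where x: "x \<in> U_low n" and y: "y \<in> J" and uxy: "u = x \<oplus>\<^bsub>U_gl n\<^esub> y" by blast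
  obtain c q where q: "q \<in> U_strictly_low n" "x = U_scalar n c \<oplus>\<^bsub>U_gl n\<^esub> q"
    using U_low_decompose[OF x] by blast
  note [simp] = U_strictly_low_closed[OF q(1)]
  have [simp]: "y \<in> carrier (U_gl n)" using y by (simp add: J_def)
  show ?thesis
  proof (rule that[OF q(1)])
    show "u \<odot>\<^bsub>M1\<^esub> v1 = U_scalar n c \<odot>\<^bsub>M1\<^esub> v1 \<oplus>\<^bsub>M1\<^esub> q \<odot>\<^bsub>M1\<^esub> v1"
      using y unfolding uxy q(2) by (simp add: M1.smult_l_distr M1.smult_closed J_def)
    show "u \<odot>\<^bsub>M2\<^esub> v2 = U_scalar n c \<odot>\<^bsub>M2\<^esub> v2 \<oplus>\<^bsub>M2\<^esub> q \<odot>\<^bsub>M2\<^esub> v2"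
      using y unfolding uxy q(2) by (simp add: M2.smult_l_distr M2.smult_closed J_def)
  qed
qed

text \<open>Otherwise irreducibility gives \<open>a\<close> with \<open>a u v2 = v2\<close>.
  Decompose \<open>a u\<close> in both modules: \<open>a u v1 = 0\<close> forces the scalar part to
  vanish, and then \<open>v2 = q v2\<close> with \<open>q\<close> strictly lowering, which
  independence in \<open>M2\<close> excludes.\<close>

lemma hw_annihilator_subset:
  assumes M1: "gl_hw_module n M1 \<mu> v1" and M2: "gl_hw_module n M2 \<mu> v2"
    and irr: "irreducible_module (U_gl n) M2"
    and u: "u \<in> carrier (U_gl n)" "u \<odot>\<^bsub>M1\<^esub> v1 = \<zero>\<^bsub>M1\<^esub>"
  shows "u \<odot>\<^bsub>M2\<^esub> v2 = \<zero>\<^bsub>M2\<^esub>"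
proof (rule ccontr)
  interpret M1: gl_hw_module n M1 \<mu> v1 by (rule M1)
  interpret M2: gl_hw_module n M2 \<mu> v2 by (rule M2)
  assume "u \<odot>\<^bsub>M2\<^esub> v2 \<noteq> \<zero>\<^bsub>M2\<^esub>"
  then obtain a where a: "a \<in> carrier (U_gl n)" "v2 = a \<odot>\<^bsub>M2\<^esub> (u \<odot>\<^bsub>M2\<^esub> v2)"
    using irreducible_module_cyclic[OF irr M2.smult_closed[OF u(1) M2.v_closed] _ M2.v_closed] by blast
  then have au: "a \<otimes>\<^bsub>U_gl n\<^esub> u \<in> carrier (U_gl n)" using u by (simp add: M1.R.m_closed)
  obtain c q where q: "q \<in> U_strictly_low n"
    and 1: "(a \<otimes>\<^bsub>U_gl n\<^esub> u) \<odot>\<^bsub>M1\<^esub> v1 = U_scalar n c \<odot>\<^bsub>M1\<^esub> v1 \<oplus>\<^bsub>M1\<^esub> q \<odot>\<^bsub>M1\<^esub> v1"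
    and 2: "(a \<otimes>\<^bsub>U_gl n\<^esub> u) \<odot>\<^bsub>M2\<^esub> v2 = U_scalar n c \<odot>\<^bsub>M2\<^esub> v2 \<oplus>\<^bsub>M2\<^esub> q \<odot>\<^bsub>M2\<^esub> v2"
    using hw_simultaneous_decomposition[OF M1 M2 au] by blast
  note [simp] = U_strictly_low_closed[OF q]
  have "(a \<otimes>\<^bsub>U_gl n\<^esub> u) \<odot>\<^bsub>M1\<^esub> v1 = \<zero>\<^bsub>M1\<^esub>" using a u by (simp add: M1.smult_assoc)
  with 1 have "c = 0" using M1.hw_lower_independent[OF q] by simp
  then have "v2 = q \<odot>\<^bsub>M2\<^esub> v2"
    using 2 a u by (simp add: M2.smult_assoc U_scalar_0 M2.smult_closed)
  then have "U_scalar n (- 1) \<odot>\<^bsub>M2\<^esub> v2 \<oplus>\<^bsub>M2\<^esub> q \<odot>\<^bsub>M2\<^esub> v2 =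
      U_scalar n (- 1) \<odot>\<^bsub>M2\<^esub> v2 \<oplus>\<^bsub>M2\<^esub> U_scalar n 1 \<odot>\<^bsub>M2\<^esub> v2"
    by (simp add: U_scalar_1 M2.smult_one)
  also have "\<dots> = U_scalar n (- 1 + 1) \<odot>\<^bsub>M2\<^esub> v2"
    by (simp only: U_scalar_add M2.smult_l_distr[OF U_scalar_closed U_scalar_closed M2.v_closed])
  also have "\<dots> = \<zero>\<^bsub>M2\<^esub>" by (simp add: U_scalar_0)
  finally show False using M2.hw_lower_independent[OF q, of "- 1"] by simp
qed

text \<open>The two highest weight vectors have the same annihilator, by
  \<open>hw_annihilator_subset\<close> in both directions, so \<open>a v1 \<mapsto> a v2\<close> is
  a well defined isomorphism.\<close>

theorem irreducible_highest_weight_unique: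
  assumes M1: "is_irreducible_highest_weight n \<mu> M1" and M2: "is_irreducible_highest_weight n \<mu> M2"
  shows "modules_isomorphic (U_gl n) M1 M2"
proof -
  obtain v1 where v1: "highest_weight_vector n \<mu> M1 v1"
    and gen1: "carrier M1 = {a \<odot>\<^bsub>M1\<^esub> v1 | a. a \<in> carrier (U_gl n)}"
    using M1 by (auto simp: is_irreducible_highest_weight_def cyclic_submodule_def)
  obtain v2 where v2: "highest_weight_vector n \<mu> M2 v2"
    and gen2: "carrier M2 = {a \<odot>\<^bsub>M2\<^esub> v2 | a. a \<in> carrier (U_gl n)}"
    using M2 by (auto simp: is_irreducible_highest_weight_def cyclic_submodule_def)
  have irr: "irreducible_module (U_gl n) M1" "irreducible_module (U_gl n) M2"
    using M1 M2 by (simp_all add: is_irreducible_highest_weight_def)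
  have hw: "gl_hw_module n M1 \<mu> v1" "gl_hw_module n M2 \<mu> v2"
    using irr v1 v2 by (simp_all add: gl_hw_module_def gl_hw_module_axioms_def irreducible_module_def)
  interpret M1: gl_hw_module n M1 \<mu> v1 by (rule hw)
  interpret M2: gl_hw_module n M2 \<mu> v2 by (rule hw)
  have iff: "a \<odot>\<^bsub>M1\<^esub> v1 = b \<odot>\<^bsub>M1\<^esub> v1 \<longleftrightarrow> a \<odot>\<^bsub>M2\<^esub> v2 = b \<odot>\<^bsub>M2\<^esub> v2"
    if ab: "a \<in> carrier (U_gl n)" "b \<in> carrier (U_gl n)" for a b
  proof -
    have "a \<oplus>\<^bsub>U_gl n\<^esub> (\<ominus>\<^bsub>U_gl n\<^esub> b) \<in> carrier (U_gl n)" using ab by simp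
    then show ?thesis
      using hw_annihilator_subset[OF hw irr(2)] hw_annihilator_subset[OF hw(2,1) irr(1)] M1.smult_diff_eq_zero_iff[OF ab M1.v_closed] M2.smult_diff_eq_zero_iff[OF ab M2.v_closed]
      by blast
  qed
  define \<phi> where "\<phi> = (\<lambda>x. (SOME a. a \<in> carrier (U_gl n) \<and> x = a \<odot>\<^bsub>M1\<^esub> v1) \<odot>\<^bsub>M2\<^esub> v2)"
  have \<phi>: "\<phi> (a \<odot>\<^bsub>M1\<^esub> v1) = a \<odot>\<^bsub>M2\<^esub> v2" if a: "a \<in> carrier (U_gl n)" for a
  proof -
    define b where "b = (SOME b. b \<in> carrier (U_gl n) \<and> a \<odot>\<^bsub>M1\<^esub> v1 = b \<odot>\<^bsub>M1\<^esub> v1)"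
    have "b \<in> carrier (U_gl n) \<and> a \<odot>\<^bsub>M1\<^esub> v1 = b \<odot>\<^bsub>M1\<^esub> v1"
      unfolding b_def by (rule someI[of _ a]) (use a in simp)
    then have "a \<odot>\<^bsub>M2\<^esub> v2 = b \<odot>\<^bsub>M2\<^esub> v2" using iff[OF a, of b] by simp
    then show ?thesis by (simp add: \<phi>_def b_def)
  qed
  have "\<phi> \<in> module_iso (U_gl n) M1 M2"
    unfolding module_iso_def iso_def hom_def
  proof (intro CollectI conjI ballI funcsetI)
    fix x assume "x \<in> carrier (add_monoid M1)"
    then obtain a where "a \<in> carrier (U_gl n)" "x = a \<odot>\<^bsub>M1\<^esub> v1" using gen1 by auto
    then show "\<phi> x \<in> carrier (add_monoid M2)" by (simp add: \<phi> M2.smult_closed)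
  next
    fix x y assume "x \<in> carrier (add_monoid M1)" "y \<in> carrier (add_monoid M1)"
    then obtain a b where "a \<in> carrier (U_gl n)" "x = a \<odot>\<^bsub>M1\<^esub> v1" "b \<in> carrier (U_gl n)" "y = b \<odot>\<^bsub>M1\<^esub> v1"
      using gen1 by auto
    then show "\<phi> (x \<otimes>\<^bsub>add_monoid M1\<^esub> y) = \<phi> x \<otimes>\<^bsub>add_monoid M2\<^esub> \<phi> y"
      using \<phi>[of "a \<oplus>\<^bsub>U_gl n\<^esub> b"] by (simp add: \<phi> M1.smult_l_distr M2.smult_l_distr)
  next
    show "bij_betw \<phi> (carrier (add_monoid M1)) (carrier (add_monoid M2))"
      unfolding bij_betw_def
    proof
      show "inj_on \<phi> (carrier (add_monoid M1))"
        by (rule inj_onI) (auto simp: gen1 \<phi> iff)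
      show "\<phi> ` carrier (add_monoid M1) = carrier (add_monoid M2)"
        by (auto simp: gen1 gen2 \<phi> image_iff) (use \<phi> in fastforce)+
    qed
  next
    fix a x assume a: "a \<in> carrier (U_gl n)" and "x \<in> carrier M1"
    then obtain b where "b \<in> carrier (U_gl n)" "x = b \<odot>\<^bsub>M1\<^esub> v1" using gen1 by auto
    then show "\<phi> (a \<odot>\<^bsub>M1\<^esub> x) = a \<odot>\<^bsub>M2\<^esub> \<phi> x"
      using a \<phi>[of "a \<otimes>\<^bsub>U_gl n\<^esub> b"] by (simp add: \<phi> M1.smult_assoc M2.smult_assoc)
  qed
  then show ?thesis by (auto simp: modules_isomorphic_def)
qed

section \<open>The module of polynomials\<close>

abbreviation act :: "nat \<Rightarrow> env_elem \<Rightarrow> matrix_poly \<Rightarrow> matrix_poly" where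
  "act n u f \<equiv> u \<odot>\<^bsub>poly_Mat n\<^esub> f"

lemma carrier_poly_Mat:
  "carrier (poly_Mat n) = {f. \<forall>a\<in>keys f. keys a \<subseteq> {1..n} \<times> {1..n}}"
  and zero_poly_Mat [simp]: "\<zero>\<^bsub>poly_Mat n\<^esub> = 0"
  and add_poly_Mat [simp]: "f \<oplus>\<^bsub>poly_Mat n\<^esub> g = f + g"
  by (simp_all add: poly_Mat_def)

lemma gl_stable_carrier_poly_Mat: "gl_stable n (carrier (poly_Mat n))"
  unfolding gl_stable_def
proof (intro conjI ballI)
  show "poly_vs.subspace (carrier (poly_Mat n))"
  proof (rule poly_vs.subspaceI)
    fix c x assume "x \<in> carrier (poly_Mat n)"
    then show "Const c * x \<in> carrier (poly_Mat n)"
      using keys_Const_mult[of c x] unfolding carrier_poly_Mat by blast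
  next
    fix x y assume "x \<in> carrier (poly_Mat n)" "y \<in> carrier (poly_Mat n)"
    then show "x + y \<in> carrier (poly_Mat n)"
      using keys_add[of x y] unfolding carrier_poly_Mat by blast
  qed (simp add: carrier_poly_Mat)
next
  fix i j x assume ij: "i \<in> {1..n}" "j \<in> {1..n}" and x: "x \<in> carrier (poly_Mat n)"
  show "col_op {1..n} i j x \<in> carrier (poly_Mat n)"
    unfolding carrier_poly_Mat
  proof (intro CollectI ballI)
    fix a assume "a \<in> keys (col_op {1..n} i j x)"
    then obtain c k where k: "k \<in> {1..n}" "c + unit_exp (j, k) \<in> keys x"
      and a: "a = c + unit_exp (i, k)" by (rule keys_col_op)
    then have "keys (c + unit_exp (j, k)) \<subseteq> {1..n} \<times> {1..n}"
      using x unfolding carrier_poly_Mat by blast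
    then show "keys a \<subseteq> {1..n} \<times> {1..n}"
      using ij k unfolding a keys_plus_nat by auto
  qed
qed

lemma col_homogeneous_subset_carrier: "col_homogeneous n d \<subseteq> carrier (poly_Mat n)"
  by (auto simp: col_homogeneous_def carrier_poly_Mat)

lemma word_action_Nil [simp]: "word_action n [] f = f"
  and word_action_Cons [simp]: "word_action n ((i, j) # w) f = col_op {1..n} i j (word_action n w f)"
  by (simp_all add: word_action_def gl_unit_action_eq_col_op)

section \<open>The action of the tensor algebra and its descent to the enveloping algebra\<close>

lemma word_action_append: "word_action n (u @ w) f = word_action n u (word_action n w f)"
  by (simp add: word_action_def)

lemma word_action_add: "word_action n w (f + g) = word_action n w f + word_action n w g"
  by (induction w) (auto simp: col_op_add)

lemma word_action_Const_mult: "word_action n w (Const c * f) = Const c * word_action n w f"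
  by (induction w) (auto simp: col_op_Const_mult)

lemma tensor_action_superset:
  assumes "finite A" "{w. p w \<noteq> 0} \<subseteq> A"
  shows "tensor_action n p f = (\<Sum>w\<in>A. Const (p w) * word_action n w f)"
  unfolding tensor_action_def using assms by (intro sum.mono_neutral_left) auto

lemma tensor_action_add_left:
  assumes "p \<in> carrier (gl_tensor_algebra n)" "q \<in> carrier (gl_tensor_algebra n)"
  shows "tensor_action n (p \<oplus>\<^bsub>gl_tensor_algebra n\<^esub> q) f = tensor_action n p f + tensor_action n q f"
proof -
  define A where "A = {w. p w \<noteq> 0} \<union> {w. q w \<noteq> 0}"
  have "finite A" using assms by (simp add: A_def gl_tensor_algebra_def)
  moreover have "{w. p w \<noteq> 0} \<subseteq> A" "{w. q w \<noteq> 0} \<subseteq> A"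
    "{w. (p \<oplus>\<^bsub>gl_tensor_algebra n\<^esub> q) w \<noteq> 0} \<subseteq> A"
    by (auto simp: A_def gl_tensor_algebra_def)
  ultimately show ?thesis
    by (simp add: tensor_action_superset[of A])
      (simp add: gl_tensor_algebra_def Const_add distrib_right sum.distrib)
qed

lemma tensor_action_add_right:
  "tensor_action n p (f + g) = tensor_action n p f + tensor_action n p g"
  by (simp add: tensor_action_def word_action_add distrib_left sum.distrib)


lemma tensor_action_0_right [simp]: "tensor_action n p 0 = 0"
  using tensor_action_add_right[of n p 0 0] by simp

lemma tensor_action_monomial:
  "tensor_action n (\<lambda>v. c * word_elem w v) f = Const c * word_action n w f"
  by (subst tensor_action_superset[of "{w}"]) (auto simp: word_elem_def)

lemma monomial_mult:
  "(\<lambda>v. c * word_elem u v) \<otimes>\<^bsub>gl_tensor_algebra n\<^esub> (\<lambda>v. d * word_elem w v) =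
     (\<lambda>v. (c * d) * word_elem (u @ w) v)"
proof
  fix v
  have "(\<Sum>k\<le>length v. (c * word_elem u (take k v)) * (d * word_elem w (drop k v))) =
      (c * d) * (\<Sum>k\<le>length v. word_elem u (take k v) * word_elem w (drop k v))"
    by (simp add: sum_distrib_left mult_ac)
  also have "(\<Sum>k\<le>length v. word_elem u (take k v) * word_elem w (drop k v)) = word_elem (u @ w) v"
    using fun_cong[OF word_elem_mult[where u = u and v = w and n = n], of v] by (simp add: gl_tensor_algebra_def)
  finally show "((\<lambda>v. c * word_elem u v) \<otimes>\<^bsub>gl_tensor_algebra n\<^esub> (\<lambda>v. d * word_elem w v)) v =
      (c * d) * word_elem (u @ w) v"
    by (simp add: gl_tensor_algebra_def)
qed

lemma monomial_closed:
  "w \<in> lists ({1..n} \<times> {1..n}) \<Longrightarrow> (\<lambda>v. c * word_elem w v) \<in> carrier (gl_tensor_algebra n)"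
  by (auto simp: gl_tensor_algebra_def word_elem_def)

lemma tensor_action_mult:
  assumes p: "p \<in> carrier (gl_tensor_algebra n)" and q: "q \<in> carrier (gl_tensor_algebra n)"
  shows "tensor_action n (p \<otimes>\<^bsub>gl_tensor_algebra n\<^esub> q) f = tensor_action n p (tensor_action n q f)"
proof -
  interpret T: ring "gl_tensor_algebra n" by (rule ring_gl_tensor_algebra)
  show ?thesis
    using p
  proof (induction p rule: gl_tensor_induct)
    case (single c u)
    note u = monomial_closed[OF single, of c]
    show ?case
      using q
    proof (induction q rule: gl_tensor_induct)
      case (single d w)
      have "tensor_action n ((\<lambda>v. c * word_elem u v) \<otimes>\<^bsub>gl_tensor_algebra n\<^esub> (\<lambda>v. d * word_elem w v)) f =
          Const (c * d) * word_action n (u @ w) f"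
        by (simp only: monomial_mult tensor_action_monomial)
      also have "\<dots> = Const c * word_action n u (Const d * word_action n w f)"
        by (simp only: word_action_append word_action_Const_mult Const_mult mult.assoc)
      finally show ?case by (simp only: tensor_action_monomial)
    next
      case (add q r)
      then show ?case
        using u by (simp add: T.r_distr tensor_action_add_left tensor_action_add_right)
    qed
  next
    case (add p p')
    then show ?case using q by (simp add: T.l_distr tensor_action_add_left)
  qed
qed


lemma tensor_action_zero: "tensor_action n \<zero>\<^bsub>gl_tensor_algebra n\<^esub> f = 0"
  by (simp add: gl_tensor_algebra_def tensor_action_def)

lemma tensor_action_relation:
  assumes "i \<in> {1..n}" "j \<in> {1..n}" "k \<in> {1..n}" "l \<in> {1..n}"
  shows "tensor_action n (gl_relation i j k l) f = 0"
proof -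
  let ?T = "gl_tensor_algebra n"
  interpret T: ring ?T by (rule ring_gl_tensor_algebra)
  define a where "a = (if j = k then - 1 else 0 :: complex)"
  define b where "b = (if l = i then 1 else 0 :: complex)"
  have rel: "gl_relation i j k l = (\<lambda>v. 1 * word_elem [(i, j), (k, l)] v) \<oplus>\<^bsub>?T\<^esub>
      ((\<lambda>v. (- 1) * word_elem [(k, l), (i, j)] v) \<oplus>\<^bsub>?T\<^esub>
       ((\<lambda>v. a * word_elem [(i, l)] v) \<oplus>\<^bsub>?T\<^esub> (\<lambda>v. b * word_elem [(k, j)] v)))"
    by (auto simp: gl_relation_def gl_tensor_algebra_def a_def b_def)
  have closed: "(\<lambda>v. c * word_elem [(x, y), (z, w)] v) \<in> carrier ?T" "(\<lambda>v. c * word_elem [(x, y)] v) \<in> carrier ?T"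
    if "x \<in> {1..n}" "y \<in> {1..n}" "z \<in> {1..n}" "w \<in> {1..n}" for c x y z w
    using that by (auto intro!: monomial_closed)
  show ?thesis
    unfolding rel using assms
    by (simp add: tensor_action_add_left closed T.a_closed tensor_action_monomial
        del: mult_1_left mult_minus1 mult_minus_left)
      (auto simp: col_op_commutator[of _ i j k l] a_def b_def Const_uminus)
qed

text \<open>The elements that act by zero on all polynomials form a two-sided ideal, which contains
  the relations.\<close>

lemma tensor_action_gl_ideal:
  assumes "p \<in> gl_ideal n"
  shows "tensor_action n p f = 0"
proof -
  let ?T = "gl_tensor_algebra n"
  interpret T: ring ?T by (rule ring_gl_tensor_algebra)
  define K where "K = {p \<in> carrier ?T. \<forall>f. tensor_action n p f = 0}"
  have "ideal K ?T"
  proof (rule idealI)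
    show "subgroup K (add_monoid ?T)"
    proof (rule subgroup.intro)
      fix p assume p: "p \<in> K"
      have "tensor_action n (\<ominus>\<^bsub>?T\<^esub> p) f = 0" for f
      proof -
        have "0 = tensor_action n (\<ominus>\<^bsub>?T\<^esub> p \<oplus>\<^bsub>?T\<^esub> p) f"
          using p by (simp add: K_def T.l_neg tensor_action_zero)
        also have "\<dots> = tensor_action n (\<ominus>\<^bsub>?T\<^esub> p) f"
          using p by (simp add: K_def tensor_action_add_left)
        finally show ?thesis by simp
      qed
      then have "\<ominus>\<^bsub>?T\<^esub> p \<in> K" using p by (simp add: K_def)
      then show "inv\<^bsub>add_monoid ?T\<^esub> p \<in> K" by (simp add: a_inv_def)
    qed (auto simp: K_def tensor_action_add_left tensor_action_zero)
  qed (auto simp: K_def tensor_action_mult T.ring_axioms)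
  then have "gl_ideal n \<subseteq> K"
    unfolding gl_ideal_def
    by (rule T.genideal_minimal) (auto simp: K_def gl_relation_closed tensor_action_relation)
  with assms show ?thesis by (auto simp: K_def)
qed

text \<open>All members of a coset act alike, so the set to which \<open>the_elem\<close> is applied
  is a singleton.\<close>

lemma act_U_proj:
  assumes p: "p \<in> carrier (gl_tensor_algebra n)"
  shows "act n (U_proj n p) f = tensor_action n p f"
proof -
  let ?T = "gl_tensor_algebra n"
  interpret T: ring ?T by (rule ring_gl_tensor_algebra)
  interpret I: ideal "gl_ideal n" ?T by (rule ideal_gl_ideal)
  have key: "tensor_action n (h \<oplus>\<^bsub>?T\<^esub> p) f = tensor_action n p f" if "h \<in> gl_ideal n" for h
    using that p I.a_subset by (auto simp: tensor_action_add_left tensor_action_gl_ideal)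
  have "gl_ideal n \<noteq> {}"
    using additive_subgroup.zero_closed[OF ideal.axioms(1)[OF ideal_gl_ideal]] by blast
  have "U_proj n p = (\<lambda>h. h \<oplus>\<^bsub>?T\<^esub> p) ` gl_ideal n"
    by (auto simp: a_r_coset_def')
  then have "(\<lambda>q. tensor_action n q f) ` U_proj n p = (\<lambda>h. tensor_action n (h \<oplus>\<^bsub>?T\<^esub> p) f) ` gl_ideal n"
    by (simp add: image_image)
  also have "\<dots> = (\<lambda>h. tensor_action n p f) ` gl_ideal n"
    by (rule image_cong) (simp_all add: key)
  also have "\<dots> = {tensor_action n p f}" using \<open>gl_ideal n \<noteq> {}\<close> by auto
  finally have "(\<lambda>q. tensor_action n q f) ` U_proj n p = {tensor_action n p f}" .
  then show ?thesis by (simp add: poly_Mat_def)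
qed

lemma act_unit: "i \<in> {1..n} \<Longrightarrow> j \<in> {1..n} \<Longrightarrow> act n (U_unit n i j) f = col_op {1..n} i j f"
proof -
  assume ij: "i \<in> {1..n}" "j \<in> {1..n}"
  have "act n (U_unit n i j) f = tensor_action n (word_elem [(i, j)]) f"
    unfolding U_unit_def using ij by (intro act_U_proj word_elem_closed) auto
  also have "\<dots> = col_op {1..n} i j f"
    using tensor_action_monomial[of n 1 "[(i, j)]" f] by simp
  finally show ?thesis .
qed

lemma act_scalar: "act n (U_scalar n c) f = Const c * f"
proof -
  have "act n (U_scalar n c) f = tensor_action n (scalar_elem c) f"
    unfolding U_scalar_def by (rule act_U_proj) simp
  also have "scalar_elem c = (\<lambda>v. c * word_elem [] v)" by (auto simp: word_elem_def)
  finally show ?thesis by (simp only: tensor_action_monomial word_action_Nil)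
qed

lemma act_add_left:
  assumes "u \<in> carrier (U_gl n)" "w \<in> carrier (U_gl n)"
  shows "act n (u \<oplus>\<^bsub>U_gl n\<^esub> w) f = act n u f + act n w f"
proof -
  interpret T: ring "gl_tensor_algebra n" by (rule ring_gl_tensor_algebra)
  show ?thesis
    using assms unfolding carrier_U_gl
    by (auto simp: U_proj_add[symmetric] act_U_proj tensor_action_add_left)
qed

lemma act_mult:
  assumes "u \<in> carrier (U_gl n)" "w \<in> carrier (U_gl n)"
  shows "act n (u \<otimes>\<^bsub>U_gl n\<^esub> w) f = act n u (act n w f)"
proof -
  interpret T: ring "gl_tensor_algebra n" by (rule ring_gl_tensor_algebra)
  show ?thesis
    using assms unfolding carrier_U_gl
    by (auto simp: U_proj_mult[symmetric] act_U_proj tensor_action_mult)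
qed

lemma act_add_right: "u \<in> carrier (U_gl n) \<Longrightarrow> act n u (f + g) = act n u f + act n u g"
  unfolding carrier_U_gl by (auto simp: act_U_proj tensor_action_add_right)

lemma act_0_right: "u \<in> carrier (U_gl n) \<Longrightarrow> act n u 0 = 0"
  unfolding carrier_U_gl by (auto simp: act_U_proj)

lemma act_sum_right: "u \<in> carrier (U_gl n) \<Longrightarrow> act n u (sum f A) = (\<Sum>x\<in>A. act n u (f x))"
  by (induction A rule: infinite_finite_induct) (simp_all add: act_0_right act_add_right)

lemma act_one: "act n \<one>\<^bsub>U_gl n\<^esub> f = f"
  using act_scalar[of n 1 f] by (simp add: U_scalar_1)

lemma gl_stable_act:
  assumes N: "gl_stable n N" and u: "u \<in> carrier (U_gl n)" and x: "x \<in> N"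
  shows "act n u x \<in> N"
  using u
proof (induction rule: U_gl_induct)
  case (add u w)
  then show ?case using N by (simp add: act_add_left gl_stable_def poly_vs.subspace_add)
next
  case (scalar c u)
  have "poly_vs.subspace N" using N by (simp add: gl_stable_def)
  from poly_vs.subspace_scale[OF this scalar.IH] show ?case
    using scalar by (simp add: act_mult act_scalar)
next
  case (unit i j u)
  then show ?case using N by (simp add: act_mult U_unit_closed act_unit gl_stable_def)
qed (simp add: act_one x)

lemma left_module_poly_Mat: "left_module (U_gl n) (poly_Mat n)"
proof -
  have sub: "poly_vs.subspace (carrier (poly_Mat n))"
    using gl_stable_carrier_poly_Mat by (simp add: gl_stable_def)
  have "abelian_group (poly_Mat n)"
  proof (rule abelian_groupI)
    fix x assume "x \<in> carrier (poly_Mat n)"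
    then show "\<exists>y\<in>carrier (poly_Mat n). y \<oplus>\<^bsub>poly_Mat n\<^esub> x = \<zero>\<^bsub>poly_Mat n\<^esub>"
      using poly_vs.subspace_neg[OF sub] by (intro bexI[of _ "- x"]) auto
  qed (simp_all add: poly_vs.subspace_add[OF sub] poly_vs.subspace_0[OF sub] add_ac)
  then show ?thesis
    by (intro left_module.intro left_module_axioms.intro ring_U_gl)
      (simp_all add: gl_stable_act[OF gl_stable_carrier_poly_Mat] act_add_left act_mult
        act_add_right act_one)
qed

section \<open>Cyclic submodules of polynomials\<close>

definition cyclic_space :: "nat \<Rightarrow> matrix_poly \<Rightarrow> matrix_poly set" where
  "cyclic_space n f = {act n u f | u. u \<in> carrier (U_gl n)}"

lemma carrier_cyclic_submodule:
  "carrier (cyclic_submodule (U_gl n) (poly_Mat n) f) = cyclic_space n f"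
  and cyclic_submodule_simps [simp]:
  "add (cyclic_submodule R M x) = add M" "smult (cyclic_submodule R M x) = smult M"
  "zero (cyclic_submodule R M x) = zero M"
  by (simp_all add: cyclic_submodule_def cyclic_space_def)

lemma mem_cyclic_space: "f \<in> cyclic_space n f"
proof -
  interpret U: ring "U_gl n" by (rule ring_U_gl)
  show ?thesis unfolding cyclic_space_def using act_one[of n f] U.one_closed by (metis (mono_tags, lifting) CollectI)
qed

lemma gl_stable_cyclic_space: "gl_stable n (cyclic_space n f)"
proof -
  interpret U: ring "U_gl n" by (rule ring_U_gl)
  have smult: "act n u x \<in> cyclic_space n f" if ux: "u \<in> carrier (U_gl n)" "x \<in> cyclic_space n f" for u x
  proof -
    obtain w where w: "w \<in> carrier (U_gl n)" "x = act n w f"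
      using ux(2) by (auto simp: cyclic_space_def)
    then have "act n u x = act n (u \<otimes>\<^bsub>U_gl n\<^esub> w) f" using ux(1) by (simp add: act_mult)
    moreover have "u \<otimes>\<^bsub>U_gl n\<^esub> w \<in> carrier (U_gl n)" using ux(1) w(1) by simp
    ultimately show ?thesis unfolding cyclic_space_def by blast
  qed
  have "poly_vs.subspace (cyclic_space n f)"
  proof (rule poly_vs.subspaceI)
    show "0 \<in> cyclic_space n f"
      using smult[OF U_scalar_closed mem_cyclic_space, of 0] by (simp add: act_scalar)
    fix x y assume x: "x \<in> cyclic_space n f" and y: "y \<in> cyclic_space n f"
    obtain u w where u: "u \<in> carrier (U_gl n)" "x = act n u f" and w: "w \<in> carrier (U_gl n)" "y = act n w f"
      using x y by (auto simp: cyclic_space_def)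
    then have "x + y = act n (u \<oplus>\<^bsub>U_gl n\<^esub> w) f" by (simp add: act_add_left)
    moreover have "u \<oplus>\<^bsub>U_gl n\<^esub> w \<in> carrier (U_gl n)" using u w by simp
    ultimately show "x + y \<in> cyclic_space n f" unfolding cyclic_space_def by blast
  next
    fix c x assume "x \<in> cyclic_space n f"
    then show "Const c * x \<in> cyclic_space n f"
      using smult[OF U_scalar_closed, of x c] by (simp add: act_scalar)
  qed
  then show ?thesis
    using smult[OF U_unit_closed] by (auto simp: gl_stable_def act_unit)
qed

lemma cyclic_space_minimal: "gl_stable n N \<Longrightarrow> f \<in> N \<Longrightarrow> cyclic_space n f \<subseteq> N"
  unfolding cyclic_space_def using gl_stable_act by blast

lemma left_module_restrict_carrier:
  assumes M: "left_module R M" and H: "submodule H R M"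
  shows "left_module R (M\<lparr>carrier := H\<rparr>)"
proof -
  interpret M: left_module R M by (rule M)
  interpret H: submodule H R M by (rule H)
  have sub: "x \<in> carrier M" if "x \<in> H" for x using that H.subset by auto
  have add: "x \<oplus>\<^bsub>M\<^esub> y \<in> H" if "x \<in> H" "y \<in> H" for x y using H.m_closed that by simp
  have zero: "\<zero>\<^bsub>M\<^esub> \<in> H" using H.one_closed by simp
  have "abelian_group (M\<lparr>carrier := H\<rparr>)"
  proof (rule abelian_groupI)
    fix x assume "x \<in> carrier (M\<lparr>carrier := H\<rparr>)"
    then show "\<exists>y\<in>carrier (M\<lparr>carrier := H\<rparr>). y \<oplus>\<^bsub>M\<lparr>carrier := H\<rparr>\<^esub> x = \<zero>\<^bsub>M\<lparr>carrier := H\<rparr>\<^esub>"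
      using H.m_inv_closed[of x] sub[of x] M.M.l_neg[of x]
      by (intro bexI[of _ "\<ominus>\<^bsub>M\<^esub> x"]) (simp_all add: a_inv_def)
  qed (auto simp: add zero sub M.M.a_ac)
  then show ?thesis
    by (intro left_module.intro left_module_axioms.intro M.R.ring_axioms)
      (auto simp: sub H.smult_closed M.smult_l_distr M.smult_r_distr M.smult_assoc M.smult_one)
qed

lemma submodule_cyclic_space:
  assumes "f \<in> carrier (poly_Mat n)"
  shows "submodule (cyclic_space n f) (U_gl n) (poly_Mat n)"
  unfolding cyclic_space_def by (rule left_module.submodule_cyclic[OF left_module_poly_Mat assms])

lemma left_module_cyclic_submodule:
  assumes "f \<in> carrier (poly_Mat n)"
  shows "left_module (U_gl n) (cyclic_submodule (U_gl n) (poly_Mat n) f)"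
  using left_module_restrict_carrier[OF left_module_poly_Mat submodule_cyclic_space[OF assms]]
  by (simp add: cyclic_submodule_def cyclic_space_def)

section \<open>Orthogonality and irreducibility of modules generated by highest weight
  vectors\<close>

lemma highest_weight_vector_poly_Mat:
  assumes "v \<in> hw_space n (part \<mu>)" "v \<noteq> 0" "v \<in> carrier (poly_Mat n)"
  shows "highest_weight_vector n \<mu> (poly_Mat n) v"
    "highest_weight_vector n \<mu> (cyclic_submodule (U_gl n) (poly_Mat n) v) v"
  using assms unfolding highest_weight_vector_def carrier_cyclic_submodule
  by (simp_all add: hw_space_def act_unit act_scalar mem_cyclic_space)

lemma gl_hw_module_poly_Mat:
  assumes "v \<in> hw_space n (part \<mu>)" "v \<noteq> 0" "v \<in> carrier (poly_Mat n)"
  shows "gl_hw_module n (poly_Mat n) \<mu> v"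
  using highest_weight_vector_poly_Mat(1)[OF assms] left_module_poly_Mat
  by (simp add: gl_hw_module_def gl_hw_module_axioms_def)

text \<open>The adjoint of the first lowering unit is a raising unit, which kills \<open>w\<close>,
  whatever the vector it is paired with.\<close>

lemma strictly_low_orthogonal:
  assumes w: "w \<in> hw_space n \<nu>" and q: "q \<in> U_strictly_low n"
  shows "fischer (act n q v) w = 0"
proof -
  interpret U: ring "U_gl n" by (rule ring_U_gl)
  show ?thesis
    using q
  proof (induction rule: U_strictly_low.induct)
    case zero
    then show ?case using act_scalar[of n 0 v] by (simp add: U_scalar_0)
  next
    case (add x y)
    then show ?case by (simp add: act_add_left U_strictly_low_closed fischer_add_left)
  next
    case (scalar x c)
    then show ?case by (simp add: act_mult U_strictly_low_closed act_scalar fischer_Const_left)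
  next
    case (unit x i j c)
    then have "fischer (act n (U_unit n i j \<otimes>\<^bsub>U_gl n\<^esub> (U_scalar n c \<oplus>\<^bsub>U_gl n\<^esub> x)) v) w =
        fischer (act n (U_scalar n c \<oplus>\<^bsub>U_gl n\<^esub> x) v) (col_op {1..n} j i w)"
      by (simp add: act_mult U_strictly_low_closed U_unit_closed act_unit fischer_col_op)
    also have "col_op {1..n} j i w = 0" using w unit.hyps by (simp add: hw_space_def)
    finally show ?case by simp
  qed
qed

text \<open>An element \<open>u v\<close> is a multiple of \<open>v\<close> plus a strictly lowered
  vector, and both are orthogonal to \<open>w\<close>.\<close>

lemma cyclic_space_orthogonal_hw:
  assumes v: "v \<in> hw_space n (part \<mu>)" "v \<in> carrier (poly_Mat n)"
    and w: "w \<in> hw_space n \<nu>" and vw: "fischer v w = 0" and x: "x \<in> cyclic_space n v"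
  shows "fischer x w = 0"
proof (cases "v = 0")
  case True
  then show ?thesis using x by (auto simp: cyclic_space_def act_0_right)
next
  case False
  note hw = gl_hw_module_poly_Mat[OF v(1) False v(2)]
  obtain u where u: "u \<in> carrier (U_gl n)" "x = act n u v" using x by (auto simp: cyclic_space_def)
  obtain c q where "q \<in> U_strictly_low n" "act n u v = act n (U_scalar n c) v \<oplus>\<^bsub>poly_Mat n\<^esub> act n q v"
    using hw_simultaneous_decomposition[OF hw hw u(1)] by blast
  then show ?thesis
    using strictly_low_orthogonal[OF w] vw by (simp add: u(2) act_scalar fischer_add_left fischer_Const_left)
qed

text \<open>The units acting on \<open>w\<close> are moved one by one to the other side, where they
  keep \<open>x\<close> in the cyclic space of \<open>v\<close>.\<close>

lemma cyclic_spaces_orthogonal: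
  assumes v: "v \<in> hw_space n (part \<mu>)" "v \<in> carrier (poly_Mat n)"
    and w: "w \<in> hw_space n \<nu>" and vw: "fischer v w = 0"
    and x: "x \<in> cyclic_space n v" and y: "y \<in> cyclic_space n w"
  shows "fischer x y = 0"
proof -
  obtain u where u: "u \<in> carrier (U_gl n)" "y = act n u w" using y by (auto simp: cyclic_space_def)
  have "\<forall>x\<in>cyclic_space n v. fischer x (act n u w) = 0"
    using u(1)
  proof (induction rule: U_gl_induct)
    case one
    then show ?case using cyclic_space_orthogonal_hw[OF v w vw] by (simp add: act_one)
  next
    case (add u u')
    then show ?case by (simp add: act_add_left fischer_add_right)
  next
    case (scalar c u)
    then show ?case by (simp add: act_mult act_scalar fischer_Const_right)
  next
    case (unit i j u)
    then show ?case
      using gl_stable_cyclic_space[of n v]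
      by (simp add: act_mult U_unit_closed act_unit fischer_col_op[symmetric] gl_stable_def)
  qed
  then show ?thesis using u(2) x by simp
qed

lemma hw_space_cong:
  assumes "\<And>i. i \<in> {1..n} \<Longrightarrow> \<mu> i = \<nu> i"
  shows "hw_space n \<mu> = hw_space n \<nu>"
  using assms by (auto simp: hw_space_def)

text \<open>A nonzero submodule contains a highest weight vector \<open>y\<close>. In the cyclic
  space of \<open>v\<close>, a highest weight vector orthogonal to \<open>v\<close> is orthogonal to
  itself. So \<open>y\<close> is not orthogonal to \<open>v\<close> and has the same weight; its
  component orthogonal to \<open>v\<close>, again a highest weight vector, vanishes. Thus
  \<open>y\<close> is a multiple of \<open>v\<close>.\<close>

lemma irreducible_cyclic_hw:
  assumes v: "v \<in> hw_space n (part \<mu>)" "v \<noteq> 0" "v \<in> col_homogeneous n d"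
  shows "is_irreducible_highest_weight n \<mu> (cyclic_submodule (U_gl n) (poly_Mat n) v)"
proof -
  let ?M = "cyclic_submodule (U_gl n) (poly_Mat n) v"
  have vc: "v \<in> carrier (poly_Mat n)" using v(3) col_homogeneous_subset_carrier by blast
  have "irreducible_module (U_gl n) ?M"
    unfolding irreducible_module_def carrier_cyclic_submodule
  proof (intro conjI allI impI)
    show "left_module (U_gl n) ?M" by (rule left_module_cyclic_submodule[OF vc])
    show "cyclic_space n v \<noteq> {\<zero>\<^bsub>?M\<^esub>}" using mem_cyclic_space[of v n] v(2) by auto
    fix N assume N: "submodule N (U_gl n) ?M"
    interpret N: submodule N "U_gl n" ?M by (rule N)
    have sub: "N \<subseteq> cyclic_space n v" using N.subset by (simp add: carrier_cyclic_submodule)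
    have N_act: "act n u x \<in> N" if "u \<in> carrier (U_gl n)" "x \<in> N" for u x
      using N.smult_closed[OF that] by simp
    have N_add: "x + y \<in> N" if "x \<in> N" "y \<in> N" for x y using N.m_closed[OF that] by simp
    have N_0: "0 \<in> N" using N.one_closed by simp
    have "poly_vs.subspace N"
      using N_act[OF U_scalar_closed] by (intro poly_vs.subspaceI) (auto simp: N_0 N_add act_scalar)
    then have stable: "gl_stable n N"
      using N_act[OF U_unit_closed] by (auto simp: gl_stable_def act_unit)
    have "cyclic_space n v \<subseteq> col_homogeneous n d"
      using v(3) by (rule cyclic_space_minimal[OF gl_stable_col_homogeneous])
    with sub have N_sub: "N \<subseteq> col_homogeneous n d" by blast
    show "N = {\<zero>\<^bsub>?M\<^esub>} \<or> N = cyclic_space n v"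
    proof (cases "N = {0}")
      case False
      obtain y a where y: "y \<in> N" "y \<noteq> 0" "a \<in> keys y" "y \<in> hw_space n (row_sum n a)"
        by (rule gl_stable_hw_vector[OF stable N_sub False])
      have y_cyc: "y \<in> cyclic_space n v" using y(1) sub by blast
      have "fischer v y \<noteq> 0"
        using cyclic_space_orthogonal_hw[OF v(1) vc y(4) _ y_cyc] y(2) fischer_self_eq_0_iff by blast
      then have "part \<mu> i = row_sum n a i" if "i \<in> {1..n}" for i
        using hw_space_orthogonal[OF v(1) y(4) that] by blast
      then have y_hw: "y \<in> hw_space n (part \<mu>)"
        using y(4) hw_space_cong[of n "part \<mu>" "row_sum n a"] by simp
      define c where "c = fischer y v / fischer v v"
      define z where "z = y - Const c * v"
      have "z \<in> hw_space n (part \<mu>)"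
        unfolding z_def using y_hw v(1)
        by (intro poly_vs.subspace_diff poly_vs.subspace_scale subspace_hw_space)
      moreover have "z \<in> cyclic_space n v"
        unfolding z_def using y_cyc mem_cyclic_space[of v n] gl_stable_cyclic_space[of n v]
        by (intro poly_vs.subspace_diff poly_vs.subspace_scale) (simp_all add: gl_stable_def)
      moreover have "fischer z v = 0"
        using v(2) by (simp add: z_def c_def fischer_diff_left fischer_Const_left fischer_self_eq_0_iff)
      then have "fischer v z = 0" using fischer_cnj[of v z] by simp
      ultimately have "fischer z z = 0" using cyclic_space_orthogonal_hw[OF v(1) vc] by blast
      then have yv: "y = Const c * v" by (simp add: fischer_self_eq_0_iff z_def)
      then have "c \<noteq> 0" using y(2) by auto
      then have "v = Const (inverse c) * y"
        unfolding yv by (simp add: mult.assoc[symmetric] Const_mult[symmetric])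
      then have "v \<in> N" using N_act[OF U_scalar_closed y(1), of "inverse c"] by (simp add: act_scalar)
      then show ?thesis using cyclic_space_minimal[OF stable] sub by blast
    qed simp
  qed
  moreover have "carrier ?M = carrier (cyclic_submodule (U_gl n) ?M v)"
    by (simp add: cyclic_submodule_def)
  ultimately show ?thesis
    using highest_weight_vector_poly_Mat(2)[OF v(1,2) vc] unfolding is_irreducible_highest_weight_def by blast
qed

section \<open>Realising the irreducible modules\<close>

text \<open>Structure carried along an injection to another type of elements:
  \<open>irrep_gl\<close> is chosen among modules of sets of elements of \<open>U_gl n\<close>,
  while the irreducible modules found consist of polynomials.\<close>

definition transport_module :: "('c \<Rightarrow> 'd) \<Rightarrow> ('a, 'c) module \<Rightarrow> ('a, 'd) module" where
  "transport_module \<phi> M =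
     \<lparr>carrier = \<phi> ` carrier M, mult = undefined, one = undefined, zero = \<phi> \<zero>\<^bsub>M\<^esub>,
      add = (\<lambda>x y. \<phi> (the_inv_into (carrier M) \<phi> x \<oplus>\<^bsub>M\<^esub> the_inv_into (carrier M) \<phi> y)),
      smult = (\<lambda>a x. \<phi> (a \<odot>\<^bsub>M\<^esub> the_inv_into (carrier M) \<phi> x))\<rparr>"

lemma transport_module_simps:
  "carrier (transport_module \<phi> M) = \<phi> ` carrier M"
  "\<zero>\<^bsub>transport_module \<phi> M\<^esub> = \<phi> \<zero>\<^bsub>M\<^esub>"
  "inj_on \<phi> (carrier M) \<Longrightarrow> x \<in> carrier M \<Longrightarrow> y \<in> carrier M \<Longrightarrow>
     \<phi> x \<oplus>\<^bsub>transport_module \<phi> M\<^esub> \<phi> y = \<phi> (x \<oplus>\<^bsub>M\<^esub> y)"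
  "inj_on \<phi> (carrier M) \<Longrightarrow> x \<in> carrier M \<Longrightarrow> a \<odot>\<^bsub>transport_module \<phi> M\<^esub> \<phi> x = \<phi> (a \<odot>\<^bsub>M\<^esub> x)"
  by (simp_all add: transport_module_def the_inv_into_f_f)

lemma left_module_transport:
  assumes M: "left_module R M" and inj: "inj_on \<phi> (carrier M)"
  shows "left_module R (transport_module \<phi> M)"
proof -
  interpret M: left_module R M by (rule M)
  note [simp] = transport_module_simps(1,2) transport_module_simps(3,4)[OF inj]
  have "abelian_group (transport_module \<phi> M)"
  proof (rule abelian_groupI)
    fix x assume "x \<in> carrier (transport_module \<phi> M)"
    then obtain y where y: "y \<in> carrier M" "x = \<phi> y" by auto
    then show "\<exists>z\<in>carrier (transport_module \<phi> M). z \<oplus>\<^bsub>transport_module \<phi> M\<^esub> x = \<zero>\<^bsub>transport_module \<phi> M\<^esub>"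
      by (intro bexI[of _ "\<phi> (\<ominus>\<^bsub>M\<^esub> y)"]) (simp_all add: M.M.l_neg)
  qed (auto simp: M.M.a_ac)
  then show ?thesis
    by (intro left_module.intro left_module_axioms.intro M.R.ring_axioms)
      (auto simp: M.smult_closed M.smult_l_distr M.smult_r_distr M.smult_assoc M.smult_one)
qed

lemma irreducible_highest_weight_transport:
  assumes M: "is_irreducible_highest_weight n \<mu> M" and inj: "inj_on \<phi> (carrier M)"
  shows "is_irreducible_highest_weight n \<mu> (transport_module \<phi> M)"
proof -
  let ?N = "transport_module \<phi> M"
  have irr: "irreducible_module (U_gl n) M" using M by (simp add: is_irreducible_highest_weight_def)
  interpret M: left_module "U_gl n" M using irr by (simp add: irreducible_module_def)
  obtain v where v: "highest_weight_vector n \<mu> M v"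
    and gen: "carrier M = {a \<odot>\<^bsub>M\<^esub> v | a. a \<in> carrier (U_gl n)}"
    using M by (auto simp: is_irreducible_highest_weight_def cyclic_submodule_def)
  have vc: "v \<in> carrier M" "v \<noteq> \<zero>\<^bsub>M\<^esub>" using v by (auto simp: highest_weight_vector_def)
  note [simp] = transport_module_simps(1,2) transport_module_simps(3,4)[OF inj]
  have inj_iff: "\<phi> x = \<phi> y \<longleftrightarrow> x = y" if "x \<in> carrier M" "y \<in> carrier M" for x y
    using inj that by (auto dest: inj_onD)
  have "irreducible_module (U_gl n) ?N"
    unfolding irreducible_module_def
  proof (intro conjI allI impI)
    show "left_module (U_gl n) ?N" by (rule left_module_transport[OF M.left_module_axioms inj])
    show "carrier ?N \<noteq> {\<zero>\<^bsub>?N\<^esub>}"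
      using vc inj_iff[OF vc(1) M.M.zero_closed] by (metis transport_module_simps(1,2) imageI singletonD)
    fix H assume H: "submodule H (U_gl n) ?N"
    interpret H: submodule H "U_gl n" ?N by (rule H)
    define K where "K = {x \<in> carrier M. \<phi> x \<in> H}"
    have "H \<subseteq> \<phi> ` carrier M" using H.subset by simp
    then have HK: "H = \<phi> ` K" by (auto simp: K_def)
    have "submodule K (U_gl n) M"
    proof (rule M.submoduleI_left)
      show "\<zero>\<^bsub>M\<^esub> \<in> K" using H.one_closed by (simp add: K_def)
      fix x y assume "x \<in> K" "y \<in> K"
      then show "x \<oplus>\<^bsub>M\<^esub> y \<in> K" using H.m_closed[of "\<phi> x" "\<phi> y"] by (simp add: K_def)
    next
      fix a x assume "a \<in> carrier (U_gl n)" "x \<in> K"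
      then show "a \<odot>\<^bsub>M\<^esub> x \<in> K" using H.smult_closed[of a "\<phi> x"] by (simp add: K_def M.smult_closed)
    qed (auto simp: K_def)
    then have "K = {\<zero>\<^bsub>M\<^esub>} \<or> K = carrier M" using irr by (simp add: irreducible_module_def)
    then show "H = {\<zero>\<^bsub>?N\<^esub>} \<or> H = carrier ?N" by (auto simp: HK)
  qed
  moreover have "highest_weight_vector n \<mu> ?N (\<phi> v)"
    using v inj_iff[OF vc(1) M.M.zero_closed] by (simp add: highest_weight_vector_def)
  moreover have "carrier ?N = carrier (cyclic_submodule (U_gl n) ?N (\<phi> v))"
  proof -
    have "carrier (cyclic_submodule (U_gl n) ?N (\<phi> v)) = {\<phi> (a \<odot>\<^bsub>M\<^esub> v) | a. a \<in> carrier (U_gl n)}"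
      using vc by (simp add: cyclic_submodule_def)
    also have "\<dots> = \<phi> ` carrier M" unfolding gen by auto
    finally show ?thesis by simp
  qed
  ultimately show ?thesis by (auto simp: is_irreducible_highest_weight_def)
qed

text \<open>A cyclic module embeds into the sets of elements of \<^term>\<open>U_gl n\<close> by sending \<open>x\<close> to the coset of
  the annihilator of the generator that maps the generator to \<open>x\<close>.\<close>

lemma irrep_gl_irreducible:
  assumes M: "is_irreducible_highest_weight n \<mu> M"
  shows "is_irreducible_highest_weight n \<mu> (irrep_gl n \<mu>)"
proof -
  obtain v where gen: "carrier M = {a \<odot>\<^bsub>M\<^esub> v | a. a \<in> carrier (U_gl n)}"
    using M by (auto simp: is_irreducible_highest_weight_def cyclic_submodule_def)
  define \<phi> where "\<phi> = (\<lambda>x. {a \<in> carrier (U_gl n). a \<odot>\<^bsub>M\<^esub> v = x})"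
  have "inj_on \<phi> (carrier M)"
    by (rule inj_onI) (auto simp: gen \<phi>_def)
  from irreducible_highest_weight_transport[OF M this] show ?thesis
    unfolding irrep_gl_def by (rule someI[of "is_irreducible_highest_weight n \<mu>"])
qed


section \<open>Weights of highest weight vectors are partitions\<close>

text \<open>Deleting the trailing zeros of a weakly decreasing sequence leaves a partition.\<close>

lemma partition_of_antitone:
  fixes \<rho> :: "nat \<Rightarrow> nat"
  assumes anti: "\<And>i. i \<in> {1..n} \<Longrightarrow> Suc i \<in> {1..n} \<Longrightarrow> \<rho> (Suc i) \<le> \<rho> i"
  obtains \<mu> where "is_partition \<mu> (\<Sum>i=1..n. \<rho> i)" "\<And>i. i \<in> {1..n} \<Longrightarrow> part \<mu> i = \<rho> i"
proof -
  have anti': "\<rho> j \<le> \<rho> i" if "1 \<le> i" "i \<le> j" "j \<le> n" for i j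
    using that(2,3)
  proof (induction j rule: dec_induct)
    case (step j)
    then have "\<rho> (Suc j) \<le> \<rho> j" using that(1) by (intro anti) auto
    then show ?case using step by simp
  qed simp
  define D where "D = {i \<in> {1..n}. \<rho> i \<noteq> 0}"
  define k where "k = card D"
  have "D = {1..card D}"
  proof (rule downward_closed_eq_interval)
    fix c c' assume "c \<in> D" "1 \<le> c'" "c' \<le> c"
    then show "c' \<in> D" using anti'[of c' c] by (auto simp: D_def)
  qed (auto simp: D_def)
  then have D: "D = {1..k}" by (simp add: k_def)
  have "D \<subseteq> {1..n}" by (auto simp: D_def)
  from card_mono[OF finite_atLeastAtMost this] have "k \<le> n" by (simp add: k_def)
  define \<mu> where "\<mu> = map \<rho> [1..<Suc k]"
  have nth: "\<mu> ! i = \<rho> (Suc i)" if "i < k" for i using that by (simp add: \<mu>_def One_nat_def del: upt_Suc)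
  have len: "length \<mu> = k" by (simp add: \<mu>_def)
  have part: "part \<mu> i = \<rho> i" if i: "i \<in> {1..n}" for i
  proof (cases "i \<le> k")
    case True
    then show ?thesis using i nth[of "i - 1"] by (auto simp: part_def len)
  next
    case False
    then have "i \<notin> D" by (simp add: D)
    then show ?thesis using i False by (simp add: part_def len D_def)
  qed
  have "is_partition \<mu> (\<Sum>i=1..n. \<rho> i)"
    unfolding is_partition_def
  proof (intro conjI)
    show "sorted_wrt (\<ge>) \<mu>"
      unfolding sorted_wrt_iff_nth_less len using anti' \<open>k \<le> n\<close> by (auto simp: nth)
    show "0 \<notin> set \<mu>"
    proof
      assume "0 \<in> set \<mu>"
      then obtain i where i: "i < k" "\<mu> ! i = 0" by (auto simp: in_set_conv_nth len)
      then have "\<rho> (Suc i) = 0" by (simp add: nth)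
      moreover have "Suc i \<in> D" unfolding D using i by simp
      ultimately show False by (simp add: D_def)
    qed
    have "sum_list \<mu> = (\<Sum>i\<in>{1..<Suc k}. \<rho> i)"
      unfolding \<mu>_def by (simp add: sum_list_distinct_conv_sum_set del: upt_Suc)
    also have "{1..<Suc k} = D" by (simp add: D atLeastLessThanSuc_atLeastAtMost)
    also have "(\<Sum>i\<in>D. \<rho> i) = (\<Sum>i=1..n. \<rho> i)"
      by (intro sum.mono_neutral_left) (auto simp: D_def)
    finally show "sum_list \<mu> = (\<Sum>i=1..n. \<rho> i)" .
  qed
  then show ?thesis using part that by blast
qed

text \<open>Parts are positive, so their values on \<open>{1..n}\<close> determine the length as
  well.\<close>

lemma partition_eqI:
  assumes \<mu>: "is_partition \<mu> N" "length \<mu> \<le> n" and \<nu>: "is_partition \<nu> N'" "length \<nu> \<le> n"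
    and eq: "\<And>i. i \<in> {1..n} \<Longrightarrow> part \<mu> i = part \<nu> i"
  shows "\<mu> = \<nu>"
proof -
  have pos: "\<mu> ! i > 0" if "is_partition \<mu> N" "i < length \<mu>" for \<mu> N i
    using that nth_mem[of i \<mu>] unfolding is_partition_def by (metis gr0I)
  have le: "length \<mu> \<le> length \<nu>"
    if "is_partition \<mu> N" "length \<mu> \<le> n" "\<And>i. i \<in> {1..n} \<Longrightarrow> part \<mu> i = part \<nu> i" for \<mu> \<nu> N
  proof (rule ccontr)
    assume "\<not> ?thesis"
    then have "length \<mu> \<in> {1..n}" "length \<mu> - 1 < length \<mu>" "length \<nu> < length \<mu>" using that(2) by auto
    then show False using that(3)[of "length \<mu>"] pos[OF that(1), of "length \<mu> - 1"] by (auto simp: part_def)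
  qed
  show ?thesis
  proof (rule nth_equalityI)
    show len: "length \<mu> = length \<nu>" using le[OF \<mu>, of \<nu>] le[OF \<nu>, of \<mu>] eq by (simp add: order_antisym)
    fix i assume i: "i < length \<mu>"
    then have "part \<mu> (Suc i) = part \<nu> (Suc i)" using \<mu>(2) by (intro eq) auto
    then show "\<mu> ! i = \<nu> ! i" using i len by (simp add: part_def)
  qed
qed

lemma hw_vector_partition:
  assumes f: "f \<in> hw_space n \<rho>" "f \<in> col_homogeneous n (\<lambda>_. l)" "f \<noteq> 0"
  obtains \<mu> where "is_partition \<mu> (n * l)" "f \<in> hw_space n (part \<mu>)"
proof -
  obtain a where a: "a \<in> keys f" using f(3) by (metis keys_eq_empty ex_in_conv)
  have "(\<Sum>i=1..n. \<rho> i) = (\<Sum>i=1..n. row_sum n a i)"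
    using hw_space_row_sum[OF f(1) a] by (intro sum.cong) auto
  also have "\<dots> = n * l" using sum_row_sum[OF f(2) a] by simp
  finally have sum: "(\<Sum>i=1..n. \<rho> i) = n * l" .
  obtain \<mu> where \<mu>: "is_partition \<mu> (n * l)" "\<And>i. i \<in> {1..n} \<Longrightarrow> part \<mu> i = \<rho> i"
    using partition_of_antitone[of n \<rho>] hw_space_dominant[OF f(1,3)] unfolding sum by blast
  then show ?thesis using that f(1) hw_space_cong[of n "part \<mu>" \<rho>] by simp
qed

text \<open>The weight only sees the first \<open>n\<close> parts, but these already add up to the
  degree \<open>n * l\<close>, so no part is left.\<close>

lemma hw_vector_length_le:
  assumes \<mu>: "is_partition \<mu> (n * l)"
    and f: "f \<in> hw_space n (part \<mu>)" "f \<in> col_homogeneous n (\<lambda>_. l)" "f \<noteq> 0"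
  shows "length \<mu> \<le> n"
proof -
  obtain a where a: "a \<in> keys f" using f(3) by (metis keys_eq_empty ex_in_conv)
  have "(\<Sum>i=1..n. part \<mu> i) = (\<Sum>i=1..n. row_sum n a i)"
    using hw_space_row_sum[OF f(1) a] by (intro sum.cong) auto
  also have "\<dots> = n * l" using sum_row_sum[OF f(2) a] by simp
  finally show ?thesis using sum_part(2)[OF \<mu>, of n] by simp
qed

lemma finite_partitions: "finite {\<mu>. is_partition \<mu> N}"
proof (rule finite_subset)
  show "{\<mu>. is_partition \<mu> N} \<subseteq> {xs. set xs \<subseteq> {..N} \<and> length xs \<le> N}"
  proof
    fix \<mu> assume "\<mu> \<in> {\<mu>. is_partition \<mu> N}"
    then have \<mu>: "0 \<notin> set \<mu>" "sum_list \<mu> = N" by (auto simp: is_partition_def)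
    have "length \<mu> \<le> sum_list \<mu>"
      using \<mu>(1) by (induction \<mu>) (auto simp: Suc_le_eq)
    moreover have "set \<mu> \<subseteq> {..N}" using \<mu>(2) member_le_sum_list[of _ \<mu>] by auto
    ultimately show "\<mu> \<in> {xs. set xs \<subseteq> {..N} \<and> length xs \<le> N}" using \<mu>(2) by simp
  qed
qed (rule finite_lists_length_le, simp)


section \<open>Decomposition of invariant subspaces\<close>

lemma finite_subset_sum_orthogonal:
  assumes A: "finite A" and z: "\<And>x y. x \<in> A \<Longrightarrow> y \<in> A \<Longrightarrow> x \<noteq> y \<Longrightarrow> fischer (z x) (z y) = 0"
    and sum: "(\<Sum>x\<in>A. z x) = 0" and x: "x \<in> A"
  shows "z x = 0"
proof -
  have "0 = fischer (\<Sum>y\<in>A. z y) (z x)" by (simp add: sum)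
  also have "\<dots> = (\<Sum>y\<in>A. if y = x then fischer (z x) (z x) else 0)"
    unfolding fischer_sum_left using z x by (intro sum.cong) auto
  also have "\<dots> = fischer (z x) (z x)" using A x by simp
  finally show ?thesis by (simp add: fischer_self_eq_0_iff)
qed

lemma gl_stable_sum:
  assumes A: "finite A" and N: "\<And>x. x \<in> A \<Longrightarrow> gl_stable n (N x)"
  shows "gl_stable n {\<Sum>x\<in>A. z x | z. \<forall>x\<in>A. z x \<in> N x}"
proof -
  have sub: "poly_vs.subspace (N x)" if "x \<in> A" for x using N[OF that] by (simp add: gl_stable_def)
  show ?thesis
    unfolding gl_stable_def
  proof (intro conjI ballI poly_vs.subspaceI)
    have "\<forall>x\<in>A. 0 \<in> N x" using sub by (simp add: poly_vs.subspace_0)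
    then show "0 \<in> {\<Sum>x\<in>A. z x | z. \<forall>x\<in>A. z x \<in> N x}"
      by (intro CollectI exI[of _ "\<lambda>_. 0"]) simp
  next
    fix f g assume "f \<in> {\<Sum>x\<in>A. z x | z. \<forall>x\<in>A. z x \<in> N x}" "g \<in> {\<Sum>x\<in>A. z x | z. \<forall>x\<in>A. z x \<in> N x}"
    then obtain z w where "f = (\<Sum>x\<in>A. z x)" "\<forall>x\<in>A. z x \<in> N x" "g = (\<Sum>x\<in>A. w x)" "\<forall>x\<in>A. w x \<in> N x"
      by blast
    then show "f + g \<in> {\<Sum>x\<in>A. z x | z. \<forall>x\<in>A. z x \<in> N x}"
      using sub by (intro CollectI exI[of _ "\<lambda>x. z x + w x"]) (auto simp: sum.distrib poly_vs.subspace_add)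
  next
    fix c f assume "f \<in> {\<Sum>x\<in>A. z x | z. \<forall>x\<in>A. z x \<in> N x}"
    then obtain z where z: "f = (\<Sum>x\<in>A. z x)" "\<forall>x\<in>A. z x \<in> N x" by blast
    have "Const c * z x \<in> N x" if "x \<in> A" for x
      using poly_vs.subspace_scale[OF sub[OF that]] z(2) that by blast
    then show "Const c * f \<in> {\<Sum>x\<in>A. z x | z. \<forall>x\<in>A. z x \<in> N x}"
      by (intro CollectI exI[of _ "\<lambda>x. Const c * z x"]) (auto simp: z(1) sum_distrib_left)
  next
    fix i j f assume ij: "i \<in> {1..n}" "j \<in> {1..n}" and "f \<in> {\<Sum>x\<in>A. z x | z. \<forall>x\<in>A. z x \<in> N x}"
    then obtain z where z: "f = (\<Sum>x\<in>A. z x)" "\<forall>x\<in>A. z x \<in> N x" by blast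
    have "col_op {1..n} i j (z x) \<in> N x" if "x \<in> A" for x
      using N[OF that] z(2) that ij unfolding gl_stable_def by blast
    then show "col_op {1..n} i j f \<in> {\<Sum>x\<in>A. z x | z. \<forall>x\<in>A. z x \<in> N x}"
      by (intro CollectI exI[of _ "\<lambda>x. col_op {1..n} i j (z x)"]) (auto simp: z(1) col_op_sum)
  qed
qed

text \<open>The orthogonal complement of an invariant subspace is invariant; were it nonzero, it would
  contain a highest weight vector.\<close>

lemma gl_stable_eq_of_hw_subset:
  assumes N: "gl_stable n N" "N \<subseteq> col_homogeneous n d" and Q: "gl_stable n Q" "Q \<subseteq> N"
    and hw: "\<And>w \<rho>. w \<in> N \<Longrightarrow> w \<noteq> 0 \<Longrightarrow> w \<in> hw_space n \<rho> \<Longrightarrow> w \<in> Q"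
  shows "Q = N"
proof (rule equalityI[OF Q(2)], rule subsetI)
  fix x assume x: "x \<in> N"
  have subN: "poly_vs.subspace N" and subQ: "poly_vs.subspace Q"
    using N(1) Q(1) by (simp_all add: gl_stable_def)
  obtain S where S: "finite S" "col_homogeneous n d \<subseteq> poly_vs.span S"
    by (rule col_homogeneous_finite_span)
  obtain B where B: "finite B" "fischer_orthogonal B" "poly_vs.span B = Q"
    by (rule subspace_orthogonal_basis[OF subQ S(1)]) (use Q(2) N(2) S(2) in blast)
  define R where "R = {y \<in> N. \<forall>z\<in>Q. fischer y z = 0}"
  have stable: "gl_stable n R"
    unfolding gl_stable_def
  proof (intro conjI ballI)
    show "poly_vs.subspace R"
      by (rule poly_vs.subspaceI)
        (auto simp: R_def poly_vs.subspace_0[OF subN] poly_vs.subspace_add[OF subN]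
          poly_vs.subspace_scale[OF subN] fischer_add_left fischer_Const_left)
    fix i j y assume "i \<in> {1..n}" "j \<in> {1..n}" "y \<in> R"
    then show "col_op {1..n} i j y \<in> R"
      using N(1) Q(1) by (simp add: R_def gl_stable_def fischer_col_op)
  qed
  have "R = {0}"
  proof (rule ccontr)
    assume "R \<noteq> {0}"
    moreover have "R \<subseteq> col_homogeneous n d" using N(2) by (auto simp: R_def)
    ultimately obtain y a where y: "y \<in> R" "y \<noteq> 0" "y \<in> hw_space n (row_sum n a)"
      using gl_stable_hw_vector[OF stable] by blast
    \<comment> \<open>Lying in \<open>Q\<close> and orthogonal to it, \<open>y\<close> would be
      orthogonal to itself.\<close>
    then have "y \<in> Q" using hw[of y] by (simp add: R_def)
    then show False using y by (auto simp: R_def fischer_self_eq_0_iff)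
  qed
  obtain y where y: "y \<in> poly_vs.span B" "\<And>z. z \<in> poly_vs.span B \<Longrightarrow> fischer (x - y) z = 0"
    using fischer_orthogonal_projection[OF B(1,2)] by blast
  have "x - y \<in> R"
    using y x Q(2) B(3) by (auto simp: R_def intro: poly_vs.subspace_diff[OF subN])
  then have "x = y" using \<open>R = {0}\<close> by simp
  then show "x \<in> Q" using y(1) B(3) by simp
qed

section \<open>Finite direct sums and the decomposition of a cyclic module\<close>

lemma carrier_direct_sum_finite:
  "finite I \<Longrightarrow> carrier (direct_sum I M) = (\<Pi>\<^sub>E i\<in>I. carrier (M i))"
  by (simp add: direct_sum_def)

text \<open>Closure of \<open>M\<close> under its operations makes the inverse additive and linear.
  The isomorphism of the decomposition is built starting from the direct sum and then
  reversed.\<close>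

lemma modules_isomorphic_sym:
  assumes \<phi>: "\<phi> \<in> module_iso R M N"
    and add: "\<And>x y. x \<in> carrier M \<Longrightarrow> y \<in> carrier M \<Longrightarrow> x \<oplus>\<^bsub>M\<^esub> y \<in> carrier M"
    and smult: "\<And>a x. a \<in> carrier R \<Longrightarrow> x \<in> carrier M \<Longrightarrow> a \<odot>\<^bsub>M\<^esub> x \<in> carrier M"
  shows "modules_isomorphic R N M"
proof -
  define \<psi> where "\<psi> = the_inv_into (carrier M) \<phi>"
  have bij: "bij_betw \<phi> (carrier M) (carrier N)"
    and hom: "\<And>x y. x \<in> carrier M \<Longrightarrow> y \<in> carrier M \<Longrightarrow> \<phi> (x \<oplus>\<^bsub>M\<^esub> y) = \<phi> x \<oplus>\<^bsub>N\<^esub> \<phi> y"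
    and lin: "\<And>a x. a \<in> carrier R \<Longrightarrow> x \<in> carrier M \<Longrightarrow> \<phi> (a \<odot>\<^bsub>M\<^esub> x) = a \<odot>\<^bsub>N\<^esub> \<phi> x"
    using \<phi> by (auto simp: module_iso_def iso_def hom_def)
  have inj: "inj_on \<phi> (carrier M)" using bij by (rule bij_betw_imp_inj_on)
  have \<psi>\<phi>: "\<psi> (\<phi> x) = x" if "x \<in> carrier M" for x
    unfolding \<psi>_def using inj that by (rule the_inv_into_f_f)
  have surj: "\<exists>x\<in>carrier M. y = \<phi> x" if "y \<in> carrier N" for y
    using bij that by (auto simp: bij_betw_def)
  have "bij_betw \<psi> (carrier N) (carrier M)"
    unfolding \<psi>_def by (rule bij_betw_the_inv_into[OF bij])
  moreover have "\<psi> (y \<oplus>\<^bsub>N\<^esub> z) = \<psi> y \<oplus>\<^bsub>M\<^esub> \<psi> z" if yz: "y \<in> carrier N" "z \<in> carrier N" for y z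
  proof -
    obtain x w where "x \<in> carrier M" "y = \<phi> x" "w \<in> carrier M" "z = \<phi> w"
      using surj[OF yz(1)] surj[OF yz(2)] by blast
    then show ?thesis by (simp add: hom[symmetric] \<psi>\<phi> add)
  qed
  moreover have "\<psi> (a \<odot>\<^bsub>N\<^esub> y) = a \<odot>\<^bsub>M\<^esub> \<psi> y" if ay: "a \<in> carrier R" "y \<in> carrier N" for a y
  proof -
    obtain x where "x \<in> carrier M" "y = \<phi> x" using surj[OF ay(2)] by blast
    then show ?thesis using ay(1) by (simp add: lin[symmetric] \<psi>\<phi> smult)
  qed
  ultimately have "\<psi> \<in> module_iso R N M"
    by (auto simp: module_iso_def iso_def hom_def dest: bij_betw_apply)
  then show ?thesis by (auto simp: modules_isomorphic_def)
qed

text \<open>The modules generated by the basis vectors exhaust the cyclic module because their sum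
  contains all its highest weight vectors; uniqueness of irreducible highest weight modules
  identifies each of them with \<open>irrep_gl\<close>.\<close>

lemma cyclic_submodule_decomposition:
  fixes n l :: nat and B :: "nat list \<Rightarrow> matrix_poly set"
  assumes f: "f \<in> col_homogeneous n (\<lambda>_. l)"
    and B: "\<And>\<mu>. finite (B \<mu>)" "\<And>\<mu>. fischer_orthogonal (B \<mu>)"
      "\<And>\<mu>. poly_vs.span (B \<mu>) = hw_space n (part \<mu>) \<inter> cyclic_space n f"
  shows "modules_isomorphic (U_gl n) (cyclic_submodule (U_gl n) (poly_Mat n) f)
    (direct_sum {\<mu>. is_partition \<mu> (n * l)} (\<lambda>\<mu>. module_power (irrep_gl n \<mu>) (card (B \<mu>))))"
proof -
  define W where "W = col_homogeneous n (\<lambda>_. l)"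
  define N where "N = cyclic_space n f"
  define P where "P = {\<mu>. is_partition \<mu> (n * l)}"
  define m where "m = (\<lambda>\<mu>. card (B \<mu>))"
  \<comment> \<open>One index for each pair of a weight and a copy, so that the nested direct sums
    become a single finite sum.\<close>
  define I where "I = (SIGMA \<mu>:P. {..<m \<mu>})"
  define D where "D = direct_sum P (\<lambda>\<mu>. module_power (irrep_gl n \<mu>) (m \<mu>))"
  have finP: "finite P" unfolding P_def by (rule finite_partitions)
  then have finI: "finite I" by (simp add: I_def)
  have N_stable: "gl_stable n N" unfolding N_def by (rule gl_stable_cyclic_space)
  have N_W: "N \<subseteq> W"
    unfolding N_def W_def by (rule cyclic_space_minimal[OF gl_stable_col_homogeneous f])
  have "\<exists>b. \<forall>\<mu>. bij_betw (b \<mu>) {..<m \<mu>} (B \<mu>)"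
    using ex_bij_betw_nat_finite[OF B(1)] unfolding m_def atLeast0LessThan by metis
  then obtain b where b: "\<And>\<mu>. bij_betw (b \<mu>) {..<m \<mu>} (B \<mu>)" by blast
  have b_mem: "b \<mu> i \<in> hw_space n (part \<mu>)" "b \<mu> i \<in> N" "b \<mu> i \<in> W" "b \<mu> i \<noteq> 0" "b \<mu> i \<in> carrier (poly_Mat n)"
    if i: "i < m \<mu>" for \<mu> i
  proof -
    have mem: "b \<mu> i \<in> B \<mu>" using bij_betw_apply[OF b] i by auto
    then show "b \<mu> i \<in> hw_space n (part \<mu>)" and N': "b \<mu> i \<in> N"
      using poly_vs.span_superset[of "B \<mu>"] B(3)[of \<mu>] by (auto simp: N_def)
    show "b \<mu> i \<in> W" using N' N_W by blast
    then show "b \<mu> i \<in> carrier (poly_Mat n)" using col_homogeneous_subset_carrier by (auto simp: W_def)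
    show "b \<mu> i \<noteq> 0" using B(2)[of \<mu>] mem by (auto simp: fischer_orthogonal_def)
  qed
  have b_orth: "fischer (b \<mu> i) (b \<nu> j) = 0"
    if p: "(\<mu>, i) \<in> I" and q: "(\<nu>, j) \<in> I" and ne: "(\<mu>, i) \<noteq> (\<nu>, j)" for \<mu> i \<nu> j
  proof (cases "\<mu> = \<nu>")
    case True
    then have "i \<noteq> j" "i < m \<mu>" "j < m \<mu>" using p q ne by (auto simp: I_def)
    then have "b \<mu> i \<noteq> b \<mu> j" "b \<mu> i \<in> B \<mu>" "b \<mu> j \<in> B \<mu>"
      using b[of \<mu>] by (auto simp: bij_betw_def inj_on_def)
    then show ?thesis using B(2)[of \<mu>] True unfolding fischer_orthogonal_def by blast
  next
    case False
    have i: "i < m \<mu>" and j: "j < m \<nu>" and \<mu>: "is_partition \<mu> (n * l)" and \<nu>: "is_partition \<nu> (n * l)"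
      using p q by (auto simp: I_def P_def)
    \<comment> \<open>Distinct partitions of length at most \<open>n\<close> differ in one of their
      first \<open>n\<close> parts, so the weights are distinct; the length bound comes from the
      existence of the two vectors.\<close>
    have "length \<mu> \<le> n" "length \<nu> \<le> n"
      using hw_vector_length_le[OF \<mu> b_mem(1)[OF i] _ b_mem(4)[OF i]] b_mem(3)[OF i]
        hw_vector_length_le[OF \<nu> b_mem(1)[OF j] _ b_mem(4)[OF j]] b_mem(3)[OF j] by (auto simp: W_def)
    then obtain k where "k \<in> {1..n}" "part \<mu> k \<noteq> part \<nu> k"
      using partition_eqI[OF \<mu> _ \<nu>] False by blast
    then show ?thesis by (rule hw_space_orthogonal[OF b_mem(1)[OF i] b_mem(1)[OF j]])
  qed
  define C where "C = (\<lambda>p. cyclic_space n (b (fst p) (snd p)))"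
  have C_orth: "fischer x y = 0" if "p \<in> I" "q \<in> I" "p \<noteq> q" "x \<in> C p" "y \<in> C q" for p q x y
  proof -
    obtain \<mu> i \<nu> j where p: "p = (\<mu>, i)" and q: "q = (\<nu>, j)" by (cases p, cases q)
    then have i: "i < m \<mu>" and j: "j < m \<nu>" using that by (auto simp: I_def)
    have "fischer (b \<mu> i) (b \<nu> j) = 0" using that by (intro b_orth) (auto simp: p q)
    then show ?thesis
      using cyclic_spaces_orthogonal[OF b_mem(1,5)[OF i] b_mem(1)[OF j]] that(4,5) by (simp add: C_def p q)
  qed
  have C_stable: "gl_stable n (C p)" for p unfolding C_def by (rule gl_stable_cyclic_space)
  have C_sub: "C p \<subseteq> N" if "p \<in> I" for p
    using that b_mem(2) unfolding C_def by (intro cyclic_space_minimal[OF N_stable]) (auto simp: I_def)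
  define Q where "Q = {\<Sum>p\<in>I. z p | z. \<forall>p\<in>I. z p \<in> C p}"
  have Q_stable: "gl_stable n Q" unfolding Q_def by (rule gl_stable_sum[OF finI C_stable])
  have "Q = N"
  proof (rule gl_stable_eq_of_hw_subset[OF N_stable N_W[unfolded W_def] Q_stable])
    show "Q \<subseteq> N"
    proof
      fix x assume "x \<in> Q"
      then obtain z where "x = (\<Sum>p\<in>I. z p)" "\<forall>p\<in>I. z p \<in> C p" by (auto simp: Q_def)
      then show "x \<in> N"
        using N_stable C_sub by (auto simp: gl_stable_def intro!: poly_vs.subspace_sum)
    qed
    fix w \<rho> assume w: "w \<in> N" "w \<noteq> 0" "w \<in> hw_space n \<rho>"
    obtain \<mu> where \<mu>: "is_partition \<mu> (n * l)" "w \<in> hw_space n (part \<mu>)"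
      using hw_vector_partition[OF w(3) _ w(2)] w(1) N_W by (auto simp: W_def)
    have "B \<mu> \<subseteq> Q"
    proof
      fix x assume "x \<in> B \<mu>"
      then obtain i where i: "i < m \<mu>" "x = b \<mu> i"
        using b[of \<mu>] by (auto simp: bij_betw_def)
      have mem: "(\<mu>, i) \<in> I" using i \<mu>(1) by (simp add: I_def P_def)
      define z where "z = (\<lambda>p. if p = (\<mu>, i) then x else 0)"
      have "x \<in> C (\<mu>, i)" unfolding C_def i(2) fst_conv snd_conv by (rule mem_cyclic_space)
      then have "\<forall>p\<in>I. z p \<in> C p"
        using C_stable by (auto simp: z_def gl_stable_def poly_vs.subspace_0)
      moreover have "(\<Sum>p\<in>I. z p) = x" using finI mem by (simp add: z_def)
      ultimately show "x \<in> Q" unfolding Q_def by blast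
    qed
    moreover have "w \<in> poly_vs.span (B \<mu>)" using \<mu>(2) w(1) B(3)[of \<mu>] by (simp add: N_def)
    ultimately show "w \<in> Q"
      using poly_vs.span_minimal[of "B \<mu>" Q] Q_stable by (auto simp: gl_stable_def)
  qed
  have irr: "is_irreducible_highest_weight n \<mu> (cyclic_submodule (U_gl n) (poly_Mat n) (b \<mu> i))"
    if i: "i < m \<mu>" for \<mu> i
    using b_mem[OF i] by (intro irreducible_cyclic_hw[of _ _ _ "\<lambda>_. l"]) (auto simp: W_def)
  \<comment> \<open>The realization just found justifies the choice in \<open>irrep_gl\<close>. If
    \<open>m \<mu> = 0\<close>, as for partitions with more than \<open>n\<close> parts, the power
    is the zero module and no property of \<open>irrep_gl n \<mu>\<close> enters.\<close>
  have irrep: "is_irreducible_highest_weight n \<mu> (irrep_gl n \<mu>)" if "i < m \<mu>" for \<mu> i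
    by (rule irrep_gl_irreducible[OF irr[OF that]])
  have irrep_module: "left_module (U_gl n) (irrep_gl n \<mu>)" if "i < m \<mu>" for \<mu> i
    using irrep[OF that] by (simp add: is_irreducible_highest_weight_def irreducible_module_def)
  define \<psi> where "\<psi> = (\<lambda>\<mu> i. SOME \<psi>. \<psi> \<in>
      module_iso (U_gl n) (irrep_gl n \<mu>) (cyclic_submodule (U_gl n) (poly_Mat n) (b \<mu> i)))"
  have \<psi>: "\<psi> \<mu> i \<in> module_iso (U_gl n) (irrep_gl n \<mu>) (cyclic_submodule (U_gl n) (poly_Mat n) (b \<mu> i))"
    if i: "i < m \<mu>" for \<mu> i
  proof -
    have "module_iso (U_gl n) (irrep_gl n \<mu>) (cyclic_submodule (U_gl n) (poly_Mat n) (b \<mu> i)) \<noteq> {}"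
      using irreducible_highest_weight_unique[OF irrep[OF i] irr[OF i]]
      unfolding modules_isomorphic_def .
    then obtain \<chi> where
      "\<chi> \<in> module_iso (U_gl n) (irrep_gl n \<mu>) (cyclic_submodule (U_gl n) (poly_Mat n) (b \<mu> i))"
      by blast
    then show ?thesis
      unfolding \<psi>_def
      by (rule someI[of "\<lambda>\<psi>. \<psi> \<in>
        module_iso (U_gl n) (irrep_gl n \<mu>) (cyclic_submodule (U_gl n) (poly_Mat n) (b \<mu> i))" \<chi>])
  qed
  have \<psi>_bij: "bij_betw (\<psi> \<mu> i) (carrier (irrep_gl n \<mu>)) (C (\<mu>, i))"
    and \<psi>_add: "\<And>x y. x \<in> carrier (irrep_gl n \<mu>) \<Longrightarrow> y \<in> carrier (irrep_gl n \<mu>) \<Longrightarrow>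
       \<psi> \<mu> i (x \<oplus>\<^bsub>irrep_gl n \<mu>\<^esub> y) = \<psi> \<mu> i x + \<psi> \<mu> i y"
    and \<psi>_smult: "\<And>a x. a \<in> carrier (U_gl n) \<Longrightarrow> x \<in> carrier (irrep_gl n \<mu>) \<Longrightarrow>
       \<psi> \<mu> i (a \<odot>\<^bsub>irrep_gl n \<mu>\<^esub> x) = act n a (\<psi> \<mu> i x)"
    if "i < m \<mu>" for \<mu> i
    using \<psi>[OF that] by (auto simp: module_iso_def iso_def hom_def carrier_cyclic_submodule C_def)
  have carrier_D: "carrier D = (\<Pi>\<^sub>E \<mu>\<in>P. \<Pi>\<^sub>E i\<in>{..<m \<mu>}. carrier (irrep_gl n \<mu>))"
    by (simp add: D_def carrier_direct_sum_finite[OF finP] module_power_def carrier_direct_sum_finite)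
  have add_D: "x \<oplus>\<^bsub>D\<^esub> y = (\<lambda>\<mu>\<in>P. \<lambda>i\<in>{..<m \<mu>}. x \<mu> i \<oplus>\<^bsub>irrep_gl n \<mu>\<^esub> y \<mu> i)"
    and smult_D: "a \<odot>\<^bsub>D\<^esub> x = (\<lambda>\<mu>\<in>P. \<lambda>i\<in>{..<m \<mu>}. a \<odot>\<^bsub>irrep_gl n \<mu>\<^esub> x \<mu> i)" for a x y
    by (simp_all add: D_def direct_sum_def module_power_def)
  have D_mem: "x \<mu> i \<in> carrier (irrep_gl n \<mu>)" if "x \<in> carrier D" "\<mu> \<in> P" "i < m \<mu>" for x \<mu> i
    using that unfolding carrier_D by (auto dest!: PiE_mem)
  have irrep_add: "x \<oplus>\<^bsub>irrep_gl n \<mu>\<^esub> y \<in> carrier (irrep_gl n \<mu>)"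
    if "i < m \<mu>" "x \<in> carrier (irrep_gl n \<mu>)" "y \<in> carrier (irrep_gl n \<mu>)" for \<mu> i x y
  proof -
    interpret M: left_module "U_gl n" "irrep_gl n \<mu>" by (rule irrep_module[OF that(1)])
    show ?thesis using that by simp
  qed
  have D_add: "x \<oplus>\<^bsub>D\<^esub> y \<in> carrier D" if "x \<in> carrier D" "y \<in> carrier D" for x y
    unfolding add_D carrier_D
    using D_mem[OF that(1)] D_mem[OF that(2)]
    by (intro restrict_PiE_iff[THEN iffD2] ballI irrep_add) auto
  have D_smult: "a \<odot>\<^bsub>D\<^esub> x \<in> carrier D" if "a \<in> carrier (U_gl n)" "x \<in> carrier D" for a x
    unfolding smult_D carrier_D
    using that(1) D_mem[OF that(2)]
    by (intro restrict_PiE_iff[THEN iffD2] ballI left_module.smult_closed[OF irrep_module]) auto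
  define \<Phi> where "\<Phi> = (\<lambda>x. \<Sum>p\<in>I. \<psi> (fst p) (snd p) (x (fst p) (snd p)))"
  have \<psi>_mem: "\<psi> (fst p) (snd p) (x (fst p) (snd p)) \<in> C p" if "x \<in> carrier D" "p \<in> I" for x p
    using bij_betw_apply[OF \<psi>_bij D_mem[OF that(1)]] that(2) by (cases p) (auto simp: I_def)
  have \<Phi>_mem: "\<Phi> x \<in> N" if x: "x \<in> carrier D" for x
    unfolding \<Phi>_def
  proof (rule poly_vs.subspace_sum)
    show "poly_vs.subspace N" using N_stable by (simp add: gl_stable_def)
    fix p assume p: "p \<in> I"
    show "\<psi> (fst p) (snd p) (x (fst p) (snd p)) \<in> N" using C_sub[OF p] \<psi>_mem[OF x p] by blast
  qed
  have "\<Phi> \<in> module_iso (U_gl n) D (cyclic_submodule (U_gl n) (poly_Mat n) f)"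
    unfolding module_iso_def iso_def hom_def
  proof (intro CollectI conjI ballI funcsetI)
    fix x y assume "x \<in> carrier (add_monoid D)" "y \<in> carrier (add_monoid D)"
    then have xy: "x \<in> carrier D" "y \<in> carrier D" by simp_all
    have "\<Phi> (x \<oplus>\<^bsub>D\<^esub> y) = \<Phi> x + \<Phi> y"
      unfolding \<Phi>_def sum.distrib[symmetric]
      using D_mem[OF xy(1)] D_mem[OF xy(2)]
      by (intro sum.cong refl) (auto simp: add_D I_def \<psi>_add)
    then show "\<Phi> (x \<otimes>\<^bsub>add_monoid D\<^esub> y) =
        \<Phi> x \<otimes>\<^bsub>add_monoid (cyclic_submodule (U_gl n) (poly_Mat n) f)\<^esub> \<Phi> y" by simp
  next
    fix a x assume a: "a \<in> carrier (U_gl n)" and x: "x \<in> carrier D"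
    show "\<Phi> (a \<odot>\<^bsub>D\<^esub> x) = a \<odot>\<^bsub>cyclic_submodule (U_gl n) (poly_Mat n) f\<^esub> \<Phi> x"
      unfolding \<Phi>_def cyclic_submodule_simps act_sum_right[OF a]
      using D_mem[OF x] a by (intro sum.cong refl) (auto simp: smult_D I_def \<psi>_smult)
  next
    fix x assume "x \<in> carrier (add_monoid D)"
    then have x: "x \<in> carrier D" by simp
    from \<Phi>_mem[OF x] show "\<Phi> x \<in> carrier (add_monoid (cyclic_submodule (U_gl n) (poly_Mat n) f))"
      by (simp add: carrier_cyclic_submodule N_def)
  next
    \<comment> \<open>The differences of the components lie in pairwise orthogonal modules and sum
      to 0, so each of them vanishes.\<close>
    have "inj_on \<Phi> (carrier D)"
    proof (rule inj_onI)
      fix x y assume x: "x \<in> carrier D" and y: "y \<in> carrier D" and eq: "\<Phi> x = \<Phi> y"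
      define z where "z = (\<lambda>p. \<psi> (fst p) (snd p) (x (fst p) (snd p)) - \<psi> (fst p) (snd p) (y (fst p) (snd p)))"
      have z_mem: "z p \<in> C p" if "p \<in> I" for p
        unfolding z_def using C_stable[of p] \<psi>_mem[OF x that] \<psi>_mem[OF y that]
        by (intro poly_vs.subspace_diff) (simp_all add: gl_stable_def)
      have "(\<Sum>p\<in>I. z p) = 0" using eq by (simp add: \<Phi>_def z_def sum_subtractf)
      then have z0: "z p = 0" if "p \<in> I" for p
        using finite_subset_sum_orthogonal[OF finI, of z p] C_orth z_mem that by blast
      have comp: "x \<mu> i = y \<mu> i" if "\<mu> \<in> P" "i < m \<mu>" for \<mu> i
      proof -
        have "\<psi> \<mu> i (x \<mu> i) = \<psi> \<mu> i (y \<mu> i)" using z0[of "(\<mu>, i)"] that by (simp add: z_def I_def)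
        then show ?thesis
          using bij_betw_imp_inj_on[OF \<psi>_bij[OF that(2)]] D_mem[OF x that] D_mem[OF y that]
          by (auto dest: inj_onD)
      qed
      have "x \<mu> = y \<mu>" if "\<mu> \<in> P" for \<mu>
      proof (rule PiE_ext)
        show "x \<mu> \<in> (\<Pi>\<^sub>E i\<in>{..<m \<mu>}. carrier (irrep_gl n \<mu>))" using x that unfolding carrier_D by (rule PiE_mem)
        show "y \<mu> \<in> (\<Pi>\<^sub>E i\<in>{..<m \<mu>}. carrier (irrep_gl n \<mu>))" using y that unfolding carrier_D by (rule PiE_mem)
      qed (use comp that in auto)
      then show "x = y" using x y unfolding carrier_D by (intro PiE_ext) auto
    qed
    moreover have "N \<subseteq> \<Phi> ` carrier D"
    proof
      fix w assume "w \<in> N"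
      then obtain z where w: "w = (\<Sum>p\<in>I. z p)" and z: "\<forall>p\<in>I. z p \<in> C p"
        unfolding \<open>Q = N\<close>[symmetric] Q_def by blast
      define x where "x = (\<lambda>\<mu>\<in>P. \<lambda>i\<in>{..<m \<mu>}. the_inv_into (carrier (irrep_gl n \<mu>)) (\<psi> \<mu> i) (z (\<mu>, i)))"
      have x: "x \<mu> i \<in> carrier (irrep_gl n \<mu>)" "\<psi> \<mu> i (x \<mu> i) = z (\<mu>, i)" if "\<mu> \<in> P" "i < m \<mu>" for \<mu> i
      proof -
        have zC: "z (\<mu>, i) \<in> C (\<mu>, i)" using z that by (simp add: I_def)
        note bij = \<psi>_bij[OF that(2)]
        show "x \<mu> i \<in> carrier (irrep_gl n \<mu>)"
          using bij_betw_apply[OF bij_betw_the_inv_into[OF bij] zC] that by (simp add: x_def)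
        show "\<psi> \<mu> i (x \<mu> i) = z (\<mu>, i)"
          using f_the_inv_into_f_bij_betw[OF bij] zC that by (simp add: x_def)
      qed
      have "x \<in> carrier D"
        unfolding carrier_D
      proof (rule PiE_I)
        fix \<mu> assume \<mu>: "\<mu> \<in> P"
        show "x \<mu> \<in> (\<Pi>\<^sub>E i\<in>{..<m \<mu>}. carrier (irrep_gl n \<mu>))"
          by (rule PiE_I) (use x(1)[OF \<mu>] \<mu> in \<open>auto simp: x_def\<close>)
      qed (simp add: x_def)
      moreover have "\<Phi> x = w"
        unfolding \<Phi>_def w by (intro sum.cong) (auto simp: I_def x(2))
      ultimately show "w \<in> \<Phi> ` carrier D" by blast
    qed
    moreover have "\<Phi> ` carrier D \<subseteq> N" using \<Phi>_mem by blast
    ultimately show "bij_betw \<Phi> (carrier (add_monoid D))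
        (carrier (add_monoid (cyclic_submodule (U_gl n) (poly_Mat n) f)))"
      by (auto simp: bij_betw_def carrier_cyclic_submodule N_def)
  qed
  then have "modules_isomorphic (U_gl n) (cyclic_submodule (U_gl n) (poly_Mat n) f) D"
    by (rule modules_isomorphic_sym) (simp_all add: D_add D_smult)
  then show ?thesis by (simp add: D_def P_def m_def)
qed

theorem theorem3p1:
  fixes n l :: nat
  assumes "n \<ge> 1" and "l \<ge> 1"
  shows "\<exists>m :: nat list \<Rightarrow> complex \<Rightarrow> nat.
    (\<forall>\<alpha>. modules_isomorphic (U_gl n)
        (cyclic_submodule (U_gl n) (poly_Mat n) (alpha_det n \<alpha> ^ l))
        (direct_sum {\<mu>. is_partition \<mu> (n * l)} (\<lambda>\<mu>. module_power (irrep_gl n \<mu>) (m \<mu> \<alpha>)))) \<and>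
    (\<forall>\<mu> \<alpha>. is_partition \<mu> (n * l) \<longrightarrow> m \<mu> \<alpha> \<le> kostka \<mu> (replicate n l)) \<and>
    (\<forall>\<mu>. is_partition \<mu> (n * l) \<longrightarrow> m \<mu> 0 = kostka \<mu> (replicate n l))"
proof -
  define f where "f = (\<lambda>\<alpha>. alpha_det n \<alpha> ^ l)"
  define W where "W = col_homogeneous n (\<lambda>_. l)"
  define H where "H = (\<lambda>\<mu> \<alpha>. hw_space n (part \<mu>) \<inter> cyclic_space n (f \<alpha>))"
  have f: "f \<alpha> \<in> W" for \<alpha> unfolding f_def W_def by (rule alpha_det_power_col_homogeneous)
  have cyc_W: "cyclic_space n (f \<alpha>) \<subseteq> W" for \<alpha>
    using f unfolding W_def by (rule cyclic_space_minimal[OF gl_stable_col_homogeneous])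
  \<comment> \<open>The multiplicity will be the size of this basis, chosen for every weight and
    every \<alpha> at once; it is finite because the column degrees are fixed.\<close>
  have "\<exists>B. finite B \<and> fischer_orthogonal B \<and> poly_vs.span B = H \<mu> \<alpha>" for \<mu> \<alpha>
  proof -
    obtain S where S: "finite S" "W \<subseteq> poly_vs.span S"
      unfolding W_def by (rule col_homogeneous_finite_span)
    have "poly_vs.subspace (H \<mu> \<alpha>)"
      unfolding H_def using gl_stable_cyclic_space[of n "f \<alpha>"]
      by (intro poly_vs.subspace_inter subspace_hw_space) (simp add: gl_stable_def)
    moreover have "H \<mu> \<alpha> \<subseteq> poly_vs.span S" using cyc_W S(2) by (auto simp: H_def)
    ultimately show ?thesis using subspace_orthogonal_basis[OF _ S(1)] by metis
  qed
  then obtain B where B: "\<And>\<mu> \<alpha>. finite (B \<mu> \<alpha>)" "\<And>\<mu> \<alpha>. fischer_orthogonal (B \<mu> \<alpha>)"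
    "\<And>\<mu> \<alpha>. poly_vs.span (B \<mu> \<alpha>) = H \<mu> \<alpha>" by metis
  have indep: "poly_vs.independent (B \<mu> \<alpha>)" for \<mu> \<alpha> by (rule fischer_orthogonal_independent[OF B(1,2)])
  have iso: "modules_isomorphic (U_gl n) (cyclic_submodule (U_gl n) (poly_Mat n) (f \<alpha>))
      (direct_sum {\<mu>. is_partition \<mu> (n * l)} (\<lambda>\<mu>. module_power (irrep_gl n \<mu>) (card (B \<mu> \<alpha>))))" for \<alpha>
    using f[of \<alpha>] B unfolding W_def H_def by (intro cyclic_submodule_decomposition) auto
  have le: "card (B \<mu> \<alpha>) \<le> kostka \<mu> (replicate n l)" if "is_partition \<mu> (n * l)" for \<mu> \<alpha>
  proof (rule independent_hw_card_le[OF that B(1) indep])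
    show "B \<mu> \<alpha> \<subseteq> hw_space n (part \<mu>) \<inter> col_homogeneous n (\<lambda>_. l)"
      using poly_vs.span_superset[of "B \<mu> \<alpha>"] B(3)[of \<mu> \<alpha>] cyc_W[of \<alpha>] by (auto simp: H_def W_def)
  qed
  have ge: "kostka \<mu> (replicate n l) \<le> card (B \<mu> 0)" if \<mu>: "is_partition \<mu> (n * l)" for \<mu>
  proof -
    have "W \<subseteq> cyclic_space n (f 0)"
      unfolding W_def
      by (rule gl_stable_diagonal_generates[OF gl_stable_cyclic_space])
        (use mem_cyclic_space[of "f 0" n] in \<open>simp add: f_def alpha_det_0\<close>)
    then have HW: "hw_space n (part \<mu>) \<inter> W \<subseteq> poly_vs.span (B \<mu> 0)" by (auto simp: B(3) H_def)
    obtain A where A: "finite A" "poly_vs.independent A" "card A = kostka \<mu> (replicate n l)"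
      "A \<subseteq> hw_space n (part \<mu>) \<inter> col_homogeneous n (\<lambda>_. l)"
      by (rule independent_tableau_minors[OF \<mu>])
    \<comment> \<open>The independent tableau products now lie in the span of the chosen basis, so
      their number bounds its size from below.\<close>
    have "A \<subseteq> poly_vs.span (B \<mu> 0)" using A(4) HW by (auto simp: W_def)
    then have "card A \<le> card (B \<mu> 0)" using poly_vs.independent_span_bound[OF B(1) A(2)] by blast
    then show ?thesis by (simp add: A(3))
  qed
  show ?thesis
    using iso le le_antisym[OF le ge] by (intro exI[of _ "\<lambda>\<mu> \<alpha>. card (B \<mu> \<alpha>)"]) (auto simp: f_def)
qed

end
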